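(* Let $1\le m\le n$ and let $Q$ be the type $A_n$ quiver $1\rightarrow 2\rightarrow\cdots\rightarrow m\leftarrow\cdots\leftarrow n-1\leftarrow n$ with minuscule vertex $m$. Then for every $M\in\mathcal{C}_{Q,m}$, $\rho_{Q,m}(M)=Pak(M)$, where $\mathsf P_{Q,m}$ is identified with the cells of the rectangular Young diagram with $n+1-m$ rows of length $m$ as described below.
   Context: Let $\Bbbk$ be an algebraically closed field. $\tau$ is the Auslander–Reiten translation. $\mathsf{P}_{Q,m}$ is the set of isomorphism classes of indecomposable representations $V$ of $Q$ with $V_m\neq0$, partially ordered by the transitive closure of $x<y$ whenever there is an arrow $x\to y$ in the Auslander–Reiten quiver of $Q$; $\lessdot$ denotes covers. $\mathcal{C}_{Q,m}$ is the category of finite direct sums of such indecomposables. Indecomposables of $Q$ are determined by their dimension vectors, which are the $0/1$ vectors supported on an interval of $\{1,\dots,n\}$. Identification with rim hooks and cells: let $\lambda$ be the Young diagram (English notation) with $n+1-m$ rows each of length $m$. Its southeast border consists of $n$ cells; number them $1,\dots,n$ reading from the southwest end to the northeast end. An indecomposable with dimension vector $d$ (supported at $m$) corresponds to the rim hook of $\lambda$ consisting of the border cells $i$ with $d_i=1$, and to the cell $u$ of $\lambda$ whose hook has the same two end cells as this rim hook. Thus $M\in\mathcal C_{Q,m}$ corresponds to a multiset of rim hooks of $\lambda$, and functions on $\mathsf P_{Q,m}$ are identified with fillings of $\lambda$. $Pak(M)$ denotes the reverse plane partition of shape $\lambda$ assigned to this multiset of rim hooks by Pak's bijection (Pak, "Hook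 length formula and geometric combinatorics", 2001). Toggles: for $\rho:\mathsf P_{Q,m}\to[0,N]$ and $x\in\mathsf P_{Q,m}$, $t_x\rho$ agrees with $\rho$ except at $x$, where $t_x\rho(x)=\max_{x\lessdot y}\rho(y)+\min_{z\lessdot x}\rho(z)-\rho(x)$, with max over the empty set $=0$, min over the empty set $=N$. The map $\rho_{Q,m}$: fix a listing $M_1,\dots,M_s$ of all indecomposable representations of $Q$ up to isomorphism such that whenever there is an arrow $M_i\to M_j$ in the Auslander–Reiten quiver, $j<i$. For $M\cong\bigoplus_{j}M_j^{c_j}$, let $\rho_0\equiv0$ and for $k=1,\dots,s$, $x\in\mathsf P_{Q,m}$: $\rho_k(x)=\max_{x\lessdot y}\rho_{k-1}(y)+c_k$ if $x$ corresponds to $M_k$; $\rho_k(x)=(t_x\rho_{k-1})(x)$ if $x$ corresponds to $\tau^{\ell}(M_k)$ for some $\ell<0$; $\rho_k(x)=\rho_{k-1}(x)$ otherwise (independent of $N$). Set $\rho_{Q,m}(M)=\rho_s$. *)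

theory Defs
  imports
    "HOL-Library.Multiset"
    "HOL-Computational_Algebra.Polynomial"
    "Graph_Theory.Digraph"
    "Jordan_Normal_Form.Matrix"
begin

section \<open>Representations of a quiver\<close>

text \<open>
  A quiver is a \<open>pre_digraph\<close>. A finite-dimensional representation \<open>V\<close> is given in coordinates:
  the space at the vertex \<open>v\<close> is the space of column vectors of dimension \<open>rdim V v\<close>, and the linear
  map of an arc is a matrix. Values outside the vertices and arcs of the quiver are irrelevant;
  isomorphism of representations ignores them.
\<close>

record ('a, 'b, 'k) qrep =
  rdim :: "'a \<Rightarrow> nat"
  rmap :: "'b \<Rightarrow> 'k mat"

definition is_rep :: "('a, 'b) pre_digraph \<Rightarrow> ('a, 'b, 'k :: field) qrep \<Rightarrow> bool" where
  "is_rep Q V \<longleftrightarrow>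
     (\<forall>e \<in> arcs Q. rmap V e \<in> carrier_mat (rdim V (head Q e)) (rdim V (tail Q e)))"

definition is_hom ::
  "('a, 'b) pre_digraph \<Rightarrow> ('a, 'b, 'k :: field) qrep \<Rightarrow> ('a, 'b, 'k) qrep \<Rightarrow> ('a \<Rightarrow> 'k mat) \<Rightarrow> bool"
where
  "is_hom Q V W f \<longleftrightarrow>
     (\<forall>v \<in> verts Q. f v \<in> carrier_mat (rdim W v) (rdim V v)) \<and>
     (\<forall>e \<in> arcs Q. f (head Q e) * rmap V e = rmap W e * f (tail Q e))"

definition rep_iso ::
  "('a, 'b) pre_digraph \<Rightarrow> ('a, 'b, 'k :: field) qrep \<Rightarrow> ('a, 'b, 'k) qrep \<Rightarrow> bool"
where
  "rep_iso Q V W \<longleftrightarrow>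
     (\<exists>f g. is_hom Q V W f \<and> is_hom Q W V g \<and>
        (\<forall>v \<in> verts Q. g v * f v = 1\<^sub>m (rdim V v) \<and> f v * g v = 1\<^sub>m (rdim W v)))"

definition iso_class ::
  "('a, 'b) pre_digraph \<Rightarrow> ('a, 'b, 'k :: field) qrep \<Rightarrow> ('a, 'b, 'k) qrep set" where
  "iso_class Q V = {W. is_rep Q W \<and> rep_iso Q V W}"

definition direct_sum :: "('a, 'b, 'k :: field) qrep list \<Rightarrow> ('a, 'b, 'k) qrep" where
  "direct_sum Vs =
     \<lparr>rdim = (\<lambda>v. \<Sum>V\<leftarrow>Vs. rdim V v), rmap = (\<lambda>e. diag_block_mat (map (\<lambda>V. rmap V e) Vs))\<rparr>"

definition is_zero_rep :: "('a, 'b) pre_digraph \<Rightarrow> ('a, 'b, 'k :: field) qrep \<Rightarrow> bool" where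
  "is_zero_rep Q V \<longleftrightarrow> (\<forall>v \<in> verts Q. rdim V v = 0)"

definition indecomposable :: "('a, 'b) pre_digraph \<Rightarrow> ('a, 'b, 'k :: field) qrep \<Rightarrow> bool" where
  "indecomposable Q V \<longleftrightarrow>
     is_rep Q V \<and> \<not> is_zero_rep Q V \<and>
     (\<forall>X Y. is_rep Q X \<longrightarrow> is_rep Q Y \<longrightarrow> rep_iso Q V (direct_sum [X, Y]) \<longrightarrow>
        is_zero_rep Q X \<or> is_zero_rep Q Y)"


section \<open>The Auslander--Reiten quiver and translation\<close>

definition split_mono ::
  "('a, 'b) pre_digraph \<Rightarrow> ('a, 'b, 'k :: field) qrep \<Rightarrow> ('a, 'b, 'k) qrep \<Rightarrow> ('a \<Rightarrow> 'k mat) \<Rightarrow> bool"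
where
  "split_mono Q V W f \<longleftrightarrow>
     is_hom Q V W f \<and> (\<exists>g. is_hom Q W V g \<and> (\<forall>v \<in> verts Q. g v * f v = 1\<^sub>m (rdim V v)))"

definition split_epi ::
  "('a, 'b) pre_digraph \<Rightarrow> ('a, 'b, 'k :: field) qrep \<Rightarrow> ('a, 'b, 'k) qrep \<Rightarrow> ('a \<Rightarrow> 'k mat) \<Rightarrow> bool"
where
  "split_epi Q V W f \<longleftrightarrow>
     is_hom Q V W f \<and> (\<exists>g. is_hom Q W V g \<and> (\<forall>v \<in> verts Q. f v * g v = 1\<^sub>m (rdim W v)))"

definition irreducible_hom ::
  "('a, 'b) pre_digraph \<Rightarrow> ('a, 'b, 'k :: field) qrep \<Rightarrow> ('a, 'b, 'k) qrep \<Rightarrow> ('a \<Rightarrow> 'k mat) \<Rightarrow> bool"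
where
  "irreducible_hom Q V W f \<longleftrightarrow>
     is_hom Q V W f \<and> \<not> split_mono Q V W f \<and> \<not> split_epi Q V W f \<and>
     (\<forall>Z h g. is_rep Q Z \<longrightarrow> is_hom Q V Z h \<longrightarrow> is_hom Q Z W g \<longrightarrow>
        (\<forall>v \<in> verts Q. f v = g v * h v) \<longrightarrow> split_mono Q V Z h \<or> split_epi Q Z W g)"

definition ar_verts :: "('a, 'b) pre_digraph \<Rightarrow> ('a, 'b, 'k :: field) qrep set set" where
  "ar_verts Q = iso_class Q ` {V. indecomposable Q V}"

text \<open>Only the existence of arrows of the Auslander--Reiten quiver is recorded, not their number.\<close>

definition ar_arrow ::
  "('a, 'b) pre_digraph \<Rightarrow> ('a, 'b, 'k :: field) qrep set \<Rightarrow> ('a, 'b, 'k) qrep set \<Rightarrow> bool"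
where
  "ar_arrow Q x y \<longleftrightarrow>
     x \<in> ar_verts Q \<and> y \<in> ar_verts Q \<and> (\<exists>V \<in> x. \<exists>W \<in> y. \<exists>f. irreducible_hom Q V W f)"

definition short_exact ::
  "('a, 'b) pre_digraph \<Rightarrow> ('a, 'b, 'k :: field) qrep \<Rightarrow> ('a \<Rightarrow> 'k mat) \<Rightarrow> ('a, 'b, 'k) qrep \<Rightarrow>
   ('a \<Rightarrow> 'k mat) \<Rightarrow> ('a, 'b, 'k) qrep \<Rightarrow> bool"
where
  "short_exact Q L f E g R \<longleftrightarrow>
     is_hom Q L E f \<and> is_hom Q E R g \<and>
     (\<forall>v \<in> verts Q.
        (\<forall>x \<in> carrier_vec (rdim L v). f v *\<^sub>v x = 0\<^sub>v (rdim E v) \<longrightarrow> x = 0\<^sub>v (rdim L v)) \<and>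
        (\<forall>y \<in> carrier_vec (rdim E v).
           g v *\<^sub>v y = 0\<^sub>v (rdim R v) \<longleftrightarrow> (\<exists>x \<in> carrier_vec (rdim L v). y = f v *\<^sub>v x)) \<and>
        (\<forall>z \<in> carrier_vec (rdim R v). \<exists>y \<in> carrier_vec (rdim E v). z = g v *\<^sub>v y))"

definition left_almost_split ::
  "('a, 'b) pre_digraph \<Rightarrow> ('a, 'b, 'k :: field) qrep \<Rightarrow> ('a, 'b, 'k) qrep \<Rightarrow> ('a \<Rightarrow> 'k mat) \<Rightarrow> bool"
where
  "left_almost_split Q L E f \<longleftrightarrow>
     is_hom Q L E f \<and> \<not> split_mono Q L E f \<and>
     (\<forall>Z h. is_rep Q Z \<longrightarrow> is_hom Q L Z h \<longrightarrow> \<not> split_mono Q L Z h \<longrightarrow>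
        (\<exists>h'. is_hom Q E Z h' \<and> (\<forall>v \<in> verts Q. h v = h' v * f v)))"

definition right_almost_split ::
  "('a, 'b) pre_digraph \<Rightarrow> ('a, 'b, 'k :: field) qrep \<Rightarrow> ('a, 'b, 'k) qrep \<Rightarrow> ('a \<Rightarrow> 'k mat) \<Rightarrow> bool"
where
  "right_almost_split Q E R g \<longleftrightarrow>
     is_hom Q E R g \<and> \<not> split_epi Q E R g \<and>
     (\<forall>Z h. is_rep Q Z \<longrightarrow> is_hom Q Z R h \<longrightarrow> \<not> split_epi Q Z R h \<longrightarrow>
        (\<exists>h'. is_hom Q Z E h' \<and> (\<forall>v \<in> verts Q. h v = g v * h' v)))"

definition almost_split_sequence ::
  "('a, 'b) pre_digraph \<Rightarrow> ('a, 'b, 'k :: field) qrep \<Rightarrow> ('a \<Rightarrow> 'k mat) \<Rightarrow> ('a, 'b, 'k) qrep \<Rightarrow>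
   ('a \<Rightarrow> 'k mat) \<Rightarrow> ('a, 'b, 'k) qrep \<Rightarrow> bool"
where
  "almost_split_sequence Q L f E g R \<longleftrightarrow>
     short_exact Q L f E g R \<and> left_almost_split Q L E f \<and> right_almost_split Q E R g"

text \<open>
  \<open>ar_translate Q x y\<close> means \<open>y = \<tau> x\<close>: there is an almost split sequence
  \<open>0 \<rightarrow> L \<rightarrow> E \<rightarrow> R \<rightarrow> 0\<close> with \<open>R\<close> in the class \<open>x\<close> and \<open>L\<close> in the class \<open>y\<close>. The translate is a
  partial operation (undefined on projectives), hence a relation.
\<close>

definition ar_translate ::
  "('a, 'b) pre_digraph \<Rightarrow> ('a, 'b, 'k :: field) qrep set \<Rightarrow> ('a, 'b, 'k) qrep set \<Rightarrow> bool"
where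
  "ar_translate Q x y \<longleftrightarrow>
     x \<in> ar_verts Q \<and> y \<in> ar_verts Q \<and>
     (\<exists>R \<in> x. \<exists>L \<in> y. \<exists>E f g. is_rep Q E \<and> almost_split_sequence Q L f E g R)"


section \<open>The poset of indecomposables supported at a vertex\<close>

definition poset_at :: "('a, 'b) pre_digraph \<Rightarrow> 'a \<Rightarrow> ('a, 'b, 'k :: field) qrep set set" where
  "poset_at Q m = iso_class Q ` {V. indecomposable Q V \<and> rdim V m \<noteq> 0}"

definition poset_less ::
  "('a, 'b) pre_digraph \<Rightarrow> 'a \<Rightarrow> ('a, 'b, 'k :: field) qrep set \<Rightarrow> ('a, 'b, 'k) qrep set \<Rightarrow> bool"
where
  "poset_less Q m = (\<lambda>x y. x \<in> poset_at Q m \<and> y \<in> poset_at Q m \<and> ar_arrow Q x y)\<^sup>+\<^sup>+"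

definition covered_by ::
  "('a, 'b) pre_digraph \<Rightarrow> 'a \<Rightarrow> ('a, 'b, 'k :: field) qrep set \<Rightarrow> ('a, 'b, 'k) qrep set \<Rightarrow> bool"
where
  "covered_by Q m x y \<longleftrightarrow>
     poset_less Q m x y \<and> \<not> (\<exists>z. poset_less Q m x z \<and> poset_less Q m z y)"

definition in_category :: "('a, 'b) pre_digraph \<Rightarrow> 'a \<Rightarrow> ('a, 'b, 'k :: field) qrep \<Rightarrow> bool" where
  "in_category Q m M \<longleftrightarrow>
     is_rep Q M \<and>
     (\<exists>Vs. (\<forall>V \<in> set Vs. indecomposable Q V \<and> rdim V m \<noteq> 0) \<and> rep_iso Q M (direct_sum Vs))"


section \<open>Toggles and the reverse plane partition of a representation\<close>

definition max_above ::
  "('a, 'b) pre_digraph \<Rightarrow> 'a \<Rightarrow> (('a, 'b, 'k :: field) qrep set \<Rightarrow> int) \<Rightarrow>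
   ('a, 'b, 'k) qrep set \<Rightarrow> int"
where
  "max_above Q m \<rho> x =
     (let S = {y. covered_by Q m x y} in if S = {} then 0 else Max (\<rho> ` S))"

definition min_below ::
  "('a, 'b) pre_digraph \<Rightarrow> 'a \<Rightarrow> nat \<Rightarrow> (('a, 'b, 'k :: field) qrep set \<Rightarrow> int) \<Rightarrow>
   ('a, 'b, 'k) qrep set \<Rightarrow> int"
where
  "min_below Q m N \<rho> x =
     (let S = {z. covered_by Q m z x} in if S = {} then int N else Min (\<rho> ` S))"

definition toggle ::
  "('a, 'b) pre_digraph \<Rightarrow> 'a \<Rightarrow> nat \<Rightarrow> ('a, 'b, 'k :: field) qrep set \<Rightarrow>
   (('a, 'b, 'k) qrep set \<Rightarrow> int) \<Rightarrow> (('a, 'b, 'k) qrep set \<Rightarrow> int)"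
where
  "toggle Q m N x \<rho> = \<rho>(x := max_above Q m \<rho> x + min_below Q m N \<rho> x - \<rho> x)"

text \<open>All indecomposables up to isomorphism, every arrow pointing from later to earlier entries.\<close>

definition ar_listing :: "('a, 'b) pre_digraph \<Rightarrow> ('a, 'b, 'k :: field) qrep list \<Rightarrow> bool" where
  "ar_listing Q Ms \<longleftrightarrow>
     (\<forall>V \<in> set Ms. indecomposable Q V) \<and>
     (\<forall>W. indecomposable Q W \<longrightarrow> (\<exists>V \<in> set Ms. rep_iso Q V W)) \<and>
     (\<forall>i < length Ms. \<forall>j < length Ms. rep_iso Q (Ms ! i) (Ms ! j) \<longrightarrow> i = j) \<and>
     (\<forall>i < length Ms. \<forall>j < length Ms.
        ar_arrow Q (iso_class Q (Ms ! i)) (iso_class Q (Ms ! j)) \<longrightarrow> j < i)"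

text \<open>
  In one step, \<open>x\<close> is the class of \<open>\<tau>\<^sup>l V\<close> for some \<open>l < 0\<close> iff \<open>V\<close> lies in \<open>\<tau>\<^sup>j x\<close> for
  some \<open>j > 0\<close>. Functions on the poset are extended by 0.
\<close>

definition rho_step ::
  "('a, 'b) pre_digraph \<Rightarrow> 'a \<Rightarrow> nat \<Rightarrow> ('a, 'b, 'k :: field) qrep \<times> nat \<Rightarrow>
   (('a, 'b, 'k) qrep set \<Rightarrow> int) \<Rightarrow> (('a, 'b, 'k) qrep set \<Rightarrow> int)"
where
  "rho_step Q m N = (\<lambda>(V, c) \<rho> x.
     if x \<notin> poset_at Q m then 0
     else if x = iso_class Q V then max_above Q m \<rho> x + int c
     else if (ar_translate Q)\<^sup>+\<^sup>+ x (iso_class Q V) then toggle Q m N x \<rho> x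
     else \<rho> x)"

definition rho ::
  "('a, 'b) pre_digraph \<Rightarrow> 'a \<Rightarrow> nat \<Rightarrow> ('a, 'b, 'k :: field) qrep list \<Rightarrow> nat list \<Rightarrow>
   ('a, 'b, 'k) qrep set \<Rightarrow> int"
where
  "rho Q m N Ms cs = fold (rho_step Q m N) (zip Ms cs) (\<lambda>_. 0)"

definition direct_sum_powers :: "('a, 'b, 'k :: field) qrep list \<Rightarrow> nat list \<Rightarrow> ('a, 'b, 'k) qrep"
where
  "direct_sum_powers Ms cs = direct_sum (concat (map2 (\<lambda>V c. replicate c V) Ms cs))"


section \<open>Rim hooks and Pak's bijection\<close>

text \<open>
  A cell is a pair (row, column) with both indices starting from 1 and rows counted downwards.
  A Young diagram is a set of cells.
\<close>

type_synonym cell = "nat \<times> nat"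

definition border :: "cell set \<Rightarrow> cell set" where
  "border Y = {(i, j). (i, j) \<in> Y \<and> (i + 1, j + 1) \<notin> Y}"

text \<open>Border cells are numbered 1, 2, \<dots> from the southwest end to the northeast end.\<close>

definition border_number :: "cell set \<Rightarrow> cell \<Rightarrow> nat" where
  "border_number Y = (\<lambda>(i, j). card {(i', j'). (i', j') \<in> border Y \<and> i \<le> i' \<and> j' \<le> j})"

definition rim_hook :: "cell set \<Rightarrow> (nat \<Rightarrow> nat) \<Rightarrow> cell set" where
  "rim_hook Y d = {u \<in> border Y. d (border_number Y u) = 1}"

definition hook :: "cell set \<Rightarrow> cell \<Rightarrow> cell set" where
  "hook Y = (\<lambda>(i, j). {(i', j'). (i', j') \<in> Y \<and> (i' = i \<and> j \<le> j' \<or> j' = j \<and> i \<le> i')})"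

definition sw_end :: "cell set \<Rightarrow> cell \<Rightarrow> bool" where
  "sw_end H = (\<lambda>(i, j). (i, j) \<in> H \<and> (\<forall>(i', j') \<in> H. i' \<le> i \<and> j \<le> j'))"

definition ne_end :: "cell set \<Rightarrow> cell \<Rightarrow> bool" where
  "ne_end H = (\<lambda>(i, j). (i, j) \<in> H \<and> (\<forall>(i', j') \<in> H. i \<le> i' \<and> j' \<le> j))"

definition same_ends :: "cell set \<Rightarrow> cell set \<Rightarrow> bool" where
  "same_ends H K \<longleftrightarrow> (\<exists>p q. sw_end H p \<and> sw_end K p \<and> ne_end H q \<and> ne_end K q)"

definition cell_of :: "cell set \<Rightarrow> (nat, 'b, 'k) qrep set \<Rightarrow> cell" where
  "cell_of Y x = (THE u. u \<in> Y \<and> (\<exists>V \<in> x. same_ends (hook Y u) (rim_hook Y (rdim V))))"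

definition rim_hooks_of :: "cell set \<Rightarrow> (nat, 'b, 'k) qrep list \<Rightarrow> nat list \<Rightarrow> cell set multiset"
where
  "rim_hooks_of Y Ms cs =
     (\<Sum>(V, c)\<leftarrow>zip Ms cs. replicate_mset c (rim_hook Y (rdim V)))"

definition hook_filling :: "cell set \<Rightarrow> cell set multiset \<Rightarrow> cell \<Rightarrow> nat" where
  "hook_filling Y H u = size {#h \<in># H. same_ends (hook Y u) h#}"

text \<open>
  Pak's map from reverse plane partitions to fillings removes the cells of the diagram one by one,
  always at a corner: the entry \<open>p\<close> at the corner is replaced by \<open>p - max(up, left)\<close>, which is the
  entry of the filling there, and the entries \<open>p\<close> further up on the diagonal of the corner by
  \<open>max(up, left) + min(down, right) - p\<close>. The definition below is the inverse, which adds the cells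
  in the order of a standard filling of the diagram. Entries outside the diagram are 0.
\<close>

definition pak_step :: "(cell \<Rightarrow> nat) \<Rightarrow> cell \<Rightarrow> (cell \<Rightarrow> int) \<Rightarrow> (cell \<Rightarrow> int)" where
  "pak_step F = (\<lambda>(i, j) \<pi> (a, b).
     if (a, b) = (i, j) then max (\<pi> (a - 1, b)) (\<pi> (a, b - 1)) + int (F (a, b))
     else if 1 \<le> a \<and> 1 \<le> b \<and> (\<exists>k \<ge> 1. a + k = i \<and> b + k = j)
       then max (\<pi> (a - 1, b)) (\<pi> (a, b - 1)) + min (\<pi> (a + 1, b)) (\<pi> (a, b + 1)) - \<pi> (a, b)
     else \<pi> (a, b))"

definition standard_order :: "cell set \<Rightarrow> cell list \<Rightarrow> bool" where
  "standard_order Y us \<longleftrightarrow>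
     set us = Y \<and> sorted_wrt (\<lambda>(i, j) (i', j'). \<not> (i' \<le> i \<and> j' \<le> j)) us"

definition pak :: "cell set \<Rightarrow> cell list \<Rightarrow> cell set multiset \<Rightarrow> cell \<Rightarrow> int" where
  "pak Y us H = fold (pak_step (hook_filling Y H)) us (\<lambda>_. 0)"


section \<open>The quiver and the diagram\<close>

definition quiver_A :: "nat \<Rightarrow> nat \<Rightarrow> (nat, nat \<times> nat) pre_digraph" where
  "quiver_A n m =
     \<lparr>verts = {1..n},
      arcs = {(i, i + 1) | i. 1 \<le> i \<and> i < m} \<union> {(i + 1, i) | i. m \<le> i \<and> i < n},
      tail = fst, head = snd\<rparr>"

definition rectangle :: "nat \<Rightarrow> nat \<Rightarrow> cell set" where
  "rectangle n m = {1..n + 1 - m} \<times> {1..m}"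

end

theory Submission
  imports Defs "HOL-Library.Function_Algebras" "Jordan_Normal_Form.Determinant"
begin

text \<open>
  An indecomposable representation supported at \<open>m\<close> is given by an interval \<open>[a, b]\<close> containing \<open>m\<close>.
  Homomorphisms between a representation \<open>V\<close> and such an interval representation are governed by
  the flags \<open>img V a\<close> and \<open>img V b\<close> that the two arms of the quiver induce on the space at
  the sink; each property of the Auslander--Reiten quiver thereby reduces to separating a vector from a
  subspace by a linear functional. The irreducible maps between these modules enlarge the
  interval by one vertex, and \<open>\<tau> [a, b] = [a + 1, b - 1]\<close>, undefined when \<open>a = m\<close> or \<open>b = m\<close>. Hence
  the poset is the rectangle, with \<open>[a, b]\<close> at the cell \<open>(n + 1 - b, a)\<close>, and inverse translates
  move up the diagonals. A step of \<open>\<rho>\<close> is then a step of the inverse of Pak's map, and the order of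
  the steps is irrelevant because cells that can be exchanged lie on diagonals that are not adjacent.
\<close>

section \<open>Linear algebra\<close>

text \<open>Irreducibility and the almost split property quantify over every test representation
  \<open>Z\<close>, so a list of the indecomposables does not decide them by itself; a criterion for
  arbitrary \<open>Z\<close> is needed. It exists because both arms are linear and meet at the sink:
  a vector at \<open>m\<close> extends to a map out of \<open>[a, b]\<close> iff it lies in
  \<open>img Z a\<close> and in \<open>img Z b\<close>, and a row at \<open>m\<close> is the sink
  component of a map into \<open>[a, b]\<close> iff it kills \<open>img Z (a - 1)\<close> and
  \<open>img Z (b + 1)\<close>. Such a pair splits as soon as the row is 1 on the vector. Failure to
  split thus means that a vector lies in a sum of two images, or that a row vanishes on their
  intersection. Intervals describe only the indecomposables supported at \<open>m\<close>; the
  others live on one side of \<open>m\<close>, which is enough to see that they have no effect. As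
  \<open>ar_translate\<close> only asserts that a sequence exists, its left end must also be shown
  to be determined by the right end. The cell \<open>(n + 1 - b, a)\<close> comes from the border
  numbering: column \<open>a\<close> of the bottom row has number \<open>a\<close>, and row
  \<open>n + 1 - b\<close> of the last column has number \<open>b\<close>.\<close>

lemma separating_row:
  fixes W :: "'k :: field mat set"
  assumes W: "W \<subseteq> carrier_mat d 1" "0\<^sub>m d 1 \<in> W"
    and add: "\<And>u v. u \<in> W \<Longrightarrow> v \<in> W \<Longrightarrow> u + v \<in> W"
    and smult: "\<And>c u. u \<in> W \<Longrightarrow> c \<cdot>\<^sub>m u \<in> W"
    and z: "z \<in> carrier_mat d 1" "z \<notin> W"
  shows "\<exists>\<Phi> \<in> carrier_mat 1 d. \<Phi> * z = 1\<^sub>m 1 \<and> (\<forall>w \<in> W. \<Phi> * w = 0\<^sub>m 1 1)"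
proof -
  \<comment> \<open>Columns of height \<open>d\<close>, extended by zero, become functions on
    \<open>nat\<close>. These form a vector space on a whole type, where bases and extension of
    linear maps are at hand.\<close>
  define scale :: "'k \<Rightarrow> (nat \<Rightarrow> 'k) \<Rightarrow> nat \<Rightarrow> 'k" where "scale = (\<lambda>c f i. c * f i)"
  define F :: "'k mat \<Rightarrow> nat \<Rightarrow> 'k" where "F = (\<lambda>Y i. if i < d then Y $$ (i, 0) else 0)"
  interpret V: vector_space scale
    by unfold_locales (auto simp: scale_def algebra_simps fun_eq_iff)
  interpret K: vector_space "(*) :: 'k \<Rightarrow> _"
    by unfold_locales (auto simp: algebra_simps)
  interpret VK: vector_space_pair scale "(*) :: 'k \<Rightarrow> _" ..
  have F_add: "F (u + v) = F u + F v" if "u \<in> carrier_mat d 1" "v \<in> carrier_mat d 1" for u v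
    using that by (auto simp: F_def fun_eq_iff)
  have F_smult: "F (c \<cdot>\<^sub>m u) = scale c (F u)" if "u \<in> carrier_mat d 1" for c u
    using that by (auto simp: F_def scale_def fun_eq_iff)
  have F_inj: "u = v" if "u \<in> carrier_mat d 1" "v \<in> carrier_mat d 1" "F u = F v" for u v
  proof (rule eq_matI)
    fix i j assume "i < dim_row v" "j < dim_col v"
    then have "i < d" "j = 0" using that by auto
    moreover from \<open>i < d\<close> have "u $$ (i, 0) = v $$ (i, 0)"
      using fun_cong[OF that(3), of i] by (simp add: F_def)
    ultimately show "u $$ (i, j) = v $$ (i, j)" by simp
  qed (use that in auto)
  have sub: "V.subspace (F ` W)"
  proof (rule V.subspaceI)
    have "F (0\<^sub>m d 1) = 0" by (auto simp: F_def fun_eq_iff)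
    then show "0 \<in> F ` W" using W(2) by (metis image_eqI)
  next
    fix x y assume "x \<in> F ` W" "y \<in> F ` W"
    then obtain u v where "u \<in> W" "v \<in> W" "x = F u" "y = F v" by auto
    then show "x + y \<in> F ` W" using F_add[of u v] add[of u v] W(1) by (metis image_eqI subsetD)
  next
    fix c x assume "x \<in> F ` W"
    then obtain u where "u \<in> W" "x = F u" by auto
    then show "scale c x \<in> F ` W" using F_smult[of u c] smult[of u c] W(1) by (metis image_eqI subsetD)
  qed
  obtain B where B: "B \<subseteq> F ` W" "V.independent B" "F ` W \<subseteq> V.span B"
    by (rule V.maximal_independent_subset)
  have span: "V.span B = F ` W"
    using V.span_minimal[OF B(1) sub] B(3) by (rule subset_antisym)
  have zn: "F z \<notin> V.span B"
    using z W(1) F_inj unfolding span by (metis imageE subsetD)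
  \<comment> \<open>\<open>F z\<close> is outside the span of the basis \<open>B\<close> of the
    image of \<open>W\<close>, so a functional may be prescribed as 1 on \<open>F z\<close> and 0 on
    \<open>B\<close>.\<close>
  have "V.independent (insert (F z) B)"
    using V.independent_insertI[OF zn B(2)] .
  from VK.linear_independent_extend[OF this, of "\<lambda>x. if x = F z then 1 else 0"]
  obtain g where g: "Vector_Spaces.linear scale (*) g"
    "\<And>x. x \<in> insert (F z) B \<Longrightarrow> g x = (if x = F z then 1 else 0)" by blast
  interpret g: Vector_Spaces.linear scale "(*)" g by (rule g(1))
  have zB: "F z \<notin> B" using zn V.span_superset by blast
  have g0: "g x = 0" if "x \<in> F ` W" for x
  proof -
    have "x \<in> V.span B" using that span by simp
    moreover have "V.span B \<subseteq> {x. g x = 0}"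
      using g(2) zB by (intro V.span_minimal g.subspace_kernel) auto
    ultimately show ?thesis by auto
  qed
  define e :: "nat \<Rightarrow> nat \<Rightarrow> 'k" where "e = (\<lambda>i j. if j = i then 1 else 0)"
  define \<Phi> where "\<Phi> = mat 1 d (\<lambda>(_, i). g (e i))"
  have \<Phi>: "\<Phi> * u = mat 1 1 (\<lambda>_. g (F u))" if u: "u \<in> carrier_mat d 1" for u
  proof -
    have sumF: "(\<Sum>i<k. scale (u $$ (i, 0)) (e i)) = (\<lambda>i. if i < k then u $$ (i, 0) else 0)" for k
      by (induction k) (auto simp: scale_def e_def fun_eq_iff less_Suc_eq)
    have "F u = (\<Sum>i<d. scale (u $$ (i, 0)) (e i))"
      unfolding sumF by (simp add: F_def)
    then have "g (F u) = (\<Sum>i<d. u $$ (i, 0) * g (e i))"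
      by (simp add: g.sum g.scale)
    then show ?thesis using u
      by (intro eq_matI) (auto simp: \<Phi>_def scalar_prod_def atLeast0LessThan mult.commute intro!: sum.cong)
  qed
  show ?thesis
  proof (intro bexI[of _ \<Phi>] conjI ballI)
    show "\<Phi> \<in> carrier_mat 1 d" by (simp add: \<Phi>_def)
    show "\<Phi> * z = 1\<^sub>m 1" using \<Phi>[OF z(1)] g(2)[of "F z"] by auto
    show "\<Phi> * w = 0\<^sub>m 1 1" if "w \<in> W" for w
      using \<Phi>[of w] g0[of "F w"] that W(1) by (auto intro!: eq_matI)
  qed
qed

text \<open>\<open>1 - x * p\<close> is the projection onto the kernel of \<open>p\<close> along
  \<open>x\<close>. The pair \<open>j\<close>, \<open>q\<close> presents that kernel in
  \<open>d - 1\<close> coordinates, which is what a representation in coordinates needs in order to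
  have a complement of a retract.\<close>

lemma complement_of_rank_one:
  fixes p :: "'k :: field mat"
  assumes p: "p \<in> carrier_mat 1 d" and x: "x \<in> carrier_mat d 1" and px: "p * x = 1\<^sub>m 1"
  obtains j q where "j \<in> carrier_mat d (d - 1)" "q \<in> carrier_mat (d - 1) d"
    "q * j = 1\<^sub>m (d - 1)" "j * q = 1\<^sub>m d - x * p"
proof -
  have "\<exists>t<d. p $$ (0, t) \<noteq> 0"
  proof (rule ccontr)
    assume "\<not> ?thesis"
    then have "p = 0\<^sub>m 1 d" using p by (intro eq_matI) auto
    then have "p * x = 0\<^sub>m 1 1" using x by simp
    moreover have "(1\<^sub>m 1 :: 'k mat) $$ (0, 0) \<noteq> 0\<^sub>m 1 1 $$ (0, 0)" by simp
    ultimately show False using px by metis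
  qed
  then obtain t where t: "t < d" "p $$ (0, t) \<noteq> 0" by blast
  \<comment> \<open>The equation given by \<open>p\<close> is solved for coordinate
    \<open>t\<close>; the remaining coordinates, listed by \<open>I\<close>, are free on the
    kernel.\<close>
  define I where "I = insert_index t"
  have I_ne: "I r \<noteq> t" for r by (simp add: I_def)
  have I_less: "I r < d" if "r < d - 1" for r using that t by (auto simp: I_def insert_index_def)
  have I_eq: "I r = I r' \<longleftrightarrow> r = r'" for r r' by (metis I_def delete_insert_index)
  have I_del: "I r = s \<longleftrightarrow> r = delete_index t s" if "s \<noteq> t" for r s
    using that by (metis I_def delete_insert_index insert_delete_index)
  have del_less: "delete_index t s < d - 1" if "s \<noteq> t" "s < d" for s
    using that t by (auto simp: delete_index_def)
  \<comment> \<open>Column \<open>r\<close> of \<open>j\<close> is the kernel vector whose only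
    nonzero free coordinate \<open>I r\<close> is 1, and \<open>E\<close> forgets coordinate
    \<open>t\<close>. \<open>T\<close> is the multiple of the \<open>t\<close>-th unit column on
    which \<open>p\<close> is 1, so \<open>j * E\<close> projects onto the kernel along
    \<open>T\<close> instead of along \<open>x\<close>.\<close>
  define j where "j = mat d (d - 1) (\<lambda>(s, r). if s = t then - p $$ (0, I r) / p $$ (0, t)
    else if s = I r then 1 else 0)"
  define E :: "'k mat" where "E = mat (d - 1) d (\<lambda>(r, s). if s = I r then 1 else 0)"
  define T where "T = mat d 1 (\<lambda>(s, _). if s = t then 1 / p $$ (0, t) else 0)"
  define N where "N = 1\<^sub>m d - x * p"
  have carr: "j \<in> carrier_mat d (d - 1)" "E \<in> carrier_mat (d - 1) d" "T \<in> carrier_mat d 1"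
    "N \<in> carrier_mat d d"
    using x p by (simp_all add: j_def E_def T_def N_def minus_carrier_mat[OF mult_carrier_mat])
  have pj: "p * j = 0\<^sub>m 1 (d - 1)"
  proof (rule eq_matI)
    fix i r assume "i < dim_row (0\<^sub>m 1 (d - 1) :: 'k mat)" "r < dim_col (0\<^sub>m 1 (d - 1) :: 'k mat)"
    then have i: "i = 0" and r: "r < d - 1" by auto
    have "(p * j) $$ (0, r) = (\<Sum>s<d. p $$ (0, s) * j $$ (s, r))"
      using p carr(1) r by (auto simp: scalar_prod_def atLeast0LessThan intro!: sum.cong)
    also have "\<dots> = (\<Sum>s<d. (if s = t then - p $$ (0, I r) else 0) +
        (if s = I r then p $$ (0, I r) else 0))"
      using r t I_ne by (intro sum.cong) (auto simp: j_def)
    also have "\<dots> = 0"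
      using t I_less[OF r] by (simp add: sum.distrib sum.delta)
    finally show "(p * j) $$ (i, r) = 0\<^sub>m 1 (d - 1) $$ (i, r)" using i r by simp
  qed (use p carr in auto)
  have Ej: "E * j = 1\<^sub>m (d - 1)"
  proof (rule eq_matI)
    fix i r assume "i < dim_row (1\<^sub>m (d - 1) :: 'k mat)" "r < dim_col (1\<^sub>m (d - 1) :: 'k mat)"
    then have i: "i < d - 1" and r: "r < d - 1" by auto
    have "(E * j) $$ (i, r) = (\<Sum>s<d. E $$ (i, s) * j $$ (s, r))"
      using carr r i by (auto simp: scalar_prod_def atLeast0LessThan intro!: sum.cong)
    also have "\<dots> = (\<Sum>s<d. if s = I i then j $$ (I i, r) else 0)"
      using i by (intro sum.cong) (auto simp: E_def)
    also have "\<dots> = j $$ (I i, r)" using I_less[OF i] by simp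
    finally show "(E * j) $$ (i, r) = 1\<^sub>m (d - 1) $$ (i, r)"
      using i r I_less I_ne by (auto simp: j_def I_eq)
  qed (use p carr in auto)
  have jE: "j * E = 1\<^sub>m d - T * p"
  proof (rule eq_matI)
    fix i s assume "i < dim_row (1\<^sub>m d - T * p)" "s < dim_col (1\<^sub>m d - T * p)"
    then have i: "i < d" and s: "s < d" using p carr by auto
    have "(j * E) $$ (i, s) = (\<Sum>r<d - 1. j $$ (i, r) * E $$ (r, s))"
      using carr s i by (auto simp: scalar_prod_def atLeast0LessThan intro!: sum.cong)
    also have "\<dots> = (if s = t then 0 else j $$ (i, delete_index t s))"
    proof (cases "s = t")
      case True
      have "s \<noteq> I r" for r using True I_ne[of r] by simp
      then show ?thesis using True s by (auto simp: E_def intro!: sum.neutral)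
    next
      case False
      have "(\<Sum>r<d - 1. j $$ (i, r) * E $$ (r, s)) =
          (\<Sum>r<d - 1. if r = delete_index t s then j $$ (i, r) else 0)"
        using s by (intro sum.cong) (auto simp: E_def I_del[OF False, symmetric])
      also have "\<dots> = j $$ (i, delete_index t s)" using del_less[OF False s] by simp
      finally show ?thesis using False by simp
    qed
    also have "\<dots> = (1\<^sub>m d - T * p) $$ (i, s)"
      using i s t p del_less[of s] I_del[of s "delete_index t s"]
      by (auto simp: j_def T_def scalar_prod_def)
    finally show "(j * E) $$ (i, s) = (1\<^sub>m d - T * p) $$ (i, s)" .
  qed (use p carr in auto)
  have pN: "p * N = 0\<^sub>m 1 d"
  proof -
    have "p * (x * p) = p"
      using assoc_mult_mat[OF p x p] px p by simp
    then show ?thesis using p x unfolding N_def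
      by (subst mult_minus_distrib_mat[OF p]) auto
  qed
  show ?thesis
  proof
    show "j \<in> carrier_mat d (d - 1)" by fact
    \<comment> \<open>The factor \<open>N\<close> corrects the direction of the projection:
      \<open>j * (E * N) = N - T * (p * N)\<close>, and \<open>p * N\<close> is zero.\<close>
    show "E * N \<in> carrier_mat (d - 1) d" using carr by simp
    have Nj: "N * j = j"
    proof -
      have "N * j = j - x * (p * j)"
        unfolding N_def using minus_mult_distrib_mat[of "1\<^sub>m d" d d "x * p" j "d - 1"] x p carr
        by simp
      then show ?thesis using pj x carr by (auto intro!: eq_matI)
    qed
    show "E * N * j = 1\<^sub>m (d - 1)"
      using assoc_mult_mat[OF carr(2,4,1)] Nj Ej by simp
    have "j * (E * N) = N - T * (p * N)"
      using assoc_mult_mat[OF carr(1,2,4)] jE minus_mult_distrib_mat[of "1\<^sub>m d" d d "T * p" N d]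
        assoc_mult_mat[OF carr(3) p carr(4)] carr p by simp
    then have "j * (E * N) = N" using pN carr by (auto intro!: eq_matI)
    then show "j * (E * N) = 1\<^sub>m d - x * p" by (simp add: N_def)
  qed
qed

lemma eq_mat_zero_row: "A \<in> carrier_mat 0 c \<Longrightarrow> B \<in> carrier_mat 0 c \<Longrightarrow> A = B"
  by (intro eq_matI) auto

lemma eq_mat_zero_col: "A \<in> carrier_mat r 0 \<Longrightarrow> B \<in> carrier_mat r 0 \<Longrightarrow> A = B"
  by (intro eq_matI) auto

lemma mult_mat_unit_vec: "A \<in> carrier_mat r c \<Longrightarrow> j < c \<Longrightarrow> A *\<^sub>v unit_vec c j = col A j"
  for A :: "'k :: field mat"
  by (intro eq_vecI) auto

text \<open>Solving for the unit vectors is enough; the solutions are the columns of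
  \<open>Y\<close>.\<close>

lemma mat_factor_through_image:
  fixes C D :: "'k :: field mat"
  assumes C: "C \<in> carrier_mat r c" and D: "D \<in> carrier_mat r s"
    and ex: "\<And>x. x \<in> carrier_vec c \<Longrightarrow> \<exists>y \<in> carrier_vec s. C *\<^sub>v x = D *\<^sub>v y"
  obtains Y where "Y \<in> carrier_mat s c" "C = D * Y"
proof -
  have "\<exists>y. y \<in> carrier_vec s \<and> col C i = D *\<^sub>v y" if "i < c" for i
    using ex[of "unit_vec c i"] C that by (auto simp: mult_mat_unit_vec)
  then obtain y where y: "\<And>i. i < c \<Longrightarrow> y i \<in> carrier_vec s \<and> col C i = D *\<^sub>v y i" by metis
  define Y where "Y = mat s c (\<lambda>(i, j). y j $ i)"
  have Y: "Y \<in> carrier_mat s c" by (simp add: Y_def)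
  have colY: "col Y j = y j" if "j < c" for j
    using that y[OF that] by (intro eq_vecI) (auto simp: Y_def)
  have "C = D * Y"
  proof (rule eq_matI)
    fix i j assume "i < dim_row (D * Y)" "j < dim_col (D * Y)"
    then have i: "i < r" and j: "j < c" using D Y by auto
    have "C $$ (i, j) = col C j $ i" using C i j by auto
    also have "\<dots> = (D *\<^sub>v col Y j) $ i" using y[OF j] colY[OF j] by simp
    also have "\<dots> = (D * Y) $$ (i, j)" using D Y i j by simp
    finally show "C $$ (i, j) = (D * Y) $$ (i, j)" .
  qed (use C D Y in auto)
  with Y that show ?thesis by blast
qed

lemma mat_eq_if_mult_vec:
  fixes A B :: "'k :: field mat"
  assumes "A \<in> carrier_mat r c" "B \<in> carrier_mat r c"
    and "\<And>x. x \<in> carrier_vec c \<Longrightarrow> A *\<^sub>v x = B *\<^sub>v x"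
  shows "A = B"
proof (rule mat_col_eqI)
  fix j assume "j < dim_col B"
  then show "col A j = col B j"
    using assms(3)[of "unit_vec c j"] assms by (simp add: mult_mat_unit_vec)
qed (use assms in auto)

text \<open>If \<open>b < a\<close>, padding with zeros to size \<open>a\<close> leaves the product
  unchanged. A right inverse of a square matrix is a left inverse, yet the padded \<open>B\<close>
  has a zero row. This yields invariance of dimensions under isomorphism.\<close>

lemma right_inverse_dim_le:
  fixes A B :: "'k :: field mat"
  assumes A: "A \<in> carrier_mat a b" and B: "B \<in> carrier_mat b a" and AB: "A * B = 1\<^sub>m a"
  shows "a \<le> b"
proof (rule ccontr)
  assume "\<not> a \<le> b"
  then have ba: "b < a" by simp
  define A' where "A' = mat a a (\<lambda>(i, j). if j < b then A $$ (i, j) else 0)"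
  define B' where "B' = mat a a (\<lambda>(i, j). if i < b then B $$ (i, j) else 0)"
  have carr: "A' \<in> carrier_mat a a" "B' \<in> carrier_mat a a" by (simp_all add: A'_def B'_def)
  have "A' * B' = A * B"
  proof (rule eq_matI)
    fix i j assume "i < dim_row (A * B)" "j < dim_col (A * B)"
    then have ij: "i < a" "j < a" using A B by auto
    have "(A' * B') $$ (i, j) = (\<Sum>k<a. A' $$ (i, k) * B' $$ (k, j))"
      using carr ij by (auto simp: scalar_prod_def atLeast0LessThan intro!: sum.cong)
    also have "\<dots> = (\<Sum>k<b. A $$ (i, k) * B $$ (k, j))"
      using ba ij by (intro sum.mono_neutral_cong_right) (auto simp: A'_def B'_def)
    also have "\<dots> = (A * B) $$ (i, j)"
      using A B ij by (auto simp: scalar_prod_def atLeast0LessThan intro!: sum.cong)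
    finally show "(A' * B') $$ (i, j) = (A * B) $$ (i, j)" .
  qed (use A B carr in auto)
  then have "B' * A' = 1\<^sub>m a"
    using mat_mult_left_right_inverse[OF carr] AB by simp
  moreover have "(B' * A') $$ (b, b) = 0"
    using carr ba by (auto simp: scalar_prod_def B'_def)
  ultimately show False using ba by simp
qed

text \<open>Here and in the next four lemmas the carrier premises become equations between
  dimensions, which \<open>simp\<close> can discharge from the lists \<open>d\<close> of dimension
  facts collected in later proofs.\<close>

lemma mult_assoc_dim:
  fixes A :: "'k :: field mat"
  shows "dim_col A = dim_row B \<Longrightarrow> dim_col B = dim_row C \<Longrightarrow> A * B * C = A * (B * C)"
  by (rule assoc_mult_mat[of A "dim_row A" "dim_col A" B "dim_col B" C "dim_col C"]) auto

lemma mult_add_distrib_dim: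
  fixes A :: "'k :: field mat"
  shows "dim_col A = dim_row B \<Longrightarrow> dim_row C = dim_row B \<Longrightarrow> dim_col C = dim_col B \<Longrightarrow>
    A * (B + C) = A * B + A * C"
  by (rule mult_add_distrib_mat[of A "dim_row A" "dim_col A" B "dim_col B" C]) auto

lemma add_mult_distrib_dim:
  fixes A :: "'k :: field mat"
  shows "dim_col A = dim_row C \<Longrightarrow> dim_row A = dim_row B \<Longrightarrow> dim_col A = dim_col B \<Longrightarrow>
    (A + B) * C = A * C + B * C"
  by (rule add_mult_distrib_mat[of A "dim_row A" "dim_col A" B C "dim_col C"]) auto

lemma mult_minus_distrib_dim:
  fixes A :: "'k :: field mat"
  shows "dim_col A = dim_row B \<Longrightarrow> dim_row C = dim_row B \<Longrightarrow> dim_col C = dim_col B \<Longrightarrow>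
    A * (B - C) = A * B - A * C"
  by (rule mult_minus_distrib_mat[of A "dim_row A" "dim_col A" B "dim_col B" C]) auto

lemma minus_mult_distrib_dim:
  fixes A :: "'k :: field mat"
  shows "dim_col A = dim_row C \<Longrightarrow> dim_row A = dim_row B \<Longrightarrow> dim_col A = dim_col B \<Longrightarrow>
    (A - B) * C = A * C - B * C"
  by (rule minus_mult_distrib_mat[of A "dim_row A" "dim_col A" B C "dim_col C"]) auto

lemma minus_zero_mat: "A \<in> carrier_mat r c \<Longrightarrow> A - 0\<^sub>m r c = A" for A :: "'k :: field mat"
  by (intro eq_matI) auto

text \<open>An interval representation has dimension at most 1 at each vertex. Where it is 0 the
  complement is everything; where it is 1 the rank one case applies. The two vanishing products
  follow by inserting \<open>j * q = 1 - x * p\<close>.\<close>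

lemma complement_of_small_retract:
  fixes p :: "'k :: field mat"
  assumes p: "p \<in> carrier_mat s d" and x: "x \<in> carrier_mat d s" and px: "p * x = 1\<^sub>m s" and s: "s \<le> 1"
  obtains j q where "j \<in> carrier_mat d (d - s)" "q \<in> carrier_mat (d - s) d"
    "q * j = 1\<^sub>m (d - s)" "j * q = 1\<^sub>m d - x * p" "p * j = 0\<^sub>m s (d - s)" "q * x = 0\<^sub>m (d - s) s"
proof -
  consider "s = 0" | "s = 1" using s by linarith
  then obtain j q where jq: "j \<in> carrier_mat d (d - s)" "q \<in> carrier_mat (d - s) d"
    "q * j = 1\<^sub>m (d - s)" "j * q = 1\<^sub>m d - x * p"
  proof cases
    case 1
    have "x * p = 0\<^sub>m d d" using p x 1 by (intro eq_matI) (auto simp: scalar_prod_def)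
    with 1 that[of "1\<^sub>m d" "1\<^sub>m d"] show ?thesis by (simp add: minus_zero_mat[of _ d d])
  next
    case 2
    with p x px complement_of_rank_one[of p d x] that show ?thesis by metis
  qed
  have N: "p * (1\<^sub>m d - x * p) = 0\<^sub>m s d" "(1\<^sub>m d - x * p) * x = 0\<^sub>m d s"
  proof -
    have "p * (x * p) = p" "x * p * x = x"
      using p x px by (simp_all add: mult_assoc_dim flip: mult_assoc_dim[of p x p])
    then show "p * (1\<^sub>m d - x * p) = 0\<^sub>m s d" "(1\<^sub>m d - x * p) * x = 0\<^sub>m d s"
      using p x by (simp_all add: mult_minus_distrib_dim minus_mult_distrib_dim)
  qed
  have "j * q * j = j" "q * (j * q) = q"
    using jq(1-3) by (simp_all add: mult_assoc_dim flip: mult_assoc_dim[of q j q])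
  then have "p * j = p * (j * q) * j" "q * x = q * ((j * q) * x)"
    using jq(1,2) p x mult_assoc_dim[of p "j * q" j] mult_assoc_dim[of q "j * q" x] by auto
  then have "p * j = 0\<^sub>m s (d - s)" "q * x = 0\<^sub>m (d - s) s"
    using jq N by simp_all
  with jq that show ?thesis by blast
qed

section \<open>Homomorphisms of quiver representations\<close>

lemma diag_block_mat_pair:
  "A \<in> carrier_mat a c \<Longrightarrow> B \<in> carrier_mat b d \<Longrightarrow>
    diag_block_mat [A, B] = four_block_mat A (0\<^sub>m a d) (0\<^sub>m b c) B"
  for A B :: "'k :: field mat"
  unfolding diag_block_mat.simps(2)[of A] by (simp add: Let_def del: diag_block_mat.simps)

lemma is_rep_carrier: "is_rep Q V \<Longrightarrow> e \<in> arcs Q \<Longrightarrow> rmap V e \<in> carrier_mat (rdim V (head Q e)) (rdim V (tail Q e))"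
  by (simp add: is_rep_def)

lemma is_hom_carrier: "is_hom Q V W f \<Longrightarrow> v \<in> verts Q \<Longrightarrow> f v \<in> carrier_mat (rdim W v) (rdim V v)"
  by (simp add: is_hom_def)

lemma is_hom_commute: "is_hom Q V W f \<Longrightarrow> e \<in> arcs Q \<Longrightarrow> f (head Q e) * rmap V e = rmap W e * f (tail Q e)"
  by (simp add: is_hom_def)

lemma is_hom_id: "wf_digraph Q \<Longrightarrow> is_rep Q V \<Longrightarrow> is_hom Q V V (\<lambda>v. 1\<^sub>m (rdim V v))"
  by (auto simp: is_hom_def is_rep_def)

context
  fixes Q :: "('a, 'b) pre_digraph"
  assumes wf: "wf_digraph Q"
begin

lemma arc_dims:
  assumes "e \<in> arcs Q" "is_rep Q V" "is_rep Q W" "is_hom Q V W f"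
  shows "f (head Q e) \<in> carrier_mat (rdim W (head Q e)) (rdim V (head Q e))"
    "f (tail Q e) \<in> carrier_mat (rdim W (tail Q e)) (rdim V (tail Q e))"
    "rmap V e \<in> carrier_mat (rdim V (head Q e)) (rdim V (tail Q e))"
    "rmap W e \<in> carrier_mat (rdim W (head Q e)) (rdim W (tail Q e))"
  using assms wf by (auto simp: is_rep_def is_hom_def wf_digraph_def)

lemma is_hom_comp:
  assumes "is_rep Q U" "is_rep Q V" "is_rep Q W" and f: "is_hom Q U V f" and g: "is_hom Q V W g"
  shows "is_hom Q U W (\<lambda>v. g v * f v)"
  unfolding is_hom_def
proof (intro conjI ballI)
  fix v assume "v \<in> verts Q"
  then show "g v * f v \<in> carrier_mat (rdim W v) (rdim U v)"
    using is_hom_carrier[OF f] is_hom_carrier[OF g] by (meson mult_carrier_mat)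
next
  fix e assume e: "e \<in> arcs Q"
  note d = arc_dims[OF e assms(1,2) f] arc_dims[OF e assms(2,3) g]
  note d' = d[THEN carrier_matD(1)] d[THEN carrier_matD(2)]
  have "g (head Q e) * f (head Q e) * rmap U e = g (head Q e) * (rmap V e * f (tail Q e))"
    using d' is_hom_commute[OF f e] by (simp add: mult_assoc_dim)
  also have "\<dots> = rmap W e * (g (tail Q e) * f (tail Q e))"
    using d' is_hom_commute[OF g e] by (simp flip: mult_assoc_dim)
  finally show "g (head Q e) * f (head Q e) * rmap U e = rmap W e * (g (tail Q e) * f (tail Q e))" .
qed

lemma is_hom_add:
  assumes "is_rep Q U" "is_rep Q V" and f: "is_hom Q U V f" and g: "is_hom Q U V g"
  shows "is_hom Q U V (\<lambda>v. f v + g v)"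
  unfolding is_hom_def
proof (intro conjI ballI)
  fix v assume "v \<in> verts Q"
  then show "f v + g v \<in> carrier_mat (rdim V v) (rdim U v)"
    using is_hom_carrier[OF f] is_hom_carrier[OF g] by (meson add_carrier_mat)
next
  fix e assume e: "e \<in> arcs Q"
  note d = arc_dims[OF e assms(1,2) f] arc_dims[OF e assms(1,2) g]
  show "(f (head Q e) + g (head Q e)) * rmap U e = rmap V e * (f (tail Q e) + g (tail Q e))"
    using is_hom_commute[OF f e] is_hom_commute[OF g e] d[THEN carrier_matD(1)] d[THEN carrier_matD(2)]
    by (simp add: mult_add_distrib_dim add_mult_distrib_dim)
qed

lemma is_hom_minus:
  assumes "is_rep Q U" "is_rep Q V" and f: "is_hom Q U V f" and g: "is_hom Q U V g"
  shows "is_hom Q U V (\<lambda>v. f v - g v)"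
  unfolding is_hom_def
proof (intro conjI ballI)
  fix v assume "v \<in> verts Q"
  then show "f v - g v \<in> carrier_mat (rdim V v) (rdim U v)"
    using is_hom_carrier[OF f] is_hom_carrier[OF g] by (meson minus_carrier_mat)
next
  fix e assume e: "e \<in> arcs Q"
  note d = arc_dims[OF e assms(1,2) f] arc_dims[OF e assms(1,2) g]
  show "(f (head Q e) - g (head Q e)) * rmap U e = rmap V e * (f (tail Q e) - g (tail Q e))"
    using is_hom_commute[OF f e] is_hom_commute[OF g e] d[THEN carrier_matD(1)] d[THEN carrier_matD(2)]
    by (simp add: mult_minus_distrib_dim minus_mult_distrib_dim)
qed

lemma rep_iso_refl: "is_rep Q V \<Longrightarrow> rep_iso Q V V"
  unfolding rep_iso_def
  by (intro exI[of _ "\<lambda>v. 1\<^sub>m (rdim V v)"]) (use is_hom_id[OF wf] in auto)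

lemma rep_iso_sym: "rep_iso Q V W \<Longrightarrow> rep_iso Q W V"
  unfolding rep_iso_def by blast

lemma comp_inverse:
  fixes a b c d :: "'k :: field mat"
  assumes "a \<in> carrier_mat p q" "b \<in> carrier_mat q p" "c \<in> carrier_mat r p" "d \<in> carrier_mat p r"
    "b * a = 1\<^sub>m q" "d * c = 1\<^sub>m p"
  shows "(b * d) * (c * a) = 1\<^sub>m q"
proof -
  have "(b * d) * (c * a) = b * ((d * c) * a)"
    using assms(1-4) by (simp add: mult_assoc_dim)
  then show ?thesis using assms by simp
qed

lemma rep_iso_trans:
  assumes reps: "is_rep Q U" "is_rep Q V" "is_rep Q W" and "rep_iso Q U V" "rep_iso Q V W"
  shows "rep_iso Q U W"
proof -
  obtain f f' where f: "is_hom Q U V f" "is_hom Q V U f'"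
    "\<And>v. v \<in> verts Q \<Longrightarrow> f' v * f v = 1\<^sub>m (rdim U v) \<and> f v * f' v = 1\<^sub>m (rdim V v)"
    using assms(4) unfolding rep_iso_def by blast
  obtain g g' where g: "is_hom Q V W g" "is_hom Q W V g'"
    "\<And>v. v \<in> verts Q \<Longrightarrow> g' v * g v = 1\<^sub>m (rdim V v) \<and> g v * g' v = 1\<^sub>m (rdim W v)"
    using assms(5) unfolding rep_iso_def by blast
  have "is_hom Q U W (\<lambda>v. g v * f v)" "is_hom Q W U (\<lambda>v. f' v * g' v)"
    using is_hom_comp reps f g by blast+
  moreover have "f' v * g' v * (g v * f v) = 1\<^sub>m (rdim U v) \<and> g v * f v * (f' v * g' v) = 1\<^sub>m (rdim W v)"
    if "v \<in> verts Q" for v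
    using is_hom_carrier[OF f(1) that] is_hom_carrier[OF f(2) that] is_hom_carrier[OF g(1) that]
      is_hom_carrier[OF g(2) that] f(3)[OF that] g(3)[OF that]
    by (blast intro: comp_inverse)
  ultimately show ?thesis unfolding rep_iso_def by (intro exI conjI ballI) auto
qed

lemma rep_iso_rdim:
  assumes "rep_iso Q V W" "v \<in> verts Q" shows "rdim V v = rdim W v"
proof -
  obtain f g where fg: "is_hom Q V W f" "is_hom Q W V g" "g v * f v = 1\<^sub>m (rdim V v)" "f v * g v = 1\<^sub>m (rdim W v)"
    using assms unfolding rep_iso_def by blast
  note c = is_hom_carrier[OF fg(1) assms(2)] is_hom_carrier[OF fg(2) assms(2)]
  show ?thesis
    using right_inverse_dim_le[OF c(1,2) fg(4)] right_inverse_dim_le[OF c(2,1) fg(3)] by simp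
qed

lemma iso_class_eq_iff:
  assumes "is_rep Q V" "is_rep Q W"
  shows "iso_class Q V = iso_class Q W \<longleftrightarrow> rep_iso Q V W"
proof
  assume "iso_class Q V = iso_class Q W"
  then have "W \<in> iso_class Q V" using assms rep_iso_refl by (simp add: iso_class_def)
  then show "rep_iso Q V W" by (simp add: iso_class_def)
next
  assume "rep_iso Q V W"
  then show "iso_class Q V = iso_class Q W"
    using assms rep_iso_trans rep_iso_sym unfolding iso_class_def by blast
qed

lemma is_zero_rep_iso: "rep_iso Q V W \<Longrightarrow> is_zero_rep Q V \<longleftrightarrow> is_zero_rep Q W"
  using rep_iso_rdim[of V W] by (simp add: is_zero_rep_def)

lemma is_rep_direct_sum2:
  assumes "is_rep Q X" "is_rep Q Y" shows "is_rep Q (direct_sum [X, Y])"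
  unfolding is_rep_def
proof
  fix e assume e: "e \<in> arcs Q"
  show "rmap (direct_sum [X, Y]) e \<in>
      carrier_mat (rdim (direct_sum [X, Y]) (head Q e)) (rdim (direct_sum [X, Y]) (tail Q e))"
    using diag_block_mat_pair[OF assms[THEN is_rep_carrier, OF e]] assms[THEN is_rep_carrier, OF e]
    by (simp add: direct_sum_def del: diag_block_mat.simps)
qed

lemma indecomposable_iso:
  assumes V: "indecomposable Q V" and W: "is_rep Q W" and iso: "rep_iso Q V W"
  shows "indecomposable Q W"
  unfolding indecomposable_def
proof (intro conjI allI impI)
  show "is_rep Q W" by fact
  show "\<not> is_zero_rep Q W" using is_zero_rep_iso[OF iso] V by (simp add: indecomposable_def)
next
  fix X Y assume XY: "is_rep Q X" "is_rep Q Y" "rep_iso Q W (direct_sum [X, Y])"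
  have "is_rep Q V" using V by (simp add: indecomposable_def)
  from rep_iso_trans[OF this W is_rep_direct_sum2[OF XY(1,2)] iso XY(3)]
  show "is_zero_rep Q X \<or> is_zero_rep Q Y" using V XY unfolding indecomposable_def by blast
qed

lemma iso_class_eqI: "is_rep Q V \<Longrightarrow> W \<in> iso_class Q V \<Longrightarrow> iso_class Q W = iso_class Q V"
  by (metis iso_class_def iso_class_eq_iff mem_Collect_eq rep_iso_sym)

lemma iso_class_self: "is_rep Q V \<Longrightarrow> V \<in> iso_class Q V"
  by (simp add: iso_class_def rep_iso_refl)

end

section \<open>Direct sums of two representations as biproducts\<close>

lemma mat_zero_dim_mult:
  fixes A :: "'k :: field mat"
  shows "dim_row A = 0 \<Longrightarrow> A * B = 0\<^sub>m 0 (dim_col B)" "dim_col B = 0 \<Longrightarrow> A * B = 0\<^sub>m (dim_row A) 0"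
  by (auto intro!: eq_matI)

lemma mult_four_block_dim:
  fixes A1 :: "'k :: field mat"
  assumes "dim_row B1 = dim_row A1" "dim_col C1 = dim_col A1" "dim_row D1 = dim_row C1" "dim_col D1 = dim_col B1"
    "dim_row A2 = dim_col A1" "dim_row B2 = dim_col A1" "dim_row C2 = dim_col B1" "dim_row D2 = dim_col B1"
    "dim_col C2 = dim_col A2" "dim_col D2 = dim_col B2"
  shows "four_block_mat A1 B1 C1 D1 * four_block_mat A2 B2 C2 D2 =
    four_block_mat (A1 * A2 + B1 * C2) (A1 * B2 + B1 * D2) (C1 * A2 + D1 * C2) (C1 * B2 + D1 * D2)"
  by (rule mult_four_block_mat[of A1 "dim_row A1" "dim_col A1" B1 "dim_col B1" C1 "dim_row C1" D1
        A2 "dim_col A2" B2 "dim_col B2" C2 D2]) (use assms in auto)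

lemma four_block_mat_empty:
  fixes A :: "'k :: field mat"
  assumes "A \<in> carrier_mat a c"
  shows "four_block_mat A (0\<^sub>m a 0) (0\<^sub>m 0 c) (0\<^sub>m 0 0) = A"
    "four_block_mat (0\<^sub>m 0 0) (0\<^sub>m 0 c) (0\<^sub>m a 0) A = A"
    "four_block_mat (0\<^sub>m 0 c) (0\<^sub>m 0 0) A (0\<^sub>m a 0) = A"
    "four_block_mat (0\<^sub>m a 0) A (0\<^sub>m 0 0) (0\<^sub>m 0 c) = A"
  using assms by (auto intro!: eq_matI)

text \<open>The injections and projections of a biproduct are all given four-block shape, with empty
  blocks, so that one multiplication rule for block matrices yields every product below.\<close>

definition block_inl :: "nat \<Rightarrow> nat \<Rightarrow> 'k :: field mat" where
  "block_inl a b = four_block_mat (1\<^sub>m a) (0\<^sub>m a 0) (0\<^sub>m b a) (0\<^sub>m b 0)"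
definition block_inr :: "nat \<Rightarrow> nat \<Rightarrow> 'k :: field mat" where
  "block_inr a b = four_block_mat (0\<^sub>m a 0) (0\<^sub>m a b) (0\<^sub>m b 0) (1\<^sub>m b)"
definition block_fst :: "nat \<Rightarrow> nat \<Rightarrow> 'k :: field mat" where
  "block_fst a b = four_block_mat (1\<^sub>m a) (0\<^sub>m a b) (0\<^sub>m 0 a) (0\<^sub>m 0 b)"
definition block_snd :: "nat \<Rightarrow> nat \<Rightarrow> 'k :: field mat" where
  "block_snd a b = four_block_mat (0\<^sub>m 0 a) (0\<^sub>m 0 b) (0\<^sub>m b a) (1\<^sub>m b)"

lemmas block_defs = block_inl_def block_inr_def block_fst_def block_snd_def

lemma block_carrier:
  "block_inl a b \<in> carrier_mat (a + b) a" "block_inr a b \<in> carrier_mat (a + b) b"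
  "block_fst a b \<in> carrier_mat a (a + b)" "block_snd a b \<in> carrier_mat b (a + b)"
  unfolding block_defs by (rule carrier_matI; simp)+

lemma block_products:
  "block_fst a b * block_inl a b = (1\<^sub>m a :: 'k :: field mat)"
  "block_snd a b * block_inr a b = (1\<^sub>m b :: 'k mat)"
  "block_fst a b * block_inr a b = (0\<^sub>m a b :: 'k mat)"
  "block_snd a b * block_inl a b = (0\<^sub>m b a :: 'k mat)"
  by (simp_all add: block_defs mult_four_block_dim mat_zero_dim_mult four_block_mat_empty[of _ a a] four_block_mat_empty[of _ a b]
      four_block_mat_empty[of _ b a] four_block_mat_empty[of _ b b])

lemma block_sum: "block_inl a b * block_fst a b + block_inr a b * block_snd a b = (1\<^sub>m (a + b) :: 'k :: field mat)"
proof -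
  have "block_inl a b * block_fst a b = (four_block_mat (1\<^sub>m a) (0\<^sub>m a b) (0\<^sub>m b a) (0\<^sub>m b b) :: 'k mat)"
    "block_inr a b * block_snd a b = (four_block_mat (0\<^sub>m a a) (0\<^sub>m a b) (0\<^sub>m b a) (1\<^sub>m b) :: 'k mat)"
    by (simp_all add: block_defs mult_four_block_dim mat_zero_dim_mult)
  then show ?thesis by (auto intro!: eq_matI)
qed

text \<open>Padding \<open>A\<close> or \<open>B\<close> with empty blocks turns both sides into
  products of four-block matrices. These identities are the compatibility with arcs that makes the
  injections and projections homomorphisms.\<close>

lemma block_natural:
  fixes A B :: "'k :: field mat"
  assumes A: "A \<in> carrier_mat a c" and B: "B \<in> carrier_mat b d"
  shows "block_inl a b * A = diag_block_mat [A, B] * block_inl c d"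
    "block_inr a b * B = diag_block_mat [A, B] * block_inr c d"
    "block_fst a b * diag_block_mat [A, B] = A * block_fst c d"
    "block_snd a b * diag_block_mat [A, B] = B * block_snd c d"
proof -
  have AB: "diag_block_mat [A, B] = four_block_mat A (0\<^sub>m a d) (0\<^sub>m b c) B"
    by (rule diag_block_mat_pair[OF A B])
  have "block_inl a b * four_block_mat A (0\<^sub>m a 0) (0\<^sub>m 0 c) (0\<^sub>m 0 0) = diag_block_mat [A, B] * block_inl c d"
    "block_inr a b * four_block_mat (0\<^sub>m 0 0) (0\<^sub>m 0 d) (0\<^sub>m b 0) B = diag_block_mat [A, B] * block_inr c d"
    "block_fst a b * diag_block_mat [A, B] = four_block_mat A (0\<^sub>m a 0) (0\<^sub>m 0 c) (0\<^sub>m 0 0) * block_fst c d"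
    "block_snd a b * diag_block_mat [A, B] = four_block_mat (0\<^sub>m 0 0) (0\<^sub>m 0 d) (0\<^sub>m b 0) B * block_snd c d"
    using A B by (simp_all add: AB block_defs mult_four_block_dim mat_zero_dim_mult del: diag_block_mat.simps)
  then show "block_inl a b * A = diag_block_mat [A, B] * block_inl c d"
    "block_inr a b * B = diag_block_mat [A, B] * block_inr c d"
    "block_fst a b * diag_block_mat [A, B] = A * block_fst c d"
    "block_snd a b * diag_block_mat [A, B] = B * block_snd c d"
    unfolding four_block_mat_empty[OF A] four_block_mat_empty[OF B] .
qed

lemma direct_sum_biproduct:
  assumes "wf_digraph Q" and X: "is_rep Q X" and Y: "is_rep Q Y"
  obtains i1 i2 p1 p2 where
    "is_hom Q X (direct_sum [X, Y]) i1" "is_hom Q Y (direct_sum [X, Y]) i2"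
    "is_hom Q (direct_sum [X, Y]) X p1" "is_hom Q (direct_sum [X, Y]) Y p2"
    "\<And>v. p1 v * i1 v = 1\<^sub>m (rdim X v)" "\<And>v. p2 v * i2 v = 1\<^sub>m (rdim Y v)"
    "\<And>v. p1 v * i2 v = 0\<^sub>m (rdim X v) (rdim Y v)" "\<And>v. p2 v * i1 v = 0\<^sub>m (rdim Y v) (rdim X v)"
    "\<And>v. i1 v * p1 v + i2 v * p2 v = 1\<^sub>m (rdim X v + rdim Y v)"
proof
  let ?i1 = "\<lambda>v. block_inl (rdim X v) (rdim Y v)" and ?i2 = "\<lambda>v. block_inr (rdim X v) (rdim Y v)"
    and ?p1 = "\<lambda>v. block_fst (rdim X v) (rdim Y v)" and ?p2 = "\<lambda>v. block_snd (rdim X v) (rdim Y v)"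
  show "is_hom Q X (direct_sum [X, Y]) ?i1" "is_hom Q Y (direct_sum [X, Y]) ?i2"
    "is_hom Q (direct_sum [X, Y]) X ?p1" "is_hom Q (direct_sum [X, Y]) Y ?p2"
    using block_natural[OF is_rep_carrier[OF X] is_rep_carrier[OF Y]]
    by (auto simp: is_hom_def direct_sum_def block_carrier simp del: diag_block_mat.simps)
qed (simp_all add: block_products block_sum)

lemma indecomposable_rep: "indecomposable Q V \<Longrightarrow> is_rep Q V"
  by (simp add: indecomposable_def)

lemma one_mat_neq_zero: "0 < d \<Longrightarrow> 1\<^sub>m d \<noteq> (0\<^sub>m d d :: 'k :: field mat)"
proof
  assume "0 < d" "1\<^sub>m d = (0\<^sub>m d d :: 'k mat)"
  then have "1\<^sub>m d $$ (0, 0) = (0\<^sub>m d d $$ (0, 0) :: 'k)" by simp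
  with \<open>0 < d\<close> show False by simp
qed

text \<open>A retract splits off: the idempotents \<open>1 - i p\<close> cut out a complement
  \<open>K\<close>, and indecomposability forces \<open>K\<close> to be zero. This is how
  isomorphism with an interval is recognised, from one map in and one map out.\<close>

lemma retract_of_indecomposable:
  fixes V X :: "('a, 'b, 'k :: field) qrep"
  assumes wf: "wf_digraph Q" and V: "indecomposable Q V" and X: "is_rep Q X" "\<not> is_zero_rep Q X"
    and small: "\<And>v. v \<in> verts Q \<Longrightarrow> rdim X v \<le> 1"
    and i: "is_hom Q X V i" and p: "is_hom Q V X p"
    and pi: "\<And>v. v \<in> verts Q \<Longrightarrow> p v * i v = 1\<^sub>m (rdim X v)"
  shows "rep_iso Q V X"
proof -
  have Vr: "is_rep Q V" using V by (rule indecomposable_rep)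
  define dk where "dk = (\<lambda>v. rdim V v - rdim X v)"
  have "\<forall>v \<in> verts Q. \<exists>j q. j \<in> carrier_mat (rdim V v) (dk v) \<and>
      q \<in> carrier_mat (dk v) (rdim V v) \<and> q * j = 1\<^sub>m (dk v) \<and>
      j * q = 1\<^sub>m (rdim V v) - i v * p v \<and> p v * j = 0\<^sub>m (rdim X v) (dk v) \<and>
      q * i v = 0\<^sub>m (dk v) (rdim X v)"
    unfolding dk_def
    using complement_of_small_retract[OF is_hom_carrier[OF p] is_hom_carrier[OF i] pi small] by metis
  then obtain j q where jq: "\<And>v. v \<in> verts Q \<Longrightarrow> j v \<in> carrier_mat (rdim V v) (dk v) \<and>
      q v \<in> carrier_mat (dk v) (rdim V v) \<and> q v * j v = 1\<^sub>m (dk v) \<and>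
      j v * q v = 1\<^sub>m (rdim V v) - i v * p v \<and> p v * j v = 0\<^sub>m (rdim X v) (dk v) \<and>
      q v * i v = 0\<^sub>m (dk v) (rdim X v)"
    by metis
  \<comment> \<open>\<open>K\<close> is the kernel of \<open>p\<close> in the coordinates
    \<open>j\<close>; the arc maps of \<open>V\<close> are applied to \<open>j\<close> and read back
    by \<open>q\<close>.\<close>
  define K :: "('a, 'b, 'k) qrep" where
    "K = \<lparr>rdim = \<lambda>v. dk v, rmap = \<lambda>e. q (head Q e) * (rmap V e * j (tail Q e))\<rparr>"
  have dK: "rdim K v = dk v" for v by (simp add: K_def)
  have ends: "head Q e \<in> verts Q" "tail Q e \<in> verts Q" if "e \<in> arcs Q" for e
    using that wf by (auto simp: wf_digraph_def)
  note jqc = jq[THEN conjunct1] jq[THEN conjunct2, THEN conjunct1]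
  have K: "is_rep Q K"
    unfolding is_rep_def
  proof
    fix e assume e: "e \<in> arcs Q"
    have "q (head Q e) * (rmap V e * j (tail Q e)) \<in> carrier_mat (rdim K (head Q e)) (rdim K (tail Q e))"
      unfolding dK using jqc[OF ends(1)[OF e]] jqc[OF ends(2)[OF e]] is_rep_carrier[OF Vr e] by simp
    then show "rmap K e \<in> carrier_mat (rdim K (head Q e)) (rdim K (tail Q e))"
      by (simp add: K_def)
  qed
  have q: "is_hom Q V K q"
    unfolding is_hom_def
  proof (intro conjI ballI)
    fix e assume e: "e \<in> arcs Q"
    note h = jq[OF ends(1)[OF e]] and t = jq[OF ends(2)[OF e]]
    note c = is_rep_carrier[OF Vr e] is_rep_carrier[OF X(1) e]
      is_hom_carrier[OF i ends(1)[OF e]] is_hom_carrier[OF i ends(2)[OF e]]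
      is_hom_carrier[OF p ends(1)[OF e]] is_hom_carrier[OF p ends(2)[OF e]]
      h[THEN conjunct1] h[THEN conjunct2, THEN conjunct1] t[THEN conjunct1] t[THEN conjunct2, THEN conjunct1]
    note d = c[THEN carrier_matD(1)] c[THEN carrier_matD(2)]
    \<comment> \<open>Replacing \<open>j q\<close> by \<open>1 - i p\<close> leaves an error term
      with \<open>i p\<close>; it is moved across the arc because \<open>i\<close> is a
      homomorphism, and then killed by \<open>q\<close>.\<close>
    have "rmap K e * q (tail Q e) = q (head Q e) * (rmap V e * (j (tail Q e) * q (tail Q e)))"
      using d by (simp add: K_def mult_assoc_dim)
    also have "\<dots> = q (head Q e) * (rmap V e * (1\<^sub>m (rdim V (tail Q e)) - i (tail Q e) * p (tail Q e)))"
      using t by simp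
    also have "rmap V e * (1\<^sub>m (rdim V (tail Q e)) - i (tail Q e) * p (tail Q e)) =
        rmap V e - rmap V e * i (tail Q e) * p (tail Q e)"
      using d c(1) by (simp add: mult_minus_distrib_dim mult_assoc_dim)
    also have "\<dots> = rmap V e - i (head Q e) * (rmap X e * p (tail Q e))"
      unfolding is_hom_commute[OF i e, symmetric] using d by (simp add: mult_assoc_dim)
    also have "q (head Q e) * \<dots> = q (head Q e) * rmap V e - q (head Q e) * i (head Q e) * (rmap X e * p (tail Q e))"
      using d by (simp add: mult_minus_distrib_dim mult_assoc_dim)
    also have "\<dots> = q (head Q e) * rmap V e"
      using h c d by (simp add: minus_zero_mat[of _ "dk (head Q e)"])
    finally show "q (head Q e) * rmap V e = rmap K e * q (tail Q e)" by simp
  qed (use jq dK in auto)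
  have j: "is_hom Q K V j"
    unfolding is_hom_def
  proof (intro conjI ballI)
    fix e assume e: "e \<in> arcs Q"
    note h = jq[OF ends(1)[OF e]] and t = jq[OF ends(2)[OF e]]
    note c = is_rep_carrier[OF Vr e] is_rep_carrier[OF X(1) e]
      is_hom_carrier[OF i ends(1)[OF e]] is_hom_carrier[OF i ends(2)[OF e]]
      is_hom_carrier[OF p ends(1)[OF e]] is_hom_carrier[OF p ends(2)[OF e]]
      h[THEN conjunct1] h[THEN conjunct2, THEN conjunct1] t[THEN conjunct1] t[THEN conjunct2, THEN conjunct1]
    note d = c[THEN carrier_matD(1)] c[THEN carrier_matD(2)]
    \<comment> \<open>Dually, the error term is moved across the arc because \<open>p\<close> is a
      homomorphism, and then killed by \<open>j\<close>.\<close>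
    have "j (head Q e) * rmap K e = j (head Q e) * q (head Q e) * (rmap V e * j (tail Q e))"
      using d by (simp add: K_def mult_assoc_dim)
    also have "\<dots> = (1\<^sub>m (rdim V (head Q e)) - i (head Q e) * p (head Q e)) * (rmap V e * j (tail Q e))"
      using h by simp
    also have "\<dots> = rmap V e * j (tail Q e) - i (head Q e) * (p (head Q e) * rmap V e * j (tail Q e))"
      using d left_mult_one_mat[OF mult_carrier_mat[OF c(1) t[THEN conjunct1]]]
      by (simp add: minus_mult_distrib_dim mult_assoc_dim)
    also have "p (head Q e) * rmap V e * j (tail Q e) = rmap X e * (p (tail Q e) * j (tail Q e))"
      unfolding is_hom_commute[OF p e] using d by (simp add: mult_assoc_dim)
    also have "rmap V e * j (tail Q e) - i (head Q e) * \<dots> = rmap V e * j (tail Q e)"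
      using t c d by (simp add: minus_zero_mat[of _ "rdim V (head Q e)"])
    finally show "j (head Q e) * rmap K e = rmap V e * j (tail Q e)" .
  qed (use jq dK in auto)
  obtain i1 i2 p1 p2 where bi:
    "is_hom Q X (direct_sum [X, K]) i1" "is_hom Q K (direct_sum [X, K]) i2"
    "is_hom Q (direct_sum [X, K]) X p1" "is_hom Q (direct_sum [X, K]) K p2"
    "\<And>v. p1 v * i1 v = 1\<^sub>m (rdim X v)" "\<And>v. p2 v * i2 v = 1\<^sub>m (rdim K v)"
    "\<And>v. p1 v * i2 v = 0\<^sub>m (rdim X v) (rdim K v)" "\<And>v. p2 v * i1 v = 0\<^sub>m (rdim K v) (rdim X v)"
    "\<And>v. i1 v * p1 v + i2 v * p2 v = 1\<^sub>m (rdim X v + rdim K v)"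
    using direct_sum_biproduct[OF wf X(1) K] by blast
  let ?F = "\<lambda>v. i1 v * p v + i2 v * q v" and ?G = "\<lambda>v. i v * p1 v + j v * p2 v"
  note S = is_rep_direct_sum2[OF wf X(1) K]
  have F: "is_hom Q V (direct_sum [X, K]) ?F" and G: "is_hom Q (direct_sum [X, K]) V ?G"
    by (intro is_hom_add[OF wf] is_hom_comp[OF wf _ X(1)] is_hom_comp[OF wf _ K] S Vr p q i j bi)+
  have "?G v * ?F v = 1\<^sub>m (rdim V v) \<and> ?F v * ?G v = 1\<^sub>m (rdim (direct_sum [X, K]) v)" if v: "v \<in> verts Q" for v
  proof
    note c = is_hom_carrier[OF bi(1) v] is_hom_carrier[OF bi(2) v] is_hom_carrier[OF bi(3) v]
      is_hom_carrier[OF bi(4) v] is_hom_carrier[OF i v] is_hom_carrier[OF p v]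
      is_hom_carrier[OF j v] is_hom_carrier[OF q v]
    note d = c[THEN carrier_matD(1)] c[THEN carrier_matD(2)]
    have dS: "rdim (direct_sum [X, K]) v = rdim X v + rdim K v" by (simp add: direct_sum_def)
    have "?G v * ?F v = i v * (p1 v * i1 v) * p v + j v * (p2 v * i1 v) * p v +
        (i v * (p1 v * i2 v) * q v + j v * (p2 v * i2 v) * q v)"
      using d by (simp add: mult_assoc_dim add_mult_distrib_dim mult_add_distrib_dim)
    also have "\<dots> = i v * p v + j v * q v"
      using c unfolding bi(5-8) by simp
    also have "\<dots> = 1\<^sub>m (rdim V v)"
      using jq[OF v] c by (auto intro!: eq_matI)
    finally show "?G v * ?F v = 1\<^sub>m (rdim V v)" .
    have "?F v * ?G v = i1 v * (p v * i v) * p1 v + i2 v * (q v * i v) * p1 v +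
        (i1 v * (p v * j v) * p2 v + i2 v * (q v * j v) * p2 v)"
      using d by (simp add: mult_assoc_dim add_mult_distrib_dim mult_add_distrib_dim)
    also have "\<dots> = i1 v * p1 v + i2 v * p2 v"
      using c pi[OF v] jq[OF v] by (simp add: dK)
    finally show "?F v * ?G v = 1\<^sub>m (rdim (direct_sum [X, K]) v)" using bi(9) dS by simp
  qed
  then have "rep_iso Q V (direct_sum [X, K])"
    unfolding rep_iso_def using F G by blast
  then have "is_zero_rep Q K" using V X K unfolding indecomposable_def by blast
  then have zK: "dk v = 0" if "v \<in> verts Q" for v
    using that by (simp add: is_zero_rep_def dK)
  \<comment> \<open>A zero complement means that \<open>j q\<close>, that is \<open>1 - i p\<close>,
    vanishes.\<close>
  have "i v * p v = 1\<^sub>m (rdim V v)" if v: "v \<in> verts Q" for v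
  proof -
    have "j v \<in> carrier_mat (rdim V v) 0" "q v \<in> carrier_mat 0 (rdim V v)" using jq[OF v] zK[OF v] by auto
    then have "j v * q v = 0\<^sub>m (rdim V v) (rdim V v)" by (auto intro!: eq_matI simp: scalar_prod_def)
    then have z: "1\<^sub>m (rdim V v) - i v * p v = 0\<^sub>m (rdim V v) (rdim V v)" using jq[OF v] by simp
    show ?thesis
    proof (rule eq_matI)
      fix a b assume "a < dim_row (1\<^sub>m (rdim V v) :: 'k mat)" "b < dim_col (1\<^sub>m (rdim V v) :: 'k mat)"
      then show "(i v * p v) $$ (a, b) = 1\<^sub>m (rdim V v) $$ (a, b)"
        using arg_cong[OF z, of "\<lambda>A. A $$ (a, b)"] is_hom_carrier[OF i v] is_hom_carrier[OF p v]
        by (auto split: if_splits)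
    qed (use is_hom_carrier[OF i v] is_hom_carrier[OF p v] in auto)
  qed
  then show ?thesis unfolding rep_iso_def using i p pi by blast
qed

lemma zero_mult_mat_vec: "x \<in> carrier_vec c \<Longrightarrow> 0\<^sub>m r c *\<^sub>v x = (0\<^sub>v r :: 'k :: field vec)"
  by (auto intro!: eq_vecI simp: scalar_prod_def)

lemma vec_eq_if_minus_zero:
  fixes a b :: "'k :: field vec"
  assumes "a \<in> carrier_vec d" "b \<in> carrier_vec d" "a - b = 0\<^sub>v d"
  shows "a = b"
proof (rule eq_vecI)
  fix i assume i: "i < dim_vec b"
  have "(a - b) $ i = 0\<^sub>v d $ i" by (simp only: assms(3))
  then show "a $ i = b $ i" using assms(1,2) i by auto
qed (use assms in auto)

section \<open>Almost split sequences\<close>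

lemma short_exact_left_cancel:
  assumes "short_exact Q L f E g R" "v \<in> verts Q"
    and A: "A \<in> carrier_mat (rdim L v) c" and B: "B \<in> carrier_mat (rdim L v) c" and eq: "f v * A = f v * B"
  shows "A = B"
proof (rule mat_eq_if_mult_vec[OF A B])
  fix x :: "'c vec" assume x: "x \<in> carrier_vec c"
  have f: "f v \<in> carrier_mat (rdim E v) (rdim L v)"
    using assms(1,2) by (auto simp: short_exact_def is_hom_def)
  have c: "A *\<^sub>v x \<in> carrier_vec (rdim L v)" "B *\<^sub>v x \<in> carrier_vec (rdim L v)" using A B x by auto
  have "f v *\<^sub>v (A *\<^sub>v x) = f v *\<^sub>v (B *\<^sub>v x)"
    using assoc_mult_mat_vec[OF f A x] assoc_mult_mat_vec[OF f B x] eq by simp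
  then have "f v *\<^sub>v (A *\<^sub>v x - B *\<^sub>v x) = 0\<^sub>v (rdim E v)"
    using f c by (simp add: mult_minus_distrib_mat_vec minus_cancel_vec)
  moreover have "\<forall>x \<in> carrier_vec (rdim L v). f v *\<^sub>v x = 0\<^sub>v (rdim E v) \<longrightarrow> x = 0\<^sub>v (rdim L v)"
    using assms(1,2) by (auto simp: short_exact_def)
  ultimately have "A *\<^sub>v x - B *\<^sub>v x = 0\<^sub>v (rdim L v)" using c by auto
  then show "A *\<^sub>v x = B *\<^sub>v x" by (rule vec_eq_if_minus_zero[OF c])
qed

lemma short_exact_zero:
  assumes "short_exact Q L f E g R" "v \<in> verts Q"
  shows "g v * f v = 0\<^sub>m (rdim R v) (rdim L v)"
proof (rule mat_eq_if_mult_vec)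
  have c: "f v \<in> carrier_mat (rdim E v) (rdim L v)" "g v \<in> carrier_mat (rdim R v) (rdim E v)"
    using assms by (auto simp: short_exact_def is_hom_def)
  then show "g v * f v \<in> carrier_mat (rdim R v) (rdim L v)" by simp
  fix x :: "'c vec" assume x: "x \<in> carrier_vec (rdim L v)"
  have "f v *\<^sub>v x \<in> carrier_vec (rdim E v)" using c x by simp
  then have "g v *\<^sub>v (f v *\<^sub>v x) = 0\<^sub>v (rdim R v)" using assms x by (auto simp: short_exact_def)
  then show "g v * f v *\<^sub>v x = 0\<^sub>m (rdim R v) (rdim L v) *\<^sub>v x"
    using assoc_mult_mat_vec[OF c(2,1) x] x by (auto intro!: eq_vecI simp: scalar_prod_def)
qed simp

lemma short_exact_right_inverse:
  assumes "short_exact Q L f E g R" "v \<in> verts Q"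
  obtains s where "s \<in> carrier_mat (rdim E v) (rdim R v)" "g v * s = 1\<^sub>m (rdim R v)"
proof -
  have g: "g v \<in> carrier_mat (rdim R v) (rdim E v)"
    using assms by (auto simp: short_exact_def is_hom_def)
  have "\<exists>y \<in> carrier_vec (rdim E v). 1\<^sub>m (rdim R v) *\<^sub>v z = g v *\<^sub>v y" if "z \<in> carrier_vec (rdim R v)" for z
    using assms that by (auto simp: short_exact_def)
  from mat_factor_through_image[OF one_carrier_mat g this] that show ?thesis by metis
qed

lemma short_exact_right_cancel:
  assumes "short_exact Q L f E g R" "v \<in> verts Q"
    and A: "A \<in> carrier_mat c (rdim R v)" and B: "B \<in> carrier_mat c (rdim R v)" and eq: "A * g v = B * g v"
  shows "A = B"
proof -
  obtain s where s: "s \<in> carrier_mat (rdim E v) (rdim R v)" "g v * s = 1\<^sub>m (rdim R v)"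
    using short_exact_right_inverse[OF assms(1,2)] .
  have g: "g v \<in> carrier_mat (rdim R v) (rdim E v)"
    using assms by (auto simp: short_exact_def is_hom_def)
  have "A * g v * s = B * g v * s" using eq by simp
  then show ?thesis using A B g s by (simp add: mult_assoc_dim)
qed

text \<open>The universal property of the kernel. The factor is chosen at each vertex separately; as
  \<open>f\<close> is mono, compatibility with the arcs may be checked after composing with
  \<open>f\<close>.\<close>

lemma kernel_factor:
  assumes wf: "wf_digraph Q" and ex: "short_exact Q L f E g R"
    and reps: "is_rep Q X" "is_rep Q L" "is_rep Q E" and u: "is_hom Q X E u"
    and gu: "\<And>v. v \<in> verts Q \<Longrightarrow> g v * u v = 0\<^sub>m (rdim R v) (rdim X v)"
  obtains s where "is_hom Q X L s" "\<And>v. v \<in> verts Q \<Longrightarrow> f v * s v = u v"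
proof -
  have hom: "is_hom Q L E f" "is_hom Q E R g" using ex by (auto simp: short_exact_def)
  have "\<exists>s. s \<in> carrier_mat (rdim L v) (rdim X v) \<and> u v = f v * s" if v: "v \<in> verts Q" for v
  proof -
    have "\<exists>y \<in> carrier_vec (rdim L v). u v *\<^sub>v x = f v *\<^sub>v y" if x: "x \<in> carrier_vec (rdim X v)" for x
    proof -
      have "g v *\<^sub>v (u v *\<^sub>v x) = 0\<^sub>m (rdim R v) (rdim X v) *\<^sub>v x"
        using assoc_mult_mat_vec[OF is_hom_carrier[OF hom(2) v] is_hom_carrier[OF u v] x] gu[OF v] by simp
      also have "\<dots> = 0\<^sub>v (rdim R v)" using x by (auto intro!: eq_vecI simp: scalar_prod_def)
      finally show ?thesis
        using ex v is_hom_carrier[OF u v] x unfolding short_exact_def by (meson mult_mat_vec_carrier)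
    qed
    from mat_factor_through_image[OF is_hom_carrier[OF u v] is_hom_carrier[OF hom(1) v] this]
    show ?thesis by metis
  qed
  then obtain s where s: "\<And>v. v \<in> verts Q \<Longrightarrow> s v \<in> carrier_mat (rdim L v) (rdim X v) \<and> u v = f v * s v"
    by metis
  have "is_hom Q X L s"
    unfolding is_hom_def
  proof (intro conjI ballI)
    fix e assume e: "e \<in> arcs Q"
    have ht: "head Q e \<in> verts Q" "tail Q e \<in> verts Q" using e wf by (auto simp: wf_digraph_def)
    note c = reps[THEN is_rep_carrier, OF e] s[OF ht(1), THEN conjunct1] s[OF ht(2), THEN conjunct1]
      is_hom_carrier[OF hom(1) ht(1)] is_hom_carrier[OF hom(1) ht(2)]
    note d = c[THEN carrier_matD(1)] c[THEN carrier_matD(2)]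
    have "f (head Q e) * (s (head Q e) * rmap X e) = u (head Q e) * rmap X e"
      using d s[OF ht(1)] by (simp add: mult_assoc_dim)
    also have "\<dots> = rmap E e * f (tail Q e) * s (tail Q e)"
      using d s[OF ht(2)] is_hom_commute[OF u e] by (simp add: mult_assoc_dim)
    also have "\<dots> = f (head Q e) * (rmap L e * s (tail Q e))"
      unfolding is_hom_commute[OF hom(1) e, symmetric] using d by (simp add: mult_assoc_dim)
    finally show "s (head Q e) * rmap X e = rmap L e * s (tail Q e)"
      by (rule short_exact_left_cancel[OF ex ht(1) mult_carrier_mat[OF c(4,1)] mult_carrier_mat[OF c(2,5)]])
  qed (use s in auto)
  then show ?thesis using s that by metis
qed

text \<open>The universal property of the cokernel. At each vertex the factor is \<open>u s\<close>
  for a linear section \<open>s\<close> of \<open>g\<close>, and compatibility with the arcs is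
  checked after composing with the epi \<open>g\<close>.\<close>

lemma cokernel_factor:
  assumes wf: "wf_digraph Q" and ex: "short_exact Q L f E g R"
    and reps: "is_rep Q X" "is_rep Q R" "is_rep Q E" and u: "is_hom Q E X u"
    and uf: "\<And>v. v \<in> verts Q \<Longrightarrow> u v * f v = 0\<^sub>m (rdim X v) (rdim L v)"
  obtains w where "is_hom Q R X w" "\<And>v. v \<in> verts Q \<Longrightarrow> w v * g v = u v"
proof -
  have hom: "is_hom Q L E f" "is_hom Q E R g" using ex by (auto simp: short_exact_def)
  have "\<exists>w. w \<in> carrier_mat (rdim X v) (rdim R v) \<and> w * g v = u v" if v: "v \<in> verts Q" for v
  proof -
    obtain s where s: "s \<in> carrier_mat (rdim E v) (rdim R v)" "g v * s = 1\<^sub>m (rdim R v)"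
      using short_exact_right_inverse[OF ex v] .
    note c = s(1) is_hom_carrier[OF hom(1) v] is_hom_carrier[OF hom(2) v] is_hom_carrier[OF u v]
    note d = c[THEN carrier_matD(1)] c[THEN carrier_matD(2)]
    have "u v * s * g v = u v"
    proof (rule mat_eq_if_mult_vec)
      fix x :: "'c vec" assume x: "x \<in> carrier_vec (rdim E v)"
      \<comment> \<open>\<open>s g x\<close> and \<open>x\<close> have the same image under
        \<open>g\<close>, so they differ by an element of the image of \<open>f\<close>, on which
        \<open>u\<close> vanishes.\<close>
      let ?y = "s *\<^sub>v (g v *\<^sub>v x)"
      have y: "?y \<in> carrier_vec (rdim E v)" using c x by simp
      have "g v *\<^sub>v ?y = g v *\<^sub>v x"
        using assoc_mult_mat_vec[OF c(3,1), of "g v *\<^sub>v x"] s c x by simp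
      then have "g v *\<^sub>v (?y - x) = 0\<^sub>v (rdim R v)"
        using c x y by (simp add: mult_minus_distrib_mat_vec minus_cancel_vec)
      then obtain z where z: "z \<in> carrier_vec (rdim L v)" "?y - x = f v *\<^sub>v z"
        using ex v x y unfolding short_exact_def by (meson minus_carrier_vec)
      have "u v *\<^sub>v (?y - x) = 0\<^sub>v (rdim X v)"
        unfolding z(2) assoc_mult_mat_vec[OF c(4,2) z(1), symmetric] uf[OF v] by (rule zero_mult_mat_vec[OF z(1)])
      then have "u v *\<^sub>v ?y - u v *\<^sub>v x = 0\<^sub>v (rdim X v)"
        using mult_minus_distrib_mat_vec[OF c(4) y x] by simp
      then have "u v *\<^sub>v ?y = u v *\<^sub>v x"
        by (rule vec_eq_if_minus_zero[OF mult_mat_vec_carrier[OF c(4) y] mult_mat_vec_carrier[OF c(4) x]])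
      moreover have "u v * s * g v *\<^sub>v x = u v *\<^sub>v ?y"
        using assoc_mult_mat_vec[OF mult_carrier_mat[OF c(4,1)] c(3) x]
          assoc_mult_mat_vec[OF c(4,1) mult_mat_vec_carrier[OF c(3) x]] by simp
      ultimately show "u v * s * g v *\<^sub>v x = u v *\<^sub>v x" by simp
    qed (use c in auto)
    then show ?thesis using c by (intro exI[of _ "u v * s"]) auto
  qed
  then obtain w where w: "\<And>v. v \<in> verts Q \<Longrightarrow> w v \<in> carrier_mat (rdim X v) (rdim R v) \<and> w v * g v = u v"
    by metis
  have "is_hom Q R X w"
    unfolding is_hom_def
  proof (intro conjI ballI)
    fix e assume e: "e \<in> arcs Q"
    have ht: "head Q e \<in> verts Q" "tail Q e \<in> verts Q" using e wf by (auto simp: wf_digraph_def)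
    note c = reps[THEN is_rep_carrier, OF e] w[OF ht(1), THEN conjunct1] w[OF ht(2), THEN conjunct1]
      is_hom_carrier[OF hom(2) ht(1)] is_hom_carrier[OF hom(2) ht(2)]
    note d = c[THEN carrier_matD(1)] c[THEN carrier_matD(2)]
    have "w (head Q e) * rmap R e * g (tail Q e) = w (head Q e) * (g (head Q e) * rmap E e)"
      using d is_hom_commute[OF hom(2) e] by (simp add: mult_assoc_dim)
    also have "\<dots> = u (head Q e) * rmap E e"
      using d w[OF ht(1)] by (simp flip: mult_assoc_dim)
    also have "\<dots> = rmap X e * w (tail Q e) * g (tail Q e)"
      using d w[OF ht(2)] is_hom_commute[OF u e] by (simp add: mult_assoc_dim)
    finally show "w (head Q e) * rmap R e = rmap X e * w (tail Q e)"
      by (rule short_exact_right_cancel[OF ex ht(2) mult_carrier_mat[OF c(4,2)] mult_carrier_mat[OF c(1,5)]])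
  qed (use w in auto)
  then show ?thesis using w that by metis
qed

lemma split_epi_comp_iso:
  assumes wf: "wf_digraph Q" and reps: "is_rep Q E" "is_rep Q R" "is_rep Q R'"
    and g: "is_hom Q E R g" and a: "is_hom Q R R' a" and b: "is_hom Q R' R b"
    and ba: "\<And>v. v \<in> verts Q \<Longrightarrow> b v * a v = 1\<^sub>m (rdim R v)"
    and split: "split_epi Q E R' (\<lambda>v. a v * g v)"
  shows "split_epi Q E R g"
proof -
  obtain s where s: "is_hom Q R' E s" "\<And>v. v \<in> verts Q \<Longrightarrow> a v * g v * s v = 1\<^sub>m (rdim R' v)"
    using split by (auto simp: split_epi_def)
  have "g v * (s v * a v) = 1\<^sub>m (rdim R v)" if v: "v \<in> verts Q" for v
  proof -
    note c = is_hom_carrier[OF g v] is_hom_carrier[OF a v] is_hom_carrier[OF b v] is_hom_carrier[OF s(1) v]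
    note d = c[THEN carrier_matD(1)] c[THEN carrier_matD(2)]
    have "g v * (s v * a v) = b v * a v * (g v * (s v * a v))"
      using ba[OF v] c by simp
    also have "\<dots> = b v * (a v * g v * s v) * a v"
      using d by (simp add: mult_assoc_dim)
    also have "\<dots> = 1\<^sub>m (rdim R v)"
      using s(2)[OF v] ba[OF v] c by simp
    finally show ?thesis .
  qed
  then show ?thesis
    unfolding split_epi_def using g is_hom_comp[OF wf reps(2,3,1) a s(1)] by blast
qed

text \<open>The epi of either sequence lifts through the other one, which induces maps
  \<open>s\<close> and \<open>s'\<close> between the left ends. If \<open>s' s\<close> were zero,
  \<open>g\<close> would split. As an endomorphism of \<open>K\<close> is zero or left invertible,
  \<open>K\<close> is a retract of the indecomposable \<open>L\<close>. With one explicit sequence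
  at hand, this determines the translate.\<close>

lemma almost_split_sequence_unique_left:
  fixes K :: "('a, 'b, 'k :: field) qrep"
  assumes wf: "wf_digraph Q"
    and reps: "is_rep Q K" "is_rep Q B" "is_rep Q R" "is_rep Q E" "is_rep Q R'"
    and seq: "almost_split_sequence Q K f B g R" and seq': "almost_split_sequence Q L f' E g' R'"
    and iso: "rep_iso Q R R'" and L: "indecomposable Q L"
    and K: "\<not> is_zero_rep Q K" "\<And>v. v \<in> verts Q \<Longrightarrow> rdim K v \<le> 1"
    and endo: "\<And>h. is_hom Q K K h \<Longrightarrow> (\<forall>v \<in> verts Q. h v = 0\<^sub>m (rdim K v) (rdim K v)) \<or>
      (\<exists>h'. is_hom Q K K h' \<and> (\<forall>v \<in> verts Q. h' v * h v = 1\<^sub>m (rdim K v)))"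
  shows "rep_iso Q L K"
proof -
  have Lr: "is_rep Q L" using L by (rule indecomposable_rep)
  have ex: "short_exact Q K f B g R" "short_exact Q L f' E g' R'"
    and ras: "right_almost_split Q B R g" "right_almost_split Q E R' g'"
    using seq seq' by (auto simp: almost_split_sequence_def)
  have homs: "is_hom Q K B f" "is_hom Q B R g" "is_hom Q L E f'" "is_hom Q E R' g'"
    using ex by (auto simp: short_exact_def)
  obtain a b where a: "is_hom Q R R' a" and b: "is_hom Q R' R b"
    and ba: "\<And>v. v \<in> verts Q \<Longrightarrow> b v * a v = 1\<^sub>m (rdim R v)"
    and ab: "\<And>v. v \<in> verts Q \<Longrightarrow> a v * b v = 1\<^sub>m (rdim R' v)"
    using iso unfolding rep_iso_def by blast
  have "\<not> split_epi Q B R' (\<lambda>v. a v * g v)"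
    using split_epi_comp_iso[OF wf reps(2,3,5) homs(2) a b ba] ras(1) by (auto simp: right_almost_split_def)
  then obtain t where t: "is_hom Q B E t" "\<And>v. v \<in> verts Q \<Longrightarrow> a v * g v = g' v * t v"
    using ras(2) reps(2) is_hom_comp[OF wf reps(2,3,5) homs(2) a] unfolding right_almost_split_def by blast
  have "\<not> split_epi Q E R (\<lambda>v. b v * g' v)"
    using split_epi_comp_iso[OF wf reps(4,5,3) homs(4) b a ab] ras(2) by (auto simp: right_almost_split_def)
  then obtain t' where t': "is_hom Q E B t'" "\<And>v. v \<in> verts Q \<Longrightarrow> b v * g' v = g v * t' v"
    using ras(1) reps(4) is_hom_comp[OF wf reps(4,5,3) homs(4) b] unfolding right_almost_split_def by blast
  note c = is_hom_carrier[OF homs(1)] is_hom_carrier[OF homs(2)] is_hom_carrier[OF homs(3)]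
    is_hom_carrier[OF homs(4)] is_hom_carrier[OF a] is_hom_carrier[OF b] is_hom_carrier[OF t(1)]
    is_hom_carrier[OF t'(1)]
  note d = c[THEN carrier_matD(1)] c[THEN carrier_matD(2)]
  have gtf: "g' v * (t v * f v) = 0\<^sub>m (rdim R' v) (rdim K v)" if v: "v \<in> verts Q" for v
  proof -
    have "g' v * (t v * f v) = a v * g v * f v" using d[OF v] t(2)[OF v] by (simp add: mult_assoc_dim)
    also have "\<dots> = a v * (g v * f v)" using d[OF v] by (simp add: mult_assoc_dim)
    finally show ?thesis using short_exact_zero[OF ex(1) v] c(5)[OF v] by simp
  qed
  obtain s where s: "is_hom Q K L s" "\<And>v. v \<in> verts Q \<Longrightarrow> f' v * s v = t v * f v"
    using kernel_factor[OF wf ex(2) reps(1) Lr reps(4) is_hom_comp[OF wf reps(1,2,4) homs(1) t(1)] gtf] by blast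
  have gtf': "g v * (t' v * f' v) = 0\<^sub>m (rdim R v) (rdim L v)" if v: "v \<in> verts Q" for v
  proof -
    have "g v * (t' v * f' v) = b v * g' v * f' v" using d[OF v] t'(2)[OF v] by (simp add: mult_assoc_dim)
    also have "\<dots> = b v * (g' v * f' v)" using d[OF v] by (simp add: mult_assoc_dim)
    finally show ?thesis using short_exact_zero[OF ex(2) v] c(6)[OF v] by simp
  qed
  obtain s' where s': "is_hom Q L K s'" "\<And>v. v \<in> verts Q \<Longrightarrow> f v * s' v = t' v * f' v"
    using kernel_factor[OF wf ex(1) Lr reps(1) reps(2) is_hom_comp[OF wf Lr reps(4,2) homs(3) t'(1)] gtf'] by blast
  note c = c is_hom_carrier[OF s(1)] is_hom_carrier[OF s'(1)]
  note d = c[THEN carrier_matD(1)] c[THEN carrier_matD(2)]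
  have "\<not> (\<forall>v \<in> verts Q. s' v * s v = 0\<^sub>m (rdim K v) (rdim K v))"
  proof
    assume zero: "\<forall>v \<in> verts Q. s' v * s v = 0\<^sub>m (rdim K v) (rdim K v)"
    \<comment> \<open>Since \<open>t' t\<close> kills \<open>f\<close>, it factors as
      \<open>w g\<close>; cancelling \<open>g\<close> in \<open>g w g = b a g = g\<close> makes
      \<open>w\<close> a section of \<open>g\<close>.\<close>
    have ttf: "t' v * t v * f v = 0\<^sub>m (rdim B v) (rdim K v)" if v: "v \<in> verts Q" for v
    proof -
      have "t' v * t v * f v = t' v * (f' v * s v)" using d[OF v] s(2)[OF v] by (simp add: mult_assoc_dim)
      also have "\<dots> = f v * (s' v * s v)" using d[OF v] s'(2)[OF v] by (simp flip: mult_assoc_dim)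
      finally show ?thesis using zero v c(1)[OF v] by simp
    qed
    obtain w where w: "is_hom Q R B w" "\<And>v. v \<in> verts Q \<Longrightarrow> w v * g v = t' v * t v"
      using cokernel_factor[OF wf ex(1) reps(2,3,2) is_hom_comp[OF wf reps(2,4,2) t(1) t'(1)] ttf] by blast
    have "g v * w v = 1\<^sub>m (rdim R v)" if v: "v \<in> verts Q" for v
    proof (rule short_exact_right_cancel[OF ex(1) v])
      note d = d[OF v] is_hom_carrier[OF w(1) v, THEN carrier_matD(1)] is_hom_carrier[OF w(1) v, THEN carrier_matD(2)]
      have "g v * w v * g v = g v * (t' v * t v)" using d w(2)[OF v] by (simp add: mult_assoc_dim)
      also have "\<dots> = b v * g' v * t v" using d t'(2)[OF v] by (simp flip: mult_assoc_dim)
      also have "\<dots> = b v * (a v * g v)" using d t(2)[OF v] by (simp add: mult_assoc_dim)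
      also have "\<dots> = 1\<^sub>m (rdim R v) * g v" using d ba[OF v] by (simp flip: mult_assoc_dim)
      finally show "g v * w v * g v = 1\<^sub>m (rdim R v) * g v" .
    qed (use c(2)[OF v] is_hom_carrier[OF w(1) v] in auto)
    then have "split_epi Q B R g" unfolding split_epi_def using homs(2) w(1) by blast
    then show False using ras(1) by (simp add: right_almost_split_def)
  qed
  then obtain h' where h': "is_hom Q K K h'" "\<And>v. v \<in> verts Q \<Longrightarrow> h' v * (s' v * s v) = 1\<^sub>m (rdim K v)"
    using endo[OF is_hom_comp[OF wf reps(1) Lr reps(1) s(1) s'(1)]] by blast
  have "h' v * s' v * s v = 1\<^sub>m (rdim K v)" if v: "v \<in> verts Q" for v
    using d[OF v] is_hom_carrier[OF h'(1) v] h'(2)[OF v] by (simp add: mult_assoc_dim)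
  then show ?thesis
    using retract_of_indecomposable[OF wf L reps(1) K(1,2) s(1) is_hom_comp[OF wf Lr reps(1,1) s'(1) h'(1)]]
    by blast
qed

text \<open>\<open>s\<close> and \<open>t\<close> split the sequence at one vertex as vector spaces
  and are not asked to form homomorphisms, so exactness is reduced to matrix identities.\<close>

lemma short_exactI:
  fixes L :: "('a, 'b, 'k :: field) qrep"
  assumes f: "is_hom Q L E f" and g: "is_hom Q E R g"
    and split: "\<And>v. v \<in> verts Q \<Longrightarrow> \<exists>s t. s \<in> carrier_mat (rdim L v) (rdim E v) \<and>
      t \<in> carrier_mat (rdim E v) (rdim R v) \<and> s * f v = 1\<^sub>m (rdim L v) \<and> g v * t = 1\<^sub>m (rdim R v) \<and>
      g v * f v = 0\<^sub>m (rdim R v) (rdim L v) \<and> f v * s + t * g v = 1\<^sub>m (rdim E v)"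
  shows "short_exact Q L f E g R"
  unfolding short_exact_def
proof (intro conjI ballI iffI impI)
  fix v assume v: "v \<in> verts Q"
  obtain s t where st: "s \<in> carrier_mat (rdim L v) (rdim E v)" "t \<in> carrier_mat (rdim E v) (rdim R v)"
    "s * f v = 1\<^sub>m (rdim L v)" "g v * t = 1\<^sub>m (rdim R v)"
    "g v * f v = 0\<^sub>m (rdim R v) (rdim L v)" "f v * s + t * g v = 1\<^sub>m (rdim E v)"
    using split[OF v] by blast
  note c = is_hom_carrier[OF f v] is_hom_carrier[OF g v] st(1,2)
  {
    fix x :: "'k vec" assume x: "x \<in> carrier_vec (rdim L v)" "f v *\<^sub>v x = 0\<^sub>v (rdim E v)"
    have "s *\<^sub>v (f v *\<^sub>v x) = x"
      using assoc_mult_mat_vec[OF c(3,1) x(1)] st(3) x by simp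
    moreover have "s *\<^sub>v 0\<^sub>v (rdim E v) = 0\<^sub>v (rdim L v)"
      using c(3) by (auto intro!: eq_vecI simp: scalar_prod_def)
    ultimately show "x = 0\<^sub>v (rdim L v)" using x by simp
  next
    fix y :: "'k vec" assume y: "y \<in> carrier_vec (rdim E v)"
    assume gy: "g v *\<^sub>v y = 0\<^sub>v (rdim R v)"
    have "y = (f v * s + t * g v) *\<^sub>v y" using st(6) y by simp
    also have "\<dots> = f v *\<^sub>v (s *\<^sub>v y) + t *\<^sub>v (g v *\<^sub>v y)"
      using add_mult_distrib_mat_vec[OF mult_carrier_mat[OF c(1,3)] mult_carrier_mat[OF c(4,2)] y]
        assoc_mult_mat_vec[OF c(1,3) y] assoc_mult_mat_vec[OF c(4,2) y] by simp
    also have "t *\<^sub>v (g v *\<^sub>v y) = 0\<^sub>v (rdim E v)"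
      unfolding gy using c(4) by (auto intro!: eq_vecI simp: scalar_prod_def)
    finally show "\<exists>x\<in>carrier_vec (rdim L v). y = f v *\<^sub>v x"
      using c y by (intro bexI[of _ "s *\<^sub>v y"]) auto
  next
    fix y :: "'k vec" assume "\<exists>x\<in>carrier_vec (rdim L v). y = f v *\<^sub>v x"
    then obtain x where x: "x \<in> carrier_vec (rdim L v)" "y = f v *\<^sub>v x" by blast
    show "g v *\<^sub>v y = 0\<^sub>v (rdim R v)"
      using assoc_mult_mat_vec[OF c(2,1) x(1)] x st(5) by (simp add: zero_mult_mat_vec)
  next
    fix z :: "'k vec" assume z: "z \<in> carrier_vec (rdim R v)"
    show "\<exists>y\<in>carrier_vec (rdim E v). z = g v *\<^sub>v y"
      using assoc_mult_mat_vec[OF c(2,4) z] st(4) z c by (intro bexI[of _ "t *\<^sub>v z"]) auto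
  }
qed (fact f g)+

text \<open>The zero map factors through the zero representation. Irreducibility would make one of
  the two factors split, and then \<open>V\<close> or \<open>W\<close> would be zero.\<close>

lemma irreducible_hom_nonzero:
  fixes V :: "('a, 'b, 'k :: field) qrep"
  assumes wf: "wf_digraph Q" and reps: "is_rep Q V" "is_rep Q W" and f: "irreducible_hom Q V W f"
    and V: "\<not> is_zero_rep Q V" and W: "\<not> is_zero_rep Q W"
  shows "\<exists>v \<in> verts Q. f v \<noteq> 0\<^sub>m (rdim W v) (rdim V v)"
proof (rule ccontr)
  assume "\<not> ?thesis"
  then have f0: "f v = 0\<^sub>m (rdim W v) (rdim V v)" if "v \<in> verts Q" for v using that by blast
  define Z :: "('a, 'b, 'k) qrep" where "Z = \<lparr>rdim = \<lambda>_. 0, rmap = \<lambda>_. 0\<^sub>m 0 0\<rparr>"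
  have Z: "is_rep Q Z" by (simp add: is_rep_def Z_def)
  have Z0: "rdim Z v = 0" for v by (simp add: Z_def)
  let ?h = "\<lambda>v. 0\<^sub>m 0 (rdim V v) :: 'k mat" and ?g = "\<lambda>v. 0\<^sub>m (rdim W v) 0 :: 'k mat"
  have h: "is_hom Q V Z ?h"
    using is_rep_carrier[OF reps(1), THEN carrier_matD(2)] unfolding is_hom_def by (auto simp: Z_def intro!: eq_matI)
  have g: "is_hom Q Z W ?g"
    using is_rep_carrier[OF reps(2), THEN carrier_matD(1)] unfolding is_hom_def by (auto simp: Z_def intro!: eq_matI)
  have "f v = ?g v * ?h v" if "v \<in> verts Q" for v
    unfolding f0[OF that] by (intro eq_matI) (auto simp: scalar_prod_def)
  then have "split_mono Q V Z ?h \<or> split_epi Q Z W ?g"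
    using f Z h g unfolding irreducible_hom_def by blast
  then show False
  proof
    assume "split_mono Q V Z ?h"
    then obtain k where k: "is_hom Q Z V k" "\<And>v. v \<in> verts Q \<Longrightarrow> k v * ?h v = 1\<^sub>m (rdim V v)"
      unfolding split_mono_def by blast
    obtain v where v: "v \<in> verts Q" "rdim V v \<noteq> 0" using V by (auto simp: is_zero_rep_def)
    have "k v * ?h v = 0\<^sub>m (rdim V v) (rdim V v)"
      using is_hom_carrier[OF k(1) v(1)] Z0 by (simp add: right_mult_zero_mat)
    then show False using k(2)[OF v(1)] v(2) one_mat_neq_zero[of "rdim V v", where 'k = 'k] by simp
  next
    assume "split_epi Q Z W ?g"
    then obtain k where k: "is_hom Q W Z k" "\<And>v. v \<in> verts Q \<Longrightarrow> ?g v * k v = 1\<^sub>m (rdim W v)"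
      unfolding split_epi_def by blast
    obtain v where v: "v \<in> verts Q" "rdim W v \<noteq> 0" using W by (auto simp: is_zero_rep_def)
    have "?g v * k v = 0\<^sub>m (rdim W v) (rdim W v)"
      using is_hom_carrier[OF k(1) v(1)] Z0 by (simp add: left_mult_zero_mat)
    then show False using k(2)[OF v(1)] v(2) one_mat_neq_zero[of "rdim W v", where 'k = 'k] by simp
  qed
qed

section \<open>Independence of Pak's map of the order of the cells\<close>

text \<open>The premise says that \<open>(a, b)\<close> and \<open>(i, j)\<close> are on different
  diagonals, without subtracting natural numbers.\<close>

lemma pak_step_off_diagonal: "a + j \<noteq> b + i \<Longrightarrow> pak_step F (i, j) \<pi> (a, b) = \<pi> (a, b)"
  by (auto simp: pak_step_def)

text \<open>Only the entry and its four neighbours are read. Agreement of the neighbours is asked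
  for positive indices only, because at the margin truncated subtraction makes \<open>a - 1\<close>
  equal to \<open>a\<close>.\<close>

lemma pak_step_cong:
  assumes "\<pi> (a, b) = \<pi>' (a, b)"
    and "1 \<le> a \<Longrightarrow> 1 \<le> b \<Longrightarrow> \<pi> (a - 1, b) = \<pi>' (a - 1, b) \<and> \<pi> (a, b - 1) = \<pi>' (a, b - 1) \<and>
      \<pi> (a + 1, b) = \<pi>' (a + 1, b) \<and> \<pi> (a, b + 1) = \<pi>' (a, b + 1)"
    and "1 \<le> i" "1 \<le> j"
  shows "pak_step F (i, j) \<pi> (a, b) = pak_step F (i, j) \<pi>' (a, b)"
  using assms by (auto simp: pak_step_def)

text \<open>A step only reads the diagonals adjacent to the one it changes.\<close>

lemma pak_step_commute:
  assumes "1 \<le> i" "1 \<le> j" "1 \<le> i'" "1 \<le> j'" "i < i'" "j' < j"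
  shows "pak_step F (i, j) (pak_step F (i', j') \<pi>) = pak_step F (i', j') (pak_step F (i, j) \<pi>)"
proof
  fix x :: "nat \<times> nat"
  obtain a b where x: "x = (a, b)" by (cases x)
  show "pak_step F (i, j) (pak_step F (i', j') \<pi>) x = pak_step F (i', j') (pak_step F (i, j) \<pi>) x"
  \<comment> \<open>With \<open>i < i'\<close> and \<open>j' < j\<close> the two diagonals are at
    distance \<open>(j - j') + (i' - i) \<ge> 2\<close>, so neither is adjacent to the
    other.\<close>
  proof (cases "a + j = b + i")
    case True
    have "pak_step F (i, j) (pak_step F (i', j') \<pi>) (a, b) = pak_step F (i, j) \<pi> (a, b)"
      by (rule pak_step_cong) (use True assms in \<open>auto simp: pak_step_off_diagonal\<close>)
    also have "\<dots> = pak_step F (i', j') (pak_step F (i, j) \<pi>) (a, b)"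
      using True assms by (simp add: pak_step_off_diagonal)
    finally show ?thesis by (simp add: x)
  next
    case False
    have "pak_step F (i', j') (pak_step F (i, j) \<pi>) (a, b) = pak_step F (i', j') \<pi> (a, b)"
    proof (cases "a + j' = b + i'")
      case True
      show ?thesis
        by (rule pak_step_cong) (use True assms in \<open>auto simp: pak_step_off_diagonal\<close>)
    next
      case ne: False
      then show ?thesis using False by (simp add: pak_step_off_diagonal)
    qed
    also have "\<dots> = pak_step F (i, j) (pak_step F (i', j') \<pi>) (a, b)"
      using False by (simp add: pak_step_off_diagonal)
    finally show ?thesis by (simp add: x)
  qed
qed

abbreviation linear_extension :: "cell list \<Rightarrow> bool" where
  "linear_extension us \<equiv> sorted_wrt (\<lambda>(i, j) (i', j'). \<not> (i' \<le> i \<and> j' \<le> j)) us"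

lemma linear_extension_distinct: "linear_extension us \<Longrightarrow> distinct us"
  by (induction us) auto

text \<open>Induction on the length compares the last cells \<open>u\<close> and \<open>u'\<close>.
  If they differ, both are maximal, so by induction each list can be rearranged to end with both of
  them, and there the two steps commute.\<close>

lemma fold_pak_step_unique:
  assumes "linear_extension us" "linear_extension us'" "set us = set us'"
    and "\<And>i j. (i, j) \<in> set us \<Longrightarrow> 1 \<le> i \<and> 1 \<le> j"
  shows "fold (pak_step F) us \<pi> = fold (pak_step F) us' \<pi>"
  using assms
proof (induction "length us" arbitrary: us us' rule: less_induct)
  case less
  note us = less.prems
  have len: "length us = length us'"
    using us(1-3) linear_extension_distinct by (metis distinct_card)
  show ?case
  proof (cases us rule: rev_cases)
    case Nil
    then show ?thesis using us(3) by simp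
  next
    case (snoc xs u)
    then obtain ys u' where ys: "us' = ys @ [u']" using len by (cases us' rule: rev_cases) auto
    have lx: "linear_extension xs" and ux: "\<And>x. x \<in> set xs \<Longrightarrow> \<not> (fst u \<le> fst x \<and> snd u \<le> snd x)"
      using us(1) unfolding snoc sorted_wrt_append by (auto simp: case_prod_beta)
    have ly: "linear_extension ys" and uy: "\<And>x. x \<in> set ys \<Longrightarrow> \<not> (fst u' \<le> fst x \<and> snd u' \<le> snd x)"
      using us(2) unfolding ys sorted_wrt_append by (auto simp: case_prod_beta)
    have d: "u \<notin> set xs" "u' \<notin> set ys" using ux[of u] uy[of u'] by auto
    have pos: "1 \<le> fst x \<and> 1 \<le> snd x" if "x \<in> set us" for x using us(4)[of "fst x" "snd x"] that by simp
    show ?thesis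
    proof (cases "u = u'")
      case True
      then have "set xs = set ys" using us(3) d unfolding snoc ys by auto
      then have "fold (pak_step F) xs \<pi> = fold (pak_step F) ys \<pi>"
        using less.hyps[of xs ys] lx ly us(4) unfolding snoc by auto
      then show ?thesis unfolding snoc ys using True by simp
    next
      case False
      then have mem: "u' \<in> set xs" "u \<in> set ys" using us(3) unfolding snoc ys by auto
      \<comment> \<open>The cells common to both lists once \<open>u\<close> and \<open>u'\<close>
        are taken away; either of the two may follow them.\<close>
      define zs where "zs = filter (\<lambda>x. x \<noteq> u') xs"
      have lz: "linear_extension zs" unfolding zs_def by (rule sorted_wrt_filter[OF lx])
      have sz: "set zs = set xs - {u'}" "set zs = set ys - {u}"
        using us(3) d mem unfolding snoc ys zs_def by auto
      have z1: "linear_extension (zs @ [u'])" "linear_extension (zs @ [u])"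
      proof -
        have "\<not> (fst u' \<le> fst x \<and> snd u' \<le> snd x)" "\<not> (fst u \<le> fst x \<and> snd u \<le> snd x)"
          if "x \<in> set zs" for x
          using that uy[of x] ux[of x] sz by blast+
        then show "linear_extension (zs @ [u'])" "linear_extension (zs @ [u])"
          unfolding sorted_wrt_append using lz by (auto simp: case_prod_beta)
      qed
      have "fold (pak_step F) xs \<pi> = fold (pak_step F) (zs @ [u']) \<pi>"
      proof (rule less.hyps)
        show "set xs = set (zs @ [u'])" using sz mem by auto
      qed (use lx z1 us(4) in \<open>auto simp: snoc\<close>)
      moreover have "fold (pak_step F) ys \<pi> = fold (pak_step F) (zs @ [u]) \<pi>"
      proof (rule less.hyps)
        show "set ys = set (zs @ [u])" using sz mem by auto
        show "length ys < length us" using len ys by simp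
        show "1 \<le> i \<and> 1 \<le> j" if "(i, j) \<in> set ys" for i j using us(3,4) that unfolding ys by auto
      qed (use ly z1 in auto)
      moreover have "pak_step F u (pak_step F u' \<rho>) = pak_step F u' (pak_step F u \<rho>)" for \<rho>
      proof -
        obtain i j i' j' where u: "u = (i, j)" "u' = (i', j')" by (cases u, cases u') auto
        have "u \<in> set us" "u' \<in> set us" using snoc mem by auto
        then have "1 \<le> i \<and> 1 \<le> j" "1 \<le> i' \<and> 1 \<le> j'" using us(4) u by auto
        \<comment> \<open>Two distinct maximal cells are incomparable, so one is strictly northeast
          of the other, as the commutation of steps requires.\<close>
        moreover have "\<not> (i \<le> i' \<and> j \<le> j')" "\<not> (i' \<le> i \<and> j' \<le> j)" using ux[OF mem(1)] uy[OF mem(2)] u by auto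
        then have "i < i' \<and> j' < j \<or> i' < i \<and> j < j'" by auto
        ultimately show ?thesis unfolding u using pak_step_commute by metis
      qed
      ultimately show ?thesis unfolding snoc ys by simp
    qed
  qed
qed

text \<open>A Young diagram of arbitrary shape: the shapes reached while cells are being added are
  meant, not just the rectangle.\<close>

definition order_ideal :: "cell set \<Rightarrow> bool" where
  "order_ideal S \<longleftrightarrow> (\<forall>(i, j) \<in> S. 1 \<le> i \<and> 1 \<le> j \<and> (\<forall>a b. 1 \<le> a \<and> a \<le> i \<and> 1 \<le> b \<and> b \<le> j \<longrightarrow> (a, b) \<in> S))"

lemma order_idealD:
  assumes "order_ideal S" "(i, j) \<in> S"
  shows "1 \<le> i" "1 \<le> j" "1 \<le> a \<Longrightarrow> a \<le> i \<Longrightarrow> 1 \<le> b \<Longrightarrow> b \<le> j \<Longrightarrow> (a, b) \<in> S"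
  using assms unfolding order_ideal_def by fastforce+

lemma order_ideal_snoc:
  assumes "linear_extension (us @ [u])" "order_ideal (set (us @ [u]))"
  shows "order_ideal (set us)"
  unfolding order_ideal_def
proof (clarify, intro conjI allI impI)
  fix i j assume ij: "(i, j) \<in> set us"
  then have ij': "(i, j) \<in> set (us @ [u])" by simp
  show "1 \<le> i" "1 \<le> j" using order_idealD[OF assms(2) ij'] by auto
  fix a b assume ab: "1 \<le> a \<and> a \<le> i \<and> 1 \<le> b \<and> b \<le> j"
  then have "(a, b) \<in> set (us @ [u])" using order_idealD(3)[OF assms(2) ij'] by blast
  moreover have "(a, b) \<noteq> u" using assms(1) ij ab by (auto simp: sorted_wrt_append)
  ultimately show "(a, b) \<in> set us" by simp
qed

text \<open>The comparison with \<open>\<rho>\<close> uses that entries outside the shape are 0 and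
  that all entries are nonnegative, since a maximum over missing neighbours counts as 0.
  Monotonicity is carried along because it keeps toggled entries nonnegative.\<close>

lemma fold_pak_step_plane_partition:
  fixes F :: "cell \<Rightarrow> nat"
  assumes "linear_extension us" "order_ideal (set us)"
  defines "\<pi> \<equiv> fold (pak_step F) us (\<lambda>_. 0)"
  shows "(\<forall>x. x \<notin> set us \<longrightarrow> \<pi> x = 0) \<and> (\<forall>x. 0 \<le> \<pi> x) \<and>
    (\<forall>a b. (a, b) \<in> set us \<longrightarrow> \<pi> (a - 1, b) \<le> \<pi> (a, b) \<and> \<pi> (a, b - 1) \<le> \<pi> (a, b))"
  using assms(1,2) unfolding \<pi>_def
proof (induction us rule: rev_induct)
  case Nil
  then show ?case by simp
next
  case (snoc u us)
  obtain i j where u: "u = (i, j)" by (cases u)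
  define \<rho> where "\<rho> = fold (pak_step F) us (\<lambda>_. 0)"
  have "linear_extension us" using snoc.prems(1) by (simp add: sorted_wrt_append)
  note IH = snoc.IH[OF this order_ideal_snoc[OF snoc.prems], folded \<rho>_def]
  have z: "\<And>x. x \<notin> set us \<Longrightarrow> \<rho> x = 0" and nn: "\<And>x. 0 \<le> \<rho> x"
    and mono: "\<And>a b. (a, b) \<in> set us \<Longrightarrow> \<rho> (a - 1, b) \<le> \<rho> (a, b) \<and> \<rho> (a, b - 1) \<le> \<rho> (a, b)"
    using IH by blast+
  have um: "(i, j) \<in> set (us @ [u])" by (simp add: u)
  note down = order_idealD[OF snoc.prems(2) um]
  have new: "\<not> (i \<le> a \<and> j \<le> b)" if "(a, b) \<in> set us" for a b
    using snoc.prems(1) that u by (auto simp: sorted_wrt_append)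
  define tog where "tog = (\<lambda>a b. 1 \<le> a \<and> 1 \<le> b \<and> (\<exists>k \<ge> 1. a + k = i \<and> b + k = j))"
  let ?t = "\<lambda>a b. max (\<rho> (a - 1, b)) (\<rho> (a, b - 1)) + min (\<rho> (a + 1, b)) (\<rho> (a, b + 1)) - \<rho> (a, b)"
  let ?\<sigma> = "pak_step F (i, j) \<rho>"
  have \<sigma>: "?\<sigma> (a, b) = (if (a, b) = (i, j) then max (\<rho> (a - 1, b)) (\<rho> (a, b - 1)) + int (F (a, b))
      else if tog a b then ?t a b else \<rho> (a, b))" for a b
    by (simp only: pak_step_def prod.case tog_def)
  \<comment> \<open>The cells below and to the right of a toggled cell are different from the new
    corner, so they are already in the shape and the minimum reads no entry from outside.\<close>
  have tog_in: "(a, b) \<in> set us \<and> (a + 1, b) \<in> set us \<and> (a, b + 1) \<in> set us" if t: "tog a b" for a b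
  proof -
    have "1 \<le> a" "1 \<le> b" "a + 1 \<le> i" "b + 1 \<le> j" using t by (auto simp: tog_def)
    then have "(a, b) \<in> set (us @ [u])" "(a + 1, b) \<in> set (us @ [u])" "(a, b + 1) \<in> set (us @ [u])"
      using down(3) by auto
    then show ?thesis using \<open>a + 1 \<le> i\<close> \<open>b + 1 \<le> j\<close> u by auto
  qed
  \<comment> \<open>A toggle reflects the entry in the interval between the maximum above and to the
    left and the minimum below and to the right, so the new entry stays in that interval.\<close>
  have bounds: "max (\<rho> (a - 1, b)) (\<rho> (a, b - 1)) \<le> ?t a b" "?t a b \<le> \<rho> (a + 1, b)" "?t a b \<le> \<rho> (a, b + 1)"
    if t: "tog a b" for a b
  proof -
    note ti = tog_in[OF t]
    have "\<rho> (a - 1, b) \<le> \<rho> (a, b)" "\<rho> (a, b - 1) \<le> \<rho> (a, b)" using mono ti by blast+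
    moreover have "\<rho> (a, b) \<le> \<rho> (a + 1, b)" "\<rho> (a, b) \<le> \<rho> (a, b + 1)"
      using mono[of "a + 1" b] mono[of a "b + 1"] ti by simp_all
    ultimately show "max (\<rho> (a - 1, b)) (\<rho> (a, b - 1)) \<le> ?t a b" "?t a b \<le> \<rho> (a + 1, b)" "?t a b \<le> \<rho> (a, b + 1)"
      by linarith+
  qed
  \<comment> \<open>The cells above and to the left are on adjacent diagonals and keep their entries
    in this step.\<close>
  have off: "\<not> tog (a - 1) b" "\<not> tog a (b - 1)" "(a - 1, b) \<noteq> (i, j)" "(a, b - 1) \<noteq> (i, j)"
    if "1 \<le> a" "1 \<le> b" "(a, b) = (i, j) \<or> tog a b" for a b
    using that by (auto simp: tog_def)
  have step: "fold (pak_step F) (us @ [u]) (\<lambda>_. 0) = ?\<sigma>" by (simp add: \<rho>_def u)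
  show ?case unfolding step
  proof (intro conjI allI impI)
    fix x assume x: "x \<notin> set (us @ [u])"
    obtain a b where ab: "x = (a, b)" by (cases x)
    have "\<not> tog a b" using tog_in x ab by auto
    then show "?\<sigma> x = 0" using x z[of x] u unfolding ab \<sigma> by auto
  next
    fix x show "0 \<le> ?\<sigma> x"
    proof -
      obtain a b where ab: "x = (a, b)" by (cases x)
      have "0 \<le> max (\<rho> (a - 1, b)) (\<rho> (a, b - 1))" using nn[of "(a - 1, b)"] by simp
      moreover from this have "0 \<le> ?t a b" if "tog a b" using bounds(1)[OF that] by linarith
      moreover from calculation have "0 \<le> max (\<rho> (a - 1, b)) (\<rho> (a, b - 1)) + int (F (a, b))" by linarith
      ultimately show ?thesis using nn[of "(a, b)"] unfolding ab \<sigma> by (simp only: split: if_split) blast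
    qed
  next
    fix a b assume ab: "(a, b) \<in> set (us @ [u])"
    have pos: "1 \<le> a" "1 \<le> b" using order_idealD(1,2)[OF snoc.prems(2) ab] .
    show "?\<sigma> (a - 1, b) \<le> ?\<sigma> (a, b)"
    proof (cases "(a, b) = (i, j) \<or> tog a b")
      case True
      have "?\<sigma> (a - 1, b) = \<rho> (a - 1, b)" using off[OF pos True] unfolding \<sigma> by auto
      then show ?thesis using True bounds(1)[of a b] unfolding \<sigma>[of a b] by auto
    next
      case False
      then have "(a, b) \<in> set us" using ab u by auto
      moreover from this have "(a - 1, b) \<noteq> (i, j)" using new[of a b] pos by auto
      ultimately show ?thesis
        using False mono[of a b] bounds(2)[of "a - 1" b] pos unfolding \<sigma> by auto
    qed
    show "?\<sigma> (a, b - 1) \<le> ?\<sigma> (a, b)"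
    proof (cases "(a, b) = (i, j) \<or> tog a b")
      case True
      have "?\<sigma> (a, b - 1) = \<rho> (a, b - 1)" using off[OF pos True] unfolding \<sigma> by auto
      then show ?thesis using True bounds(1)[of a b] unfolding \<sigma>[of a b] by auto
    next
      case False
      then have "(a, b) \<in> set us" using ab u by auto
      moreover from this have "(a, b - 1) \<noteq> (i, j)" using new[of a b] pos by auto
      ultimately show ?thesis
        using False mono[of a b] bounds(3)[of a "b - 1"] pos unfolding \<sigma> by auto
    qed
  qed
qed

section \<open>Hooks and rim hooks of a rectangle\<close>

lemma border_rectangle:
  "u \<in> border (rectangle n m) \<longleftrightarrow> u \<in> rectangle n m \<and> (fst u = n + 1 - m \<or> snd u = m)"
  by (cases u) (auto simp: border_def rectangle_def)

lemma border_number_bottom: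
  assumes "1 \<le> m" "m \<le> n" "1 \<le> j" "j \<le> m"
  shows "border_number (rectangle n m) (n + 1 - m, j) = j"
proof -
  have "{(i', j'). (i', j') \<in> border (rectangle n m) \<and> n + 1 - m \<le> i' \<and> j' \<le> j} = {n + 1 - m} \<times> {1..j}"
    unfolding border_rectangle using assms by (auto simp: rectangle_def)
  then show ?thesis by (simp add: border_number_def)
qed

text \<open>The \<open>m\<close> cells of the bottom row come first, followed by the
  \<open>n + 1 - m - i\<close> cells of the last column from the row above the bottom up to row
  \<open>i\<close>. At the corner this agrees with the number \<open>m\<close> found in the bottom
  row.\<close>

lemma border_number_right:
  assumes "1 \<le> m" "m \<le> n" "1 \<le> i" "i \<le> n + 1 - m"
  shows "border_number (rectangle n m) (i, m) = n + 1 - i"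
proof -
  have eq: "{(i', j'). (i', j') \<in> border (rectangle n m) \<and> i \<le> i' \<and> j' \<le> m} =
      {n + 1 - m} \<times> {1..m} \<union> {i..<n + 1 - m} \<times> {m}"
    unfolding border_rectangle using assms by (auto simp: rectangle_def)
  have "card ({n + 1 - m} \<times> {1..m} \<union> {i..<n + 1 - m} \<times> {m}) = m + (n + 1 - m - i)"
    by (subst card_Un_disjoint) (auto simp: card_cartesian_product)
  then show ?thesis using assms by (simp add: border_number_def eq)
qed

lemma rim_hook_rectangle: "u \<in> rim_hook (rectangle n m) d \<longleftrightarrow>
    u \<in> rectangle n m \<and> (fst u = n + 1 - m \<or> snd u = m) \<and> d (border_number (rectangle n m) u) = 1"
  by (simp add: rim_hook_def border_rectangle)

lemma ends_unique:
  "sw_end H p \<Longrightarrow> sw_end H q \<Longrightarrow> p = q" "ne_end H p \<Longrightarrow> ne_end H q \<Longrightarrow> p = q"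
proof -
  show "p = q" if "sw_end H p" "sw_end H q"
    using that by (cases p; cases q) (force simp: sw_end_def)
  show "p = q" if "ne_end H p" "ne_end H q"
    using that by (cases p; cases q) (force simp: ne_end_def)
qed

text \<open>In a rectangle the leg of every hook reaches the bottom row and its arm the last column,
  and end cells are unique.\<close>

lemma same_ends_hook:
  assumes "(i, j) \<in> rectangle n m"
  shows "same_ends (hook (rectangle n m) (i, j)) H \<longleftrightarrow> sw_end H (n + 1 - m, j) \<and> ne_end H (i, m)"
proof -
  have "sw_end (hook (rectangle n m) (i, j)) (n + 1 - m, j)" "ne_end (hook (rectangle n m) (i, j)) (i, m)"
    using assms by (auto simp: sw_end_def ne_end_def hook_def rectangle_def)
  then have sw: "sw_end (hook (rectangle n m) (i, j)) p \<longleftrightarrow> p = (n + 1 - m, j)"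
    and ne: "ne_end (hook (rectangle n m) (i, j)) p \<longleftrightarrow> p = (i, m)" for p
    using ends_unique by blast+
  show ?thesis unfolding same_ends_def sw ne by blast
qed

text \<open>The rim hook of \<open>[a, b]\<close> consists of columns \<open>a\<close> to
  \<open>m\<close> of the bottom row and rows \<open>n + 1 - b\<close> to \<open>n + 1 - m\<close>
  of the last column. The function \<open>d\<close> is prescribed on \<open>{1..n}\<close> alone
  because dimensions off the quiver are arbitrary.\<close>

lemma same_ends_interval:
  assumes mn: "1 \<le> m" "m \<le> n" and ij: "(i, j) \<in> rectangle n m" and ab: "1 \<le> a" "a \<le> m" "m \<le> b" "b \<le> n"
    and d: "\<And>v. v \<in> {1..n} \<Longrightarrow> d v = (if v \<in> {a..b} then 1 else 0)"
  shows "same_ends (hook (rectangle n m) (i, j)) (rim_hook (rectangle n m) d) \<longleftrightarrow> (i, j) = (n + 1 - b, a)"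
proof -
  let ?H = "rim_hook (rectangle n m) d"
  have rect: "(n + 1 - m, j') \<in> rectangle n m \<longleftrightarrow> 1 \<le> j' \<and> j' \<le> m"
    "(i', m) \<in> rectangle n m \<longleftrightarrow> 1 \<le> i' \<and> i' \<le> n + 1 - m" for i' j'
    using mn by (auto simp: rectangle_def)
  have bottom: "(n + 1 - m, j') \<in> ?H \<longleftrightarrow> a \<le> j' \<and> j' \<le> m" for j'
    unfolding rim_hook_rectangle rect
  proof (cases "1 \<le> j' \<and> j' \<le> m")
    case True
    then have "j' \<in> {1..n}" and iff: "j' \<in> {a..b} \<longleftrightarrow> a \<le> j'" using mn ab by auto
    from d[OF this(1)] have "d j' = (if a \<le> j' then 1 else 0)" unfolding iff .
    then show "(1 \<le> j' \<and> j' \<le> m) \<and> (fst (n + 1 - m, j') = n + 1 - m \<or> snd (n + 1 - m, j') = m) \<and>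
        d (border_number (rectangle n m) (n + 1 - m, j')) = 1 \<longleftrightarrow> a \<le> j' \<and> j' \<le> m"
      unfolding border_number_bottom[OF mn conjunct1[OF True] conjunct2[OF True]] using True by simp
  next
    case False
    then show "(1 \<le> j' \<and> j' \<le> m) \<and> (fst (n + 1 - m, j') = n + 1 - m \<or> snd (n + 1 - m, j') = m) \<and>
        d (border_number (rectangle n m) (n + 1 - m, j')) = 1 \<longleftrightarrow> a \<le> j' \<and> j' \<le> m"
      using ab(1) by linarith
  qed
  have right: "(i', m) \<in> ?H \<longleftrightarrow> n + 1 - b \<le> i' \<and> i' \<le> n + 1 - m" for i'
    unfolding rim_hook_rectangle rect
  proof (cases "1 \<le> i' \<and> i' \<le> n + 1 - m")
    case True
    then have "n + 1 - i' \<in> {1..n}" and iff: "n + 1 - i' \<in> {a..b} \<longleftrightarrow> n + 1 - b \<le> i'" using mn ab by auto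
    from d[OF this(1)] have "d (n + 1 - i') = (if n + 1 - b \<le> i' then 1 else 0)" unfolding iff .
    then show "(1 \<le> i' \<and> i' \<le> n + 1 - m) \<and> (fst (i', m) = n + 1 - m \<or> snd (i', m) = m) \<and>
        d (border_number (rectangle n m) (i', m)) = 1 \<longleftrightarrow> n + 1 - b \<le> i' \<and> i' \<le> n + 1 - m"
      unfolding border_number_right[OF mn conjunct1[OF True] conjunct2[OF True]] using True by simp
  next
    case False
    then show "(1 \<le> i' \<and> i' \<le> n + 1 - m) \<and> (fst (i', m) = n + 1 - m \<or> snd (i', m) = m) \<and>
        d (border_number (rectangle n m) (i', m)) = 1 \<longleftrightarrow> n + 1 - b \<le> i' \<and> i' \<le> n + 1 - m"
      using ab(4) by linarith
  qed
  have H: "u \<in> ?H \<longleftrightarrow> (fst u = n + 1 - m \<and> a \<le> snd u \<and> snd u \<le> m) \<or> (snd u = m \<and> n + 1 - b \<le> fst u \<and> fst u \<le> n + 1 - m)" for u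
  proof
    assume u: "u \<in> ?H"
    then have "fst u = n + 1 - m \<or> snd u = m" unfolding rim_hook_rectangle by blast
    then show "(fst u = n + 1 - m \<and> a \<le> snd u \<and> snd u \<le> m) \<or> (snd u = m \<and> n + 1 - b \<le> fst u \<and> fst u \<le> n + 1 - m)"
      using u bottom[of "snd u"] right[of "fst u"] by (cases u) auto
  next
    assume "(fst u = n + 1 - m \<and> a \<le> snd u \<and> snd u \<le> m) \<or> (snd u = m \<and> n + 1 - b \<le> fst u \<and> fst u \<le> n + 1 - m)"
    then show "u \<in> ?H" using bottom[of "snd u"] right[of "fst u"] by (cases u) auto
  qed
  have "sw_end ?H (n + 1 - m, j) \<longleftrightarrow> j = a"
  proof
    assume "sw_end ?H (n + 1 - m, j)"
    then have "a \<le> j" "\<forall>u \<in> ?H. j \<le> snd u" using bottom[of j] by (auto simp: sw_end_def case_prod_beta)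
    moreover have "(n + 1 - m, a) \<in> ?H" using bottom ab by simp
    ultimately show "j = a" by fastforce
  next
    assume "j = a"
    then show "sw_end ?H (n + 1 - m, j)" using ab unfolding sw_end_def by (auto simp: H)
  qed
  moreover have "ne_end ?H (i, m) \<longleftrightarrow> i = n + 1 - b"
  proof
    assume "ne_end ?H (i, m)"
    then have "n + 1 - b \<le> i" "\<forall>u \<in> ?H. i \<le> fst u" using right[of i] by (auto simp: ne_end_def case_prod_beta)
    moreover have "(n + 1 - b, m) \<in> ?H" using right ab by simp
    ultimately show "i = n + 1 - b" by fastforce
  next
    assume "i = n + 1 - b"
    then show "ne_end ?H (i, m)" using ab unfolding ne_end_def by (auto simp: H)
  qed
  ultimately show ?thesis unfolding same_ends_hook[OF ij] by auto
qed

text \<open>One end of a hook has border number at most \<open>m\<close> and the other at least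
  \<open>m\<close>; whichever side \<open>d\<close> vanishes on, one end is missing. Hence listed
  modules that vanish at \<open>m\<close> contribute nothing to the hook filling.\<close>

lemma same_ends_one_sided:
  assumes mn: "1 \<le> m" "m \<le> n" and ij: "(i, j) \<in> rectangle n m"
    and d: "(\<forall>v \<in> {1..n}. m \<le> v \<longrightarrow> d v = 0) \<or> (\<forall>v \<in> {1..n}. v \<le> m \<longrightarrow> d v = 0)"
  shows "\<not> same_ends (hook (rectangle n m) (i, j)) (rim_hook (rectangle n m) d)"
proof
  assume "same_ends (hook (rectangle n m) (i, j)) (rim_hook (rectangle n m) d)"
  then have "(n + 1 - m, j) \<in> rim_hook (rectangle n m) d" "(i, m) \<in> rim_hook (rectangle n m) d"
    unfolding same_ends_hook[OF ij] by (auto simp: sw_end_def ne_end_def)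
  then have "d (border_number (rectangle n m) (n + 1 - m, j)) = 1" "d (border_number (rectangle n m) (i, m)) = 1"
    unfolding rim_hook_rectangle by blast+
  moreover have "1 \<le> i" "i \<le> n + 1 - m" "1 \<le> j" "j \<le> m" using ij by (auto simp: rectangle_def)
  ultimately have "d j = 1" "d (n + 1 - i) = 1"
    using border_number_bottom[OF mn, of j] border_number_right[OF mn, of i] by simp_all
  moreover have "j \<in> {1..n}" "j \<le> m" "n + 1 - i \<in> {1..n}" "m \<le> n + 1 - i"
    using ij mn by (auto simp: rectangle_def)
  ultimately show False using d by force
qed

lemma hook_filling_rim_hooks_of:
  "hook_filling Y (rim_hooks_of Y Ms cs) u =
    (\<Sum>(V, c)\<leftarrow>zip Ms cs. if same_ends (hook Y u) (rim_hook Y (rdim V)) then c else 0)"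
proof -
  have rep: "size (filter_mset P (replicate_mset c h)) = (if P h then c else 0)" for P c and h :: "cell set"
    by (induction c) auto
  have "size {#h \<in># (\<Sum>(V, c)\<leftarrow>zs. replicate_mset c (rim_hook Y (rdim V))). same_ends (hook Y u) h#} =
      (\<Sum>(V, c)\<leftarrow>zs. if same_ends (hook Y u) (rim_hook Y (rdim V)) then c else 0)" for zs
    by (induction zs) (auto simp: rep)
  then show ?thesis by (simp add: hook_filling_def rim_hooks_of_def)
qed

section \<open>Interval representations\<close>

lemma row_zeroI:
  fixes A :: "'k :: field mat"
  assumes A: "A \<in> carrier_mat r d" and 0: "\<And>x. x \<in> carrier_mat d 1 \<Longrightarrow> A * x = 0\<^sub>m r 1"
  shows "A = 0\<^sub>m r d"
proof (rule mat_eq_if_mult_vec[OF A])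
  fix x :: "'k vec" assume x: "x \<in> carrier_vec d"
  define X where "X = mat d 1 (\<lambda>(i, _). x $ i)"
  have X: "X \<in> carrier_mat d 1" "col X 0 = x" using x by (auto simp: X_def)
  have "A *\<^sub>v x = col (A * X) 0" using A X by (subst col_mult2[of A r d X 1]) auto
  also have "\<dots> = 0\<^sub>m r d *\<^sub>v x" using 0[OF X(1)] zero_mult_mat_vec[OF x, of r] by (auto intro!: eq_vecI)
  finally show "A *\<^sub>v x = 0\<^sub>m r d *\<^sub>v x" .
qed simp

lemma scalar_mat_cases:
  fixes A :: "'k :: field mat"
  assumes "A \<in> carrier_mat 1 1"
  obtains "A = 0\<^sub>m 1 1" | c where "c \<noteq> 0" "A = c \<cdot>\<^sub>m 1\<^sub>m 1"
proof (cases "A $$ (0, 0) = 0")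
  case True
  then have "A = 0\<^sub>m 1 1" using assms by (intro eq_matI) auto
  then show ?thesis using that by blast
next
  case False
  have "A = A $$ (0, 0) \<cdot>\<^sub>m 1\<^sub>m 1" using assms by (intro eq_matI) auto
  then show ?thesis using that False by blast
qed

section \<open>The quiver as two paths into a sink\<close>

type_synonym 'k vrep = "(nat, nat \<times> nat, 'k) qrep"

locale sink_quiver =
  fixes n m :: nat
  assumes m_ge: "1 \<le> m" and m_le: "m \<le> n"
begin

abbreviation Q :: "(nat, nat \<times> nat) pre_digraph" where "Q \<equiv> quiver_A n m"

text \<open>The head of the only arc leaving \<open>v\<close>; at the sink, where no arc starts, the
  value is a dummy.\<close>

definition nx :: "nat \<Rightarrow> nat" where
  "nx v = (if v < m then v + 1 else if m < v then v - 1 else v)"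

lemma verts_Q: "verts Q = {1..n}" and tail_Q: "tail Q = fst" and head_Q: "head Q = snd"
  by (simp_all add: quiver_A_def)

lemma arcs_Q: "arcs Q = (\<lambda>v. (v, nx v)) ` ({1..n} - {m})"
proof (intro equalityI subsetI)
  fix e assume "e \<in> arcs Q"
  then consider i where "e = (i, i + 1)" "1 \<le> i" "i < m" | i where "e = (i + 1, i)" "m \<le> i" "i < n"
    by (auto simp: quiver_A_def)
  then show "e \<in> (\<lambda>v. (v, nx v)) ` ({1..n} - {m})"
  proof cases
    case 1 then show ?thesis using m_le by (intro image_eqI[of _ _ i]) (auto simp: nx_def)
  next
    case 2 then show ?thesis by (intro image_eqI[of _ _ "i + 1"]) (auto simp: nx_def)
  qed
next
  fix e assume "e \<in> (\<lambda>v. (v, nx v)) ` ({1..n} - {m})"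
  then obtain v where "e = (v, nx v)" "v \<in> {1..n} - {m}" by blast
  then have v: "e = (v, nx v)" "1 \<le> v" "v \<le> n" "v \<noteq> m" by simp_all
  show "e \<in> arcs Q"
  proof (cases "v < m")
    case False
    then obtain i where "v = i + 1" "m \<le> i" using v by (intro that[of "v - 1"]) auto
    then show ?thesis using v by (auto simp: nx_def quiver_A_def)
  qed (use v in \<open>auto simp: nx_def quiver_A_def\<close>)
qed

lemma nx_in: "v \<in> {1..n} \<Longrightarrow> nx v \<in> {1..n}"
  using m_ge m_le by (auto simp: nx_def)

lemma wf_Q: "wf_digraph Q"
  using nx_in by unfold_locales (auto simp: arcs_Q verts_Q tail_Q head_Q)

lemma m_in: "m \<in> {1..n}" using m_ge m_le by simp

lemma is_rep_iff: "is_rep Q V \<longleftrightarrow>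
    (\<forall>v \<in> {1..n} - {m}. rmap V (v, nx v) \<in> carrier_mat (rdim V (nx v)) (rdim V v))"
  by (simp add: is_rep_def arcs_Q head_Q tail_Q)

lemma is_hom_iff: "is_hom Q V W f \<longleftrightarrow>
    (\<forall>v \<in> {1..n}. f v \<in> carrier_mat (rdim W v) (rdim V v)) \<and>
    (\<forall>v \<in> {1..n} - {m}. f (nx v) * rmap V (v, nx v) = rmap W (v, nx v) * f v)"
  by (simp add: is_hom_def arcs_Q head_Q tail_Q verts_Q)

text \<open>With truncated subtraction \<open>(v - m) + (m - v)\<close> is the distance of
  \<open>v\<close> from the sink, on either arm.\<close>

lemma sink_induct [consumes 1, case_names sink step]:
  assumes "v \<in> {1..n}" "P m" "\<And>v. v \<in> {1..n} \<Longrightarrow> v \<noteq> m \<Longrightarrow> P (nx v) \<Longrightarrow> P v"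
  shows "P v"
  using assms(1)
proof (induction "(v - m) + (m - v)" arbitrary: v rule: less_induct)
  case less
  show ?case
  proof (cases "v = m")
    case False
    have "nx v - m + (m - nx v) < v - m + (m - v)" using False by (auto simp: nx_def)
    then have "P (nx v)" using less(1) nx_in[OF less(2)] by blast
    then show ?thesis using assms(3)[OF less(2) False] by simp
  qed (simp add: assms(2))
qed

primrec steps :: "('k :: field) vrep \<Rightarrow> nat \<Rightarrow> nat \<Rightarrow> 'k mat" where
  "steps V 0 v = 1\<^sub>m (rdim V v)"
| "steps V (Suc k) v = steps V k (nx v) * rmap V (v, nx v)"

text \<open>The composite of the maps of \<open>V\<close> along the path from \<open>v\<close> to
  \<open>m\<close>.\<close>

definition to_sink :: "('k :: field) vrep \<Rightarrow> nat \<Rightarrow> 'k mat" where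
  "to_sink V v = steps V ((v - m) + (m - v)) v"

lemma to_sink_m: "to_sink V m = 1\<^sub>m (rdim V m)"
  by (simp add: to_sink_def)

lemma to_sink_step: "v \<noteq> m \<Longrightarrow> to_sink V v = to_sink V (nx v) * rmap V (v, nx v)"
proof -
  assume "v \<noteq> m"
  then have "v - m + (m - v) = Suc (nx v - m + (m - nx v))" by (auto simp: nx_def)
  then show ?thesis by (simp add: to_sink_def)
qed

lemma to_sink_carrier:
  assumes V: "is_rep Q V" and v: "v \<in> {1..n}"
  shows "to_sink V v \<in> carrier_mat (rdim V m) (rdim V v)"
  using v
proof (induction v rule: sink_induct)
  case (step v)
  then show ?case using V by (auto simp: to_sink_step is_rep_iff)
qed (simp add: to_sink_m)

lemma to_sink_hom:
  assumes V: "is_rep Q V" and W: "is_rep Q W" and f: "is_hom Q V W f" and v: "v \<in> {1..n}"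
  shows "f m * to_sink V v = to_sink W v * f v"
  using v
proof (induction v rule: sink_induct)
  case sink
  have "f m \<in> carrier_mat (rdim W m) (rdim V m)" using f m_in unfolding is_hom_iff by blast
  then show ?case by (simp add: to_sink_m)
next
  case (step v)
  have c: "f m \<in> carrier_mat (rdim W m) (rdim V m)" "f v \<in> carrier_mat (rdim W v) (rdim V v)"
    "f (nx v) \<in> carrier_mat (rdim W (nx v)) (rdim V (nx v))"
    "rmap V (v, nx v) \<in> carrier_mat (rdim V (nx v)) (rdim V v)"
    "rmap W (v, nx v) \<in> carrier_mat (rdim W (nx v)) (rdim W v)"
    "to_sink V (nx v) \<in> carrier_mat (rdim V m) (rdim V (nx v))"
    "to_sink W (nx v) \<in> carrier_mat (rdim W m) (rdim W (nx v))"
    using is_hom_carrier[OF f, of m] is_hom_carrier[OF f, of v] is_hom_carrier[OF f, of "nx v"] V W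
      step(1,2) m_in nx_in[OF step(1)] to_sink_carrier[OF V nx_in[OF step(1)]] to_sink_carrier[OF W nx_in[OF step(1)]]
    by (simp_all add: verts_Q is_rep_iff)
  note d = c[THEN carrier_matD(1)] c[THEN carrier_matD(2)]
  have fv: "f (nx v) * rmap V (v, nx v) = rmap W (v, nx v) * f v"
    using f step by (simp add: is_hom_iff)
  have "f m * to_sink V v = f m * to_sink V (nx v) * rmap V (v, nx v)"
    using d step(2) by (simp add: to_sink_step mult_assoc_dim)
  also have "\<dots> = to_sink W (nx v) * (f (nx v) * rmap V (v, nx v))"
    unfolding step(3) using d by (simp add: mult_assoc_dim)
  also have "\<dots> = to_sink W v * f v"
    unfolding fv using d step by (simp add: to_sink_step mult_assoc_dim)
  finally show ?case .
qed

section \<open>Maps into and out of interval representations\<close>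

definition spans :: "nat \<Rightarrow> nat \<Rightarrow> bool" where
  "spans a b \<longleftrightarrow> 1 \<le> a \<and> a \<le> m \<and> m \<le> b \<and> b \<le> n"

lemma spans_nx: "spans a b \<Longrightarrow> v \<in> {a..b} \<Longrightarrow> nx v \<in> {a..b}"
  by (auto simp: spans_def nx_def)

lemma spans_sub: "spans a b \<Longrightarrow> {a..b} \<subseteq> {1..n}" and spans_m: "spans a b \<Longrightarrow> m \<in> {a..b}"
  by (auto simp: spans_def)

text \<open>Every matrix has 0 or 1 rows and columns: it is the identity on arcs inside the interval
  and empty on all other arcs.\<close>

definition interval_rep :: "nat \<Rightarrow> nat \<Rightarrow> ('k :: field) vrep" where
  "interval_rep a b = \<lparr>rdim = \<lambda>v. if v \<in> {a..b} then 1 else 0,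
     rmap = \<lambda>e. mat (if snd e \<in> {a..b} then 1 else 0) (if fst e \<in> {a..b} then 1 else 0) (\<lambda>_. 1)\<rparr>"

lemma rdim_interval [simp]: "rdim (interval_rep a b) v = (if v \<in> {a..b} then 1 else 0)"
  by (simp add: interval_rep_def)

lemma rmap_interval: "v \<in> {a..b} \<Longrightarrow> w \<in> {a..b} \<Longrightarrow> rmap (interval_rep a b) (v, w) = 1\<^sub>m 1"
  by (auto simp: interval_rep_def intro!: eq_matI)

lemma rmap_interval_carrier: "rmap (interval_rep a b) (v, w) \<in>
    carrier_mat (if w \<in> {a..b} then 1 else 0) (if v \<in> {a..b} then 1 else 0)"
  by (simp add: interval_rep_def)

lemma interval_is_rep: "is_rep Q (interval_rep a b)"
  by (simp add: is_rep_iff interval_rep_def)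

lemma to_sink_interval: "spans a b \<Longrightarrow> v \<in> {a..b} \<Longrightarrow> to_sink (interval_rep a b) v = 1\<^sub>m 1"
proof -
  assume ab: "spans a b"
  have "v \<in> {1..n} \<Longrightarrow> v \<in> {a..b} \<longrightarrow> to_sink (interval_rep a b) v = 1\<^sub>m 1"
    by (induction v rule: sink_induct) (use spans_nx[OF ab] in \<open>auto simp: to_sink_m to_sink_step rmap_interval simp del: atLeastAtMost_iff\<close>)
  then show "v \<in> {a..b} \<Longrightarrow> to_sink (interval_rep a b) v = 1\<^sub>m 1" using spans_sub[OF ab] by auto
qed

text \<open>Families of compatible columns are the homomorphisms out of an interval representation, while
  homomorphisms into it are rows at the sink that vanish on what arrives from outside the interval.\<close>

definition family :: "('k :: field) vrep \<Rightarrow> nat set \<Rightarrow> (nat \<Rightarrow> 'k mat) \<Rightarrow> bool" where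
  "family V S Y \<longleftrightarrow> (\<forall>v \<in> S. Y v \<in> carrier_mat (rdim V v) 1) \<and>
     (\<forall>v \<in> S - {m}. rmap V (v, nx v) * Y v = Y (nx v))"

lemma family_subset: "family V S Y \<Longrightarrow> S' \<subseteq> S \<Longrightarrow> family V S' Y"
  by (auto simp: family_def)

lemma family_minus:
  assumes V: "is_rep Q V" and S: "S \<subseteq> {1..n}" "\<And>v. v \<in> S \<Longrightarrow> nx v \<in> S" and "family V S Y" "family V S Y'"
  shows "family V S (\<lambda>v. Y v - Y' v)"
  unfolding family_def
proof (intro conjI ballI)
  fix v assume v: "v \<in> S - {m}"
  have "rmap V (v, nx v) \<in> carrier_mat (rdim V (nx v)) (rdim V v)" using V S v by (auto simp: is_rep_iff)
  then show "rmap V (v, nx v) * (Y v - Y' v) = Y (nx v) - Y' (nx v)"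
    using v assms(4,5) by (auto simp: family_def mult_minus_distrib_mat)
qed (use assms(4,5) in \<open>auto simp: family_def intro: minus_carrier_mat\<close>)

lemma family_to_sink:
  assumes V: "is_rep Q V" and ab: "spans a b" and Y: "family V {a..b} Y" and v: "v \<in> {a..b}"
  shows "to_sink V v * Y v = Y m"
proof -
  have "v \<in> {1..n} \<Longrightarrow> v \<in> {a..b} \<longrightarrow> to_sink V v * Y v = Y m"
  proof (induction v rule: sink_induct)
    case sink
    show ?case
    proof
      assume "m \<in> {a..b}"
      then have "Y m \<in> carrier_mat (rdim V m) 1" using Y unfolding family_def by blast
      then show "to_sink V m * Y m = Y m" by (simp add: to_sink_m)
    qed
  next
    case (step v)
    show ?case
    proof
      assume v: "v \<in> {a..b}"
      have c: "to_sink V (nx v) \<in> carrier_mat (rdim V m) (rdim V (nx v))"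
        "rmap V (v, nx v) \<in> carrier_mat (rdim V (nx v)) (rdim V v)" "Y v \<in> carrier_mat (rdim V v) 1"
        using V v Y step nx_in to_sink_carrier by (auto simp: is_rep_iff family_def)
      have "to_sink V v * Y v = to_sink V (nx v) * (rmap V (v, nx v) * Y v)"
        using step assoc_mult_mat[OF c] by (simp add: to_sink_step)
      also have "\<dots> = Y m" using Y v step spans_nx[OF ab v] by (auto simp: family_def)
      finally show "to_sink V v * Y v = Y m" .
    qed
  qed
  then show ?thesis using v spans_sub[OF ab] by auto
qed

lemma family_hom:
  assumes V: "is_rep Q V" and ab: "spans a b" and Y: "family V {a..b} Y"
  shows "is_hom Q (interval_rep a b) V (\<lambda>v. if v \<in> {a..b} then Y v else 0\<^sub>m (rdim V v) 0)"
  unfolding is_hom_iff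
proof (intro conjI ballI)
  fix v assume v: "v \<in> {1..n} - {m}"
  have Vc: "rmap V (v, nx v) \<in> carrier_mat (rdim V (nx v)) (rdim V v)" using V v by (simp add: is_rep_iff)
  let ?f = "\<lambda>v. if v \<in> {a..b} then Y v else 0\<^sub>m (rdim V v) 0"
  show "?f (nx v) * rmap (interval_rep a b) (v, nx v) = rmap V (v, nx v) * ?f v"
  proof (cases "v \<in> {a..b}")
    case True
    then show ?thesis using spans_nx[OF ab True] Y v
      by (auto simp: rmap_interval family_def simp del: atLeastAtMost_iff)
  next
    case False
    have "?f (nx v) \<in> carrier_mat (rdim V (nx v)) (if nx v \<in> {a..b} then 1 else 0)"
      using Y by (auto simp: family_def)
    from mult_carrier_mat[OF this rmap_interval_carrier[of a b v "nx v"]]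
    have "?f (nx v) * rmap (interval_rep a b) (v, nx v) \<in> carrier_mat (rdim V (nx v)) 0"
      unfolding if_not_P[OF False] .
    then show ?thesis unfolding if_not_P[OF False]
      by (rule eq_mat_zero_col) (rule mult_carrier_mat[OF Vc zero_carrier_mat])
  qed
qed (use Y in \<open>auto simp: family_def\<close>)

lemma hom_family:
  assumes ab: "spans a b" and f: "is_hom Q (interval_rep a b) V f"
  shows "family V {a..b} f"
  unfolding family_def
proof (intro conjI ballI)
  fix v assume v: "v \<in> {a..b}"
  then have "v \<in> {1..n}" using spans_sub[OF ab] by blast
  then show "f v \<in> carrier_mat (rdim V v) 1" 
    using is_hom_carrier[OF f, of v] v by (simp add: verts_Q)
next
  fix v assume v: "v \<in> {a..b} - {m}"
  then have v': "v \<in> {1..n} - {m}" and nv: "nx v \<in> {a..b}" using spans_sub[OF ab] spans_nx[OF ab] by blast+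
  have "nx v \<in> {1..n}" using nv spans_sub[OF ab] by blast
  then have "f (nx v) \<in> carrier_mat (rdim V (nx v)) 1"
    using is_hom_carrier[OF f, of "nx v"] nv by (simp add: verts_Q)
  moreover have "f (nx v) * rmap (interval_rep a b) (v, nx v) = rmap V (v, nx v) * f v"
    using f v' unfolding is_hom_iff by blast
  ultimately show "rmap V (v, nx v) * f v = f (nx v)" using v nv by (simp add: rmap_interval)
qed

text \<open>The row is pulled back along the path to the sink. Commutation holds automatically on
  arcs inside or outside the interval; on an arc entering the interval it is the condition
  \<open>kill\<close>.\<close>

lemma row_hom:
  fixes V :: "('k :: field) vrep"
  assumes V: "is_rep Q V" and ab: "spans a b" and \<Phi>: "\<Phi> \<in> carrier_mat 1 (rdim V m)"
    and kill: "\<And>v. v \<in> {1..n} - {a..b} \<Longrightarrow> \<Phi> * to_sink V v = 0\<^sub>m 1 (rdim V v)"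
  shows "is_hom Q V (interval_rep a b) (\<lambda>v. if v \<in> {a..b} then \<Phi> * to_sink V v else 0\<^sub>m 0 (rdim V v))"
  unfolding is_hom_iff
proof (intro conjI ballI)
  fix v assume "v \<in> {1..n}"
  then show "(if v \<in> {a..b} then \<Phi> * to_sink V v else 0\<^sub>m 0 (rdim V v)) \<in> carrier_mat (rdim (interval_rep a b) v) (rdim V v)"
    using mult_carrier_mat[OF \<Phi> to_sink_carrier[OF V]] by auto
next
  fix v assume v: "v \<in> {1..n} - {m}"
  have c: "rmap V (v, nx v) \<in> carrier_mat (rdim V (nx v)) (rdim V v)"
    "to_sink V v \<in> carrier_mat (rdim V m) (rdim V v)"
    "to_sink V (nx v) \<in> carrier_mat (rdim V m) (rdim V (nx v))"
    using V v to_sink_carrier nx_in by (auto simp: is_rep_iff)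
  have T: "\<Phi> * to_sink V (nx v) * rmap V (v, nx v) = \<Phi> * to_sink V v"
    using assoc_mult_mat[OF \<Phi> c(3,1)] v by (simp add: to_sink_step)
  let ?f = "\<lambda>v. if v \<in> {a..b} then \<Phi> * to_sink V v else 0\<^sub>m 0 (rdim V v)"
  show "?f (nx v) * rmap V (v, nx v) = rmap (interval_rep a b) (v, nx v) * ?f v"
  proof (cases "nx v \<in> {a..b}")
    case nxin: True
    show ?thesis
    proof (cases "v \<in> {a..b}")
      case True
      show ?thesis
        unfolding if_P[OF nxin] if_P[OF True] T rmap_interval[OF True nxin]
        by (rule left_mult_one_mat[OF mult_carrier_mat[OF \<Phi> c(2)], symmetric])
    next
      case False
      let ?R = "rmap (interval_rep a b) (v, nx v) :: 'k mat"
      have "?R \<in> carrier_mat 1 0"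
        using rmap_interval_carrier[of a b v "nx v"] nxin False by (simp del: atLeastAtMost_iff)
      then have "?R * 0\<^sub>m 0 (rdim V v) = 0\<^sub>m 1 (rdim V v)" by simp
      moreover have "\<Phi> * to_sink V v = 0\<^sub>m 1 (rdim V v)" using kill v False by blast
      ultimately show ?thesis unfolding if_P[OF nxin] if_not_P[OF False] T by simp
    qed
  next
    case False
    \<comment> \<open>The interval contains the sink, so no arc leaves it.\<close>
    then have v': "v \<notin> {a..b}" using spans_nx[OF ab] by blast
    have "(rmap (interval_rep a b) (v, nx v) :: 'k mat) \<in> carrier_mat 0 0"
      using rmap_interval_carrier[of a b v "nx v"] v' False by (simp del: atLeastAtMost_iff)
    from mult_carrier_mat[OF this zero_carrier_mat] mult_carrier_mat[OF zero_carrier_mat c(1), of 0]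
    show ?thesis unfolding if_not_P[OF v'] if_not_P[OF False] by (intro eq_mat_zero_row) auto
  qed
qed

text \<open>A homomorphism commutes with \<open>to_sink\<close>, and inside the interval
  \<open>to_sink\<close> is the identity; the component at the sink therefore determines the whole
  map.\<close>

lemma hom_row:
  assumes V: "is_rep Q V" and ab: "spans a b" and f: "is_hom Q V (interval_rep a b) f"
  shows "f m \<in> carrier_mat 1 (rdim V m)"
    "v \<in> {a..b} \<Longrightarrow> f v = f m * to_sink V v"
    "v \<in> {1..n} - {a..b} \<Longrightarrow> f m * to_sink V v = 0\<^sub>m 1 (rdim V v)"
proof -
  have fc: "f v \<in> carrier_mat (if v \<in> {a..b} then 1 else 0) (rdim V v)" if "v \<in> {1..n}" for v
    using is_hom_carrier[OF f, of v] that by (simp add: verts_Q)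
  show "f m \<in> carrier_mat 1 (rdim V m)" using fc[OF m_in] spans_m[OF ab] by simp
  note T = to_sink_hom[OF V interval_is_rep f]
  show "f v = f m * to_sink V v" if v: "v \<in> {a..b}"
  proof -
    have v': "v \<in> {1..n}" using v spans_sub[OF ab] by blast
    show ?thesis using T[OF v'] fc[OF v'] v unfolding to_sink_interval[OF ab v] by simp
  qed
  show "f m * to_sink V v = 0\<^sub>m 1 (rdim V v)" if v: "v \<in> {1..n} - {a..b}"
  proof -
    have v': "v \<in> {1..n}" using v by blast
    have "to_sink (interval_rep a b :: (nat, nat \<times> nat, 'a) qrep) v \<in> carrier_mat 1 0"
      using to_sink_carrier[OF interval_is_rep v', of a b] v spans_m[OF ab] by auto
    moreover have "f v \<in> carrier_mat 0 (rdim V v)" using fc[OF v'] v by auto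
    ultimately have "to_sink (interval_rep a b) v * f v = 0\<^sub>m 1 (rdim V v)"
      by (intro eq_matI) (auto simp: scalar_prod_def)
    then show ?thesis using T[OF v'] by simp
  qed
qed

text \<open>The value at \<open>u\<close> is pushed along the arcs;
  \<open>{min u m..max u m}\<close> is the path from \<open>u\<close> to \<open>m\<close> on either
  arm.\<close>

lemma family_extend:
  assumes V: "is_rep Q V" and u: "u \<in> {1..n}"
  shows "x \<in> carrier_mat (rdim V u) 1 \<Longrightarrow> \<exists>Y. family V {min u m..max u m} Y \<and> Y u = x"
  using u
proof (induction u arbitrary: x rule: sink_induct)
  case sink
  then show ?case by (intro exI[of _ "\<lambda>_. x"]) (auto simp: family_def)
next
  case (step u)
  have c: "rmap V (u, nx u) \<in> carrier_mat (rdim V (nx u)) (rdim V u)" using step V by (auto simp: is_rep_iff)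
  from step.IH[OF mult_carrier_mat[OF c step.prems]]
  obtain Y where Y: "family V {min (nx u) m..max (nx u) m} Y" "Y (nx u) = rmap V (u, nx u) * x" by blast
  have "{min u m..max u m} = insert u {min (nx u) m..max (nx u) m}" "u \<notin> {min (nx u) m..max (nx u) m}"
    "nx u \<noteq> u" "\<forall>v \<in> {min (nx u) m..max (nx u) m} - {m}. nx v \<noteq> u"
    using step.hyps by (auto simp: nx_def min_def max_def split: if_splits)
  then show ?case
    using Y step.prems by (intro exI[of _ "Y(u := x)"]) (auto simp: family_def)
qed

text \<open>The two arms share only the sink, so agreement there suffices.\<close>

lemma family_glue:
  assumes "family V {a..m} Y" "family V {m..b} Y'" "Y m = Y' m"
  shows "family V {a..b} (\<lambda>v. if v \<le> m then Y v else Y' v)"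
  unfolding family_def
proof (intro conjI ballI)
  fix v assume v: "v \<in> {a..b} - {m}"
  show "rmap V (v, nx v) * (if v \<le> m then Y v else Y' v) = (if nx v \<le> m then Y (nx v) else Y' (nx v))"
  proof (cases "v < m")
    case True
    then have "nx v \<le> m" by (simp add: nx_def)
    then show ?thesis using assms(1) v True by (auto simp: family_def)
  next
    case False
    then have mv: "m < v" using v by auto
    then have "nx v = m \<or> m < nx v" by (auto simp: nx_def)
    then have "(if nx v \<le> m then Y (nx v) else Y' (nx v)) = Y' (nx v)" using assms(3) by auto
    moreover have "rmap V (v, nx v) * Y' v = Y' (nx v)" using assms(2) v mv by (auto simp: family_def)
    ultimately show ?thesis using mv by simp
  qed
qed (use assms in \<open>auto simp: family_def\<close>)

text \<open>Outside the quiver the image is zero, which makes the statements below uniform at the two ends.\<close>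

definition img :: "('k :: field) vrep \<Rightarrow> nat \<Rightarrow> 'k mat set" where
  "img V u = (if u \<in> {1..n} then (\<lambda>x. to_sink V u * x) ` carrier_mat (rdim V u) 1 else {0\<^sub>m (rdim V m) 1})"

lemma img_out: "u \<notin> {1..n} \<Longrightarrow> img V u = {0\<^sub>m (rdim V m) 1}"
  unfolding img_def by (rule if_not_P)

section \<open>Flags at the sink and the criteria for splitting\<close>

context
  fixes V :: "('k :: field) vrep"
  assumes V: "is_rep Q V"
begin

lemma img_carrier: "w \<in> img V u \<Longrightarrow> w \<in> carrier_mat (rdim V m) 1"
  using to_sink_carrier[OF V, of u] by (auto simp: img_def split: if_splits)

lemma img_zero: "0\<^sub>m (rdim V m) 1 \<in> img V u"
proof (cases "u \<in> {1..n}")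
  case True
  have "to_sink V u * 0\<^sub>m (rdim V u) 1 = 0\<^sub>m (rdim V m) 1"
    by (rule right_mult_zero_mat[OF to_sink_carrier[OF V True]])
  then show ?thesis unfolding img_def if_P[OF True] by (metis image_eqI zero_carrier_mat)
qed (use img_out in blast)

lemma img_closed:
  assumes "w \<in> img V u" "w' \<in> img V u"
  shows "w + w' \<in> img V u" "w - w' \<in> img V u" "c \<cdot>\<^sub>m w \<in> img V u"
proof -
  have "w + w' \<in> img V u \<and> w - w' \<in> img V u \<and> c \<cdot>\<^sub>m w \<in> img V u"
  proof (cases "u \<in> {1..n}")
    case True
    then obtain x x' where x: "x \<in> carrier_mat (rdim V u) 1" "w = to_sink V u * x"
      and x': "x' \<in> carrier_mat (rdim V u) 1" "w' = to_sink V u * x'"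
      using assms by (auto simp: img_def)
    note T = to_sink_carrier[OF V True]
    have "w + w' = to_sink V u * (x + x')" "w - w' = to_sink V u * (x - x')" "c \<cdot>\<^sub>m w = to_sink V u * (c \<cdot>\<^sub>m x)"
      using mult_add_distrib_mat[OF T x(1) x'(1)] mult_minus_distrib_mat[OF T x(1) x'(1)]
        mult_smult_distrib[OF T x(1)] x x' by auto
    moreover have "x + x' \<in> carrier_mat (rdim V u) 1" "x - x' \<in> carrier_mat (rdim V u) 1" "c \<cdot>\<^sub>m x \<in> carrier_mat (rdim V u) 1"
      using x x' by (auto intro: minus_carrier_mat)
    ultimately show ?thesis unfolding img_def if_P[OF True] by blast
  next
    case False
    then have "w = 0\<^sub>m (rdim V m) 1" "w' = 0\<^sub>m (rdim V m) 1" using assms img_out by blast+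
    moreover from this have "w + w' = 0\<^sub>m (rdim V m) 1" "w - w' = 0\<^sub>m (rdim V m) 1" "c \<cdot>\<^sub>m w = 0\<^sub>m (rdim V m) 1"
      by (auto intro!: eq_matI)
    ultimately show ?thesis using img_zero by metis
  qed
  then show "w + w' \<in> img V u" "w - w' \<in> img V u" "c \<cdot>\<^sub>m w \<in> img V u" by auto
qed

lemma img_nx: "v \<noteq> m \<Longrightarrow> img V v \<subseteq> img V (nx v)"
proof (cases "v \<in> {1..n}")
  case True
  assume v: "v \<noteq> m"
  show ?thesis
  proof
    fix w assume "w \<in> img V v"
    then obtain x where x: "x \<in> carrier_mat (rdim V v) 1" "w = to_sink V v * x"
      using True by (auto simp: img_def)
    have r: "rmap V (v, nx v) \<in> carrier_mat (rdim V (nx v)) (rdim V v)" using V True v by (simp add: is_rep_iff)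
    have "w = to_sink V (nx v) * (rmap V (v, nx v) * x)"
      using x assoc_mult_mat[OF to_sink_carrier[OF V nx_in[OF True]] r x(1)] v by (simp add: to_sink_step)
    then show "w \<in> img V (nx v)"
      unfolding img_def if_P[OF nx_in[OF True]] using mult_carrier_mat[OF r x(1)] by blast
  qed
next
  case False
  then show ?thesis using img_out[OF False, of V] img_zero[of "nx v"] by simp
qed

text \<open>A path starting further out passes through the vertices nearer to the sink, so the
  images along each arm form a flag.\<close>

lemma img_mono:
  shows "u' \<le> u \<Longrightarrow> u \<le> m \<Longrightarrow> img V u' \<subseteq> img V u" "m \<le> u \<Longrightarrow> u \<le> u' \<Longrightarrow> img V u' \<subseteq> img V u"
proof -
  show "u' \<le> u \<Longrightarrow> u \<le> m \<Longrightarrow> img V u' \<subseteq> img V u"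
  proof (induction u rule: dec_induct)
    case (step u)
    then show ?case using img_nx[of u] by (auto simp: nx_def)
  qed simp
  assume "u \<le> u'"
  then show "m \<le> u \<Longrightarrow> img V u' \<subseteq> img V u"
  proof (induction u' rule: dec_induct)
    case (step v)
    then show ?case using img_nx[of "Suc v"] by (auto simp: nx_def)
  qed simp
qed

lemma img_m: "img V m = carrier_mat (rdim V m) 1"
  using m_in by (force simp: img_def to_sink_m)

lemma img_kill:
  assumes \<Phi>: "\<Phi> \<in> carrier_mat 1 (rdim V m)" and v: "v \<in> {1..n}"
  shows "\<Phi> * to_sink V v = 0\<^sub>m 1 (rdim V v) \<longleftrightarrow> (\<forall>w \<in> img V v. \<Phi> * w = 0\<^sub>m 1 1)"
proof
  note T = to_sink_carrier[OF V v]
  {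
    assume 0: "\<Phi> * to_sink V v = 0\<^sub>m 1 (rdim V v)"
    show "\<forall>w \<in> img V v. \<Phi> * w = 0\<^sub>m 1 1"
      unfolding img_def if_P[OF v]
    proof safe
      fix x :: "'k mat" assume x: "x \<in> carrier_mat (rdim V v) 1"
      show "\<Phi> * (to_sink V v * x) = 0\<^sub>m 1 1"
        using assoc_mult_mat[OF \<Phi> T x] 0 x by simp
    qed
  next
    assume 0: "\<forall>w \<in> img V v. \<Phi> * w = 0\<^sub>m 1 1"
    show "\<Phi> * to_sink V v = 0\<^sub>m 1 (rdim V v)"
    proof (rule row_zeroI[OF mult_carrier_mat[OF \<Phi> T]])
      fix x :: "'k mat" assume x: "x \<in> carrier_mat (rdim V v) 1"
      then have "to_sink V v * x \<in> img V v" unfolding img_def if_P[OF v] by blast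
      then show "\<Phi> * to_sink V v * x = 0\<^sub>m 1 1"
        using assoc_mult_mat[OF \<Phi> T x] 0 by simp
    qed
  }
qed

text \<open>By the flag property \<open>img V (a - 1)\<close> and \<open>img V (b + 1)\<close>
  contain everything that arrives from outside the interval. Beyond the ends of the quiver they are
  zero and impose nothing.\<close>

lemma row_hom_img:
  assumes ab: "spans a b" and \<Phi>: "\<Phi> \<in> carrier_mat 1 (rdim V m)"
    and kill: "\<And>w. w \<in> img V (a - 1) \<Longrightarrow> \<Phi> * w = 0\<^sub>m 1 1" "\<And>w. w \<in> img V (b + 1) \<Longrightarrow> \<Phi> * w = 0\<^sub>m 1 1"
  shows "is_hom Q V (interval_rep a b) (\<lambda>v. if v \<in> {a..b} then \<Phi> * to_sink V v else 0\<^sub>m 0 (rdim V v))"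
proof (rule row_hom[OF V ab \<Phi>])
  fix v assume v: "v \<in> {1..n} - {a..b}"
  have "img V v \<subseteq> img V (a - 1) \<or> img V v \<subseteq> img V (b + 1)"
  proof (cases "v < a")
    case True
    then have "v \<le> a - 1" "a - 1 \<le> m" using ab by (auto simp: spans_def)
    then show ?thesis using img_mono(1) by blast
  next
    case False
    then have "m \<le> b + 1" "b + 1 \<le> v" using ab v by (auto simp: spans_def)
    then show ?thesis using img_mono(2) by blast
  qed
  then show "\<Phi> * to_sink V v = 0\<^sub>m 1 (rdim V v)"
    using kill v img_kill[OF \<Phi>, of v] by blast
qed

lemma hom_row_img:
  assumes ab: "spans a b" and f: "is_hom Q V (interval_rep a b) f" and v: "v \<notin> {a..b}" and w: "w \<in> img V v"
  shows "f m * w = 0\<^sub>m 1 1"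
proof (cases "v \<in> {1..n}")
  case True
  then show ?thesis
    using hom_row(3)[OF V ab f, of v] v w img_kill[OF hom_row(1)[OF V ab f] True] by blast
next
  case False
  then have "w = 0\<^sub>m (rdim V m) 1" using w img_out by blast
  then show ?thesis using hom_row(1)[OF V ab f] by simp
qed

lemma family_in_img:
  assumes "spans a b" "family V {a..b} Y" "v \<in> {a..b}"
  shows "Y m \<in> img V v"
proof -
  have "v \<in> {1..n}" using assms spans_sub by blast
  moreover have "Y v \<in> carrier_mat (rdim V v) 1" using assms by (simp add: family_def)
  ultimately have "to_sink V v * Y v \<in> img V v" unfolding img_def by simp
  then show ?thesis using family_to_sink[OF V assms] by simp
qed

lemma img_family_left:
  assumes "1 \<le> a" "a \<le> m" "w \<in> img V a"
  obtains Y where "family V {a..m} Y" "Y m = w"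
proof -
  have a: "a \<in> {1..n}" using assms m_le by simp
  obtain x where x: "x \<in> carrier_mat (rdim V a) 1" "w = to_sink V a * x"
    using assms(3) a by (auto simp: img_def)
  obtain Y where Y: "family V {a..m} Y" "Y a = x"
    using family_extend[OF V a x(1)] min_absorb1[OF assms(2)] max_absorb2[OF assms(2)] by auto
  then show ?thesis
    using family_to_sink[OF V _ Y(1), of a] x(2) assms m_le that by (auto simp: spans_def)
qed

lemma img_family_right:
  assumes "m \<le> b" "b \<le> n" "w \<in> img V b"
  obtains Y where "family V {m..b} Y" "Y m = w"
proof -
  have b: "b \<in> {1..n}" using assms m_ge by simp
  obtain x where x: "x \<in> carrier_mat (rdim V b) 1" "w = to_sink V b * x"
    using assms(3) b by (auto simp: img_def)
  obtain Y where Y: "family V {m..b} Y" "Y b = x"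
    using family_extend[OF V b x(1)] min_absorb2[OF assms(1)] max_absorb1[OF assms(1)] by auto
  then show ?thesis
    using family_to_sink[OF V _ Y(1), of b] x(2) assms m_ge that by (auto simp: spans_def)
qed

text \<open>The vector is lifted along each arm separately, and the two lifts are glued at the
  sink.\<close>

lemma img_family:
  assumes "spans a b" "w \<in> img V a" "w \<in> img V b"
  obtains Y where "family V {a..b} Y" "Y m = w"
proof -
  obtain Y where Y: "family V {a..m} Y" "Y m = w"
    using img_family_left assms by (auto simp: spans_def)
  obtain Y' where Y': "family V {m..b} Y'" "Y' m = w"
    using img_family_right assms by (auto simp: spans_def)
  have "family V {a..b} (\<lambda>v. if v \<le> m then Y v else Y' v)"
    using family_glue[OF Y(1) Y'(1)] Y Y' by simp
  then show ?thesis using that Y by force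
qed

text \<open>Since \<open>to_sink V v * Y v = Y m\<close>, the product at every vertex of the
  interval is the one at the sink, so a splitting has to be arranged at \<open>m\<close>
  only.\<close>

lemma row_family_retract:
  assumes ab: "spans a b" and Y: "family V {a..b} Y" and \<Phi>: "\<Phi> \<in> carrier_mat 1 (rdim V m)" "\<Phi> * Y m = 1\<^sub>m 1"
  shows "v \<in> verts Q \<Longrightarrow> (if v \<in> {a..b} then \<Phi> * to_sink V v else 0\<^sub>m 0 (rdim V v)) *
    (if v \<in> {a..b} then Y v else 0\<^sub>m (rdim V v) 0) = 1\<^sub>m (rdim (interval_rep a b :: 'k vrep) v)"
proof (cases "v \<in> {a..b}")
  case True
  then have "v \<in> {1..n}" "Y v \<in> carrier_mat (rdim V v) 1" using spans_sub[OF ab] Y by (auto simp: family_def)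
  then have "\<Phi> * to_sink V v * Y v = \<Phi> * (to_sink V v * Y v)"
    using assoc_mult_mat[OF \<Phi>(1) to_sink_carrier[OF V]] by blast
  then show ?thesis using True \<Phi>(2) family_to_sink[OF V ab Y True] by simp
next
  case False
  then show ?thesis unfolding if_not_P[OF False] by (intro eq_matI) auto
qed

text \<open>With \<open>a - 1\<close> and \<open>b + 1\<close> as the two vertices, the sum of the
  images is the subspace that a row must kill to define a map into \<open>[a, b]\<close>.\<close>

lemma separate_two:
  assumes z: "z \<in> carrier_mat (rdim V m) 1" and n: "\<And>l r. l \<in> img V a \<Longrightarrow> r \<in> img V b \<Longrightarrow> z \<noteq> l + r"
  shows "\<exists>\<Phi> \<in> carrier_mat 1 (rdim V m). \<Phi> * z = 1\<^sub>m 1 \<and> (\<forall>w \<in> img V a \<union> img V b. \<Phi> * w = 0\<^sub>m 1 1)"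
proof -
  define W where "W = {l + r | l r. l \<in> img V a \<and> r \<in> img V b}"
  have c: "w \<in> carrier_mat (rdim V m) 1" if "w \<in> img V u" for w u using that by (rule img_carrier)
  have imgs: "img V a \<subseteq> W" "img V b \<subseteq> W"
  proof -
    show "img V a \<subseteq> W"
    proof
      fix w assume w: "w \<in> img V a"
      then have "w = w + 0\<^sub>m (rdim V m) 1" using c by simp
      then show "w \<in> W" using w img_zero unfolding W_def by blast
    qed
    show "img V b \<subseteq> W"
    proof
      fix w assume w: "w \<in> img V b"
      then have "w = 0\<^sub>m (rdim V m) 1 + w" using c by simp
      then show "w \<in> W" using w img_zero unfolding W_def by blast
    qed
  qed
  have zW: "z \<notin> W" using n by (auto simp: W_def)
  have Wc: "W \<subseteq> carrier_mat (rdim V m) 1" using c by (auto simp: W_def)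
  have Wadd: "u + v \<in> W" if "u \<in> W" "v \<in> W" for u v
  proof -
    obtain l r l' r' where lr: "l \<in> img V a" "r \<in> img V b" "u = l + r" "l' \<in> img V a" "r' \<in> img V b" "v = l' + r'"
      using \<open>u \<in> W\<close> \<open>v \<in> W\<close> by (auto simp: W_def)
    have "u + v = (l + l') + (r + r')"
      using c[OF lr(1)] c[OF lr(2)] c[OF lr(4)] c[OF lr(5)] lr by (intro eq_matI) auto
    then show ?thesis using img_closed(1)[OF lr(1,4)] img_closed(1)[OF lr(2,5)] by (auto simp: W_def)
  qed
  have Wsm: "k \<cdot>\<^sub>m u \<in> W" if "u \<in> W" for k u
  proof -
    obtain l r where lr: "l \<in> img V a" "r \<in> img V b" "u = l + r" using \<open>u \<in> W\<close> by (auto simp: W_def)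
    have "k \<cdot>\<^sub>m u = k \<cdot>\<^sub>m l + k \<cdot>\<^sub>m r"
      using c[OF lr(1)] c[OF lr(2)] lr by (intro eq_matI) (auto simp: algebra_simps)
    then show ?thesis using img_closed(3)[OF lr(1,1)] img_closed(3)[OF lr(2,2)] by (auto simp: W_def)
  qed
  have W0: "0\<^sub>m (rdim V m) 1 \<in> W" using imgs(1) img_zero by blast
  have "\<exists>\<Phi> \<in> carrier_mat 1 (rdim V m). \<Phi> * z = 1\<^sub>m 1 \<and> (\<forall>w \<in> W. \<Phi> * w = 0\<^sub>m 1 1)"
    by (rule separating_row[OF Wc W0 _ _ z zW]) (fact Wadd Wsm)+
  with imgs show ?thesis by blast
qed

text \<open>Otherwise some row is 1 on \<open>h m\<close> and kills both images; it defines a map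
  back to the interval, which is a retraction of \<open>h\<close>.\<close>

lemma not_split_mono_decompose:
  assumes ab: "spans a b" and h: "is_hom Q (interval_rep a b) V h" and ns: "\<not> split_mono Q (interval_rep a b) V h"
  shows "\<exists>l \<in> img V (a - 1). \<exists>r \<in> img V (b + 1). h m = l + r"
proof (rule ccontr)
  assume no: "\<not> (\<exists>l \<in> img V (a - 1). \<exists>r \<in> img V (b + 1). h m = l + r)"
  note Y = hom_family[OF ab h]
  have hm: "h m \<in> carrier_mat (rdim V m) 1" using Y spans_m[OF ab] by (simp add: family_def)
  have nd: "h m \<noteq> l + r" if "l \<in> img V (a - 1)" "r \<in> img V (b + 1)" for l r
    using no that by blast
  obtain \<Phi> where \<Phi>: "\<Phi> \<in> carrier_mat 1 (rdim V m)" "\<Phi> * h m = 1\<^sub>m 1"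
    "\<And>w. w \<in> img V (a - 1) \<Longrightarrow> \<Phi> * w = 0\<^sub>m 1 1" "\<And>w. w \<in> img V (b + 1) \<Longrightarrow> \<Phi> * w = 0\<^sub>m 1 1"
    using separate_two[OF hm nd] by blast
  let ?p = "\<lambda>v. if v \<in> {a..b} then \<Phi> * to_sink V v else 0\<^sub>m 0 (rdim V v)"
  have "?p v * h v = 1\<^sub>m (rdim (interval_rep a b :: 'k vrep) v)" if v: "v \<in> verts Q" for v
  proof -
    have "h v = (if v \<in> {a..b} then h v else 0\<^sub>m (rdim V v) 0)"
      using is_hom_carrier[OF h v] by (auto intro!: eq_matI)
    then show ?thesis using row_family_retract[OF ab Y \<Phi>(1,2) v] by simp
  qed
  moreover have "is_hom Q V (interval_rep a b) ?p" by (rule row_hom_img[OF ab \<Phi>(1,3,4)])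
  ultimately show False using ns h unfolding split_mono_def by blast
qed

text \<open>Dually, a vector of both images on which \<open>g m\<close> is nonzero can be scaled to
  value 1 and lifted to a map out of the interval, which is a section of \<open>g\<close>.\<close>

lemma not_split_epi_vanish:
  assumes ab: "spans a b" and g: "is_hom Q V (interval_rep a b) g" and ns: "\<not> split_epi Q V (interval_rep a b) g"
    and w: "w \<in> img V a" "w \<in> img V b"
  shows "g m * w = 0\<^sub>m 1 1"
proof (rule ccontr)
  assume no: "g m * w \<noteq> 0\<^sub>m 1 1"
  note gm = hom_row[OF V ab g]
  have wc: "w \<in> carrier_mat (rdim V m) 1" using img_carrier[OF w(1)] .
  obtain c where c: "c \<noteq> 0" "g m * w = c \<cdot>\<^sub>m 1\<^sub>m 1"
    by (rule scalar_mat_cases[OF mult_carrier_mat[OF gm(1) wc]]) (use no in simp, blast)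
  let ?w = "(1 / c) \<cdot>\<^sub>m w"
  have gw: "g m * ?w = 1\<^sub>m 1"
    using mult_smult_distrib[OF gm(1) wc, of "1 / c"] c by (auto intro!: eq_matI)
  obtain Y where Y: "family V {a..b} Y" "Y m = ?w"
    using img_family[OF ab img_closed(3)[OF w(1,1)] img_closed(3)[OF w(2,2)]] by blast
  let ?s = "\<lambda>v. if v \<in> {a..b} then Y v else 0\<^sub>m (rdim V v) 0"
  have "g v * ?s v = 1\<^sub>m (rdim (interval_rep a b :: 'k vrep) v)" if v: "v \<in> verts Q" for v
  proof -
    have "g v = (if v \<in> {a..b} then g m * to_sink V v else 0\<^sub>m 0 (rdim V v))"
      using is_hom_carrier[OF g v] gm(2)[of v] by (auto intro!: eq_matI)
    then show ?thesis using row_family_retract[OF ab Y(1) gm(1) _ v] gw Y(2) by simp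
  qed
  then show False using ns g family_hom[OF V ab Y(1)] unfolding split_epi_def by blast
qed

text \<open>With \<open>a\<close> least such that \<open>img V a\<close> is nonzero, and then
  \<open>b\<close> greatest such that \<open>img V b\<close> meets it nontrivially, a common vector
  \<open>w\<close> is outside \<open>img V (a - 1) + img V (b + 1)\<close>. It gives a map from
  \<open>[a, b]\<close>, a separating row gives a map back, and a retract of an indecomposable is
  all of it.\<close>

lemma classification:
  assumes ind: "indecomposable Q V" and Vm: "rdim V m \<noteq> 0"
  obtains a b where "spans a b" "rep_iso Q V (interval_rep a b :: 'k vrep)"
proof -
  let ?z = "0\<^sub>m (rdim V m) 1 :: 'k mat"
  define x :: "'k mat" where "x = mat (rdim V m) 1 (\<lambda>_. 1)"
  have "x $$ (0, 0) = 1" "?z $$ (0, 0) = 0" using Vm by (simp_all add: x_def)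
  then have x: "x \<in> carrier_mat (rdim V m) 1" "x \<noteq> ?z" by (auto simp: x_def)
  define P where "P = (\<lambda>a. \<exists>w \<in> img V a. w \<noteq> ?z)"
  define a where "a = (LEAST a. P a)"
  have "P m" unfolding P_def img_m using x by blast
  then have Pa: "P a" and am: "a \<le> m" and least: "\<And>u. u < a \<Longrightarrow> \<not> P u"
    unfolding a_def by (auto intro: LeastI Least_le dest: not_less_Least)
  have a1: "1 \<le> a" using Pa by (auto simp: P_def img_def Suc_le_eq intro: gr0I)
  define R where "R = (\<lambda>b. m \<le> b \<and> b \<le> n \<and> (\<exists>w \<in> img V a. w \<in> img V b \<and> w \<noteq> ?z))"
  have "R m" using Pa m_le img_m img_carrier by (auto simp: R_def P_def)
  define b where "b = (GREATEST b. R b)"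
  have Rn: "\<And>u. R u \<Longrightarrow> u \<le> n" by (simp add: R_def)
  have Rb: "R b" unfolding b_def by (rule GreatestI_nat[of R, OF \<open>R m\<close> Rn])
  have greatest: "\<And>u. R u \<Longrightarrow> u \<le> b" unfolding b_def by (rule Greatest_le_nat[of R, OF _ Rn])
  have ab: "spans a b" using Rb a1 am by (auto simp: spans_def R_def)
  obtain w where w: "w \<in> img V a" "w \<in> img V b" "w \<noteq> ?z" using Rb by (auto simp: R_def)
  have nd: "w \<noteq> l + r" if l: "l \<in> img V (a - 1)" and r: "r \<in> img V (b + 1)" for l r
  proof
    assume eq: "w = l + r"
    \<comment> \<open>Minimality of \<open>a\<close> makes \<open>img V (a - 1)\<close> zero. So
      \<open>w\<close> would lie in \<open>img V (b + 1)\<close>, against the maximality of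
      \<open>b\<close>, or be zero when \<open>b = n\<close>.\<close>
    have "l = ?z" using least[of "a - 1"] a1 l by (auto simp: P_def)
    then have "w = r" using eq img_carrier[OF r] by simp
    show False
    proof (cases "b + 1 \<le> n")
      case True
      then have "R (b + 1)" using w r \<open>w = r\<close> Rb by (auto simp: R_def)
      then show False using greatest by fastforce
    next
      case False
      then show False using r w \<open>w = r\<close> img_out[of "b + 1" V] by simp
    qed
  qed
  obtain \<Phi> where \<Phi>: "\<Phi> \<in> carrier_mat 1 (rdim V m)" "\<Phi> * w = 1\<^sub>m 1"
    "\<And>w. w \<in> img V (a - 1) \<Longrightarrow> \<Phi> * w = 0\<^sub>m 1 1" "\<And>w. w \<in> img V (b + 1) \<Longrightarrow> \<Phi> * w = 0\<^sub>m 1 1"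
    using separate_two[OF img_carrier[OF w(1)] nd] by blast
  obtain Y where Y: "family V {a..b} Y" "Y m = w" using img_family[OF ab w(1,2)] by blast
  have "\<not> is_zero_rep Q (interval_rep a b :: 'k vrep)"
    using spans_m[OF ab] m_in by (auto simp: is_zero_rep_def verts_Q)
  from retract_of_indecomposable[OF wf_Q ind interval_is_rep this _ family_hom[OF V ab Y(1)] row_hom_img[OF ab \<Phi>(1,3,4)]]
  have "rep_iso Q V (interval_rep a b)"
    using row_family_retract[OF ab Y(1) \<Phi>(1)] \<Phi>(2) Y(2) by simp
  with ab that show ?thesis by blast
qed

end

section \<open>Homomorphisms between intervals, and indecomposability\<close>

lemma interval_nonzero: "spans a b \<Longrightarrow> \<not> is_zero_rep Q (interval_rep a b)"
  using m_in spans_m unfolding is_zero_rep_def verts_Q by (metis rdim_interval zero_neq_one)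

text \<open>Some vertex of \<open>[a, b]\<close> is outside \<open>[a', b']\<close>. Its path to the
  sink is an identity in the source, while what arrives from it must be killed in the
  target.\<close>

lemma hom_intervals_at_sink:
  fixes f :: "nat \<Rightarrow> 'k :: field mat"
  assumes ab: "spans a b" and ab': "spans a' b'" and f: "is_hom Q (interval_rep a b) (interval_rep a' b') f"
    and n: "\<not> (a' \<le> a \<and> b \<le> b')"
  shows "f m = 0\<^sub>m 1 1"
proof -
  obtain v where v: "v \<in> {a..b}" "v \<notin> {a'..b'}"
  proof (cases "a < a'")
    case True
    then show ?thesis using that[of a] ab by (auto simp: spans_def)
  next
    case False
    then show ?thesis using that[of b] n ab by (auto simp: spans_def)
  qed
  then have "v \<in> {1..n} - {a'..b'}" using spans_sub[OF ab] by blast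
  from hom_row(3)[OF interval_is_rep ab' f this]
  have "f m * 1\<^sub>m 1 = 0\<^sub>m 1 1" unfolding to_sink_interval[OF ab v(1)] using v(1) by simp
  moreover have "f m \<in> carrier_mat 1 1" using hom_row(1)[OF interval_is_rep ab' f] spans_m[OF ab] by simp
  ultimately show ?thesis by simp
qed

lemma hom_interval_zero:
  assumes V: "is_rep Q V" and ab: "spans a b" and f: "is_hom Q V (interval_rep a b) f"
    and fm: "f m = 0\<^sub>m 1 (rdim V m)" and v: "v \<in> verts Q"
  shows "f v = 0\<^sub>m (if v \<in> {a..b} then 1 else 0) (rdim V v)"
proof (cases "v \<in> {a..b}")
  case True
  have "v \<in> {1..n}" using v by (simp add: verts_Q)
  then show ?thesis
    using hom_row(2)[OF V ab f True] fm left_mult_zero_mat[OF to_sink_carrier[OF V], of v] True by simp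
next
  case False
  then show ?thesis using is_hom_carrier[OF f v] by (auto intro!: eq_matI)
qed

text \<open>At the sink an endomorphism is a scalar, either zero or invertible. The statement has
  the form of the assumption \<open>endo\<close> in the uniqueness of the left end.\<close>

lemma interval_endo:
  fixes h :: "nat \<Rightarrow> 'k :: field mat"
  assumes ab: "spans a b" and h: "is_hom Q (interval_rep a b) (interval_rep a b) h"
  defines "I \<equiv> interval_rep a b :: 'k vrep"
  shows "(\<forall>v \<in> verts Q. h v = 0\<^sub>m (rdim I v) (rdim I v)) \<or>
    (\<exists>h'. is_hom Q I I h' \<and> (\<forall>v \<in> verts Q. h' v * h v = 1\<^sub>m (rdim I v)))"
proof -
  have I: "is_rep Q I" unfolding I_def by (rule interval_is_rep)
  have h: "is_hom Q I I h" using h by (simp add: I_def)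
  have hI: "is_hom Q I (interval_rep a b) h" using h by (simp add: I_def)
  have dm: "rdim I m = 1" using spans_m[OF ab] by (simp add: I_def)
  have hm: "h m \<in> carrier_mat 1 1" using hom_row(1)[OF I ab hI] dm by simp
  show ?thesis
  proof (cases rule: scalar_mat_cases[OF hm])
    case 1
    then have "h m = 0\<^sub>m 1 (rdim I m)" using dm by simp
    from hom_interval_zero[OF I ab hI this] show ?thesis by (simp add: I_def)
  next
    case (2 c)
    have \<Phi>: "(1 / c) \<cdot>\<^sub>m 1\<^sub>m 1 \<in> carrier_mat 1 (rdim I m)" using dm by simp
    have kill: "(1 / c) \<cdot>\<^sub>m 1\<^sub>m 1 * to_sink I v = 0\<^sub>m 1 (rdim I v)" if v: "v \<in> {1..n} - {a..b}" for v
    proof -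
      have "v \<in> {1..n}" "rdim I v = 0" using v by (auto simp: I_def)
      then show ?thesis using mult_carrier_mat[OF \<Phi> to_sink_carrier[OF I, of v]]
        by (intro eq_mat_zero_col[of _ 1]) auto
    qed
    have h': "is_hom Q I I (\<lambda>v. if v \<in> {a..b} then (1 / c) \<cdot>\<^sub>m 1\<^sub>m 1 * to_sink I v else 0\<^sub>m 0 (rdim I v))"
      using row_hom[OF I ab \<Phi> kill] unfolding I_def .
    have "(if v \<in> {a..b} then (1 / c) \<cdot>\<^sub>m 1\<^sub>m 1 * to_sink I v else 0\<^sub>m 0 (rdim I v)) * h v = 1\<^sub>m (rdim I v)"
      if v: "v \<in> verts Q" for v
    proof (cases "v \<in> {a..b}")
      case True
      have "h v = c \<cdot>\<^sub>m 1\<^sub>m 1"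
        using hom_row(2)[OF I ab hI True] 2 unfolding I_def to_sink_interval[OF ab True] by (auto intro!: eq_matI)
      moreover have "rdim I v = 1" using True by (simp add: I_def)
      moreover have "to_sink I v = 1\<^sub>m 1" unfolding I_def by (rule to_sink_interval[OF ab True])
      ultimately show ?thesis using True 2(1) by (auto intro!: eq_matI simp: scalar_prod_def)
    next
      case False
      then show ?thesis unfolding if_not_P[OF False] using is_hom_carrier[OF h v] by (auto simp: I_def intro!: eq_matI)
    qed
    with h' show ?thesis by blast
  qed
qed

text \<open>Each vertex of the interval belongs to exactly one summand. If the summand changed along
  an arc, the direct sum would have the zero map there, against the identity of the
  interval.\<close>

lemma interval_indecomposable:
  assumes ab: "spans a b"
  shows "indecomposable Q (interval_rep a b :: ('k :: field) vrep)"
  unfolding indecomposable_def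
proof (intro conjI allI impI)
  let ?I = "interval_rep a b :: 'k vrep"
  fix X Y assume XY: "is_rep Q X" "is_rep Q Y" "rep_iso Q ?I (direct_sum [X, Y])"
  have dims: "rdim X v + rdim Y v = (if v \<in> {a..b} then 1 else 0)" if "v \<in> {1..n}" for v
    using rep_iso_rdim[OF wf_Q XY(3), of v] that by (simp add: verts_Q direct_sum_def)
  obtain f g where f: "is_hom Q ?I (direct_sum [X, Y]) f" and
    gf: "\<And>v. v \<in> verts Q \<Longrightarrow> g v * f v = 1\<^sub>m (rdim ?I v)" and g: "is_hom Q (direct_sum [X, Y]) ?I g"
    using XY(3) unfolding rep_iso_def by blast
  have const: "v \<in> {1..n} \<Longrightarrow> v \<in> {a..b} \<longrightarrow> rdim X v = rdim X m" for v
  proof (induction v rule: sink_induct)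
    case (step v)
    show ?case
    proof (intro impI, rule ccontr)
      assume v: "v \<in> {a..b}" and ne: "rdim X v \<noteq> rdim X m"
      have nv: "nx v \<in> {a..b}" "nx v \<in> {1..n}" using spans_nx[OF ab v] nx_in[OF step(1)] .
      have ne: "rdim X v \<noteq> rdim X (nx v)" using ne step(3) nv by simp
      note d = dims[OF step(1)] dims[OF nv(2)]
      have A: "rmap X (v, nx v) \<in> carrier_mat (rdim X (nx v)) (rdim X v)"
        and B: "rmap Y (v, nx v) \<in> carrier_mat (rdim Y (nx v)) (rdim Y v)"
        using XY step(1,2) by (auto simp: is_rep_iff)
      have "rmap (direct_sum [X, Y]) (v, nx v) =
          four_block_mat (rmap X (v, nx v)) (0\<^sub>m (rdim X (nx v)) (rdim Y v)) (0\<^sub>m (rdim Y (nx v)) (rdim X v)) (rmap Y (v, nx v))"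
        using diag_block_mat_pair[OF A B] by (simp add: direct_sum_def del: diag_block_mat.simps)
      also have "\<dots> = 0\<^sub>m 1 1"
      proof -
        have "rdim X v = 0 \<and> rdim Y v = 1 \<and> rdim X (nx v) = 1 \<and> rdim Y (nx v) = 0 \<or>
            rdim X v = 1 \<and> rdim Y v = 0 \<and> rdim X (nx v) = 0 \<and> rdim Y (nx v) = 1"
          using d v nv(1) ne unfolding if_P[OF v] if_P[OF nv(1)] by linarith
        then show ?thesis using A B by (auto intro!: eq_matI)
      qed
      finally have 0: "rmap (direct_sum [X, Y]) (v, nx v) = 0\<^sub>m 1 1" .
      have fc: "f (nx v) \<in> carrier_mat 1 1" "f v \<in> carrier_mat 1 1"
        using is_hom_carrier[OF f, of "nx v"] is_hom_carrier[OF f, of v] d v nv step(1)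
        by (simp_all add: verts_Q direct_sum_def)
      have "f (nx v) * rmap ?I (v, nx v) = rmap (direct_sum [X, Y]) (v, nx v) * f v"
        using f step(1,2) unfolding is_hom_iff by blast
      then have "f (nx v) = 0\<^sub>m 1 1"
        unfolding 0 rmap_interval[OF v nv(1)] using fc by simp
      moreover have "g (nx v) \<in> carrier_mat 1 1"
        using is_hom_carrier[OF g, of "nx v"] d nv by (simp add: verts_Q direct_sum_def)
      ultimately have "g (nx v) * f (nx v) = 0\<^sub>m 1 1" by simp
      then show False using gf[of "nx v"] nv one_mat_neq_zero[of 1, where 'k = 'k] by (simp add: verts_Q)
    qed
  qed simp
  show "is_zero_rep Q X \<or> is_zero_rep Q Y"
  proof (cases "rdim X m = 0")
    case True
    then have "rdim X v = 0" if "v \<in> {1..n}" for v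
      using const[of v] dims[of v] that by (cases "v \<in> {a..b}") auto
    then show ?thesis by (simp add: is_zero_rep_def verts_Q)
  next
    case False
    then have "rdim Y v = 0" if "v \<in> {1..n}" for v
      using const[of v] dims[of v] that by (cases "v \<in> {a..b}") auto
    then show ?thesis by (simp add: is_zero_rep_def verts_Q)
  qed
qed (use interval_is_rep interval_nonzero[OF ab] in auto)

section \<open>Irreducible maps between intervals\<close>

lemma ar_arrow_intervals:
  assumes ab: "spans a b" and ab': "spans a' b'"
    and arrow: "ar_arrow Q (iso_class Q (interval_rep a b :: ('k :: field) vrep)) (iso_class Q (interval_rep a' b'))"
  shows "a' \<le> a \<and> b \<le> b' \<and> (a, b) \<noteq> (a', b')"
proof -
  let ?I = "interval_rep a b :: 'k vrep" and ?I' = "interval_rep a' b' :: 'k vrep"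
  obtain V W f where V: "is_rep Q V" "rep_iso Q ?I V" and W: "is_rep Q W" "rep_iso Q ?I' W"
    and f: "irreducible_hom Q V W f"
    using arrow unfolding ar_arrow_def iso_class_def by blast
  have fh: "is_hom Q V W f" using f by (simp add: irreducible_hom_def)
  obtain p p' where p: "is_hom Q ?I V p" "is_hom Q V ?I p'"
    "\<And>v. v \<in> verts Q \<Longrightarrow> p v * p' v = 1\<^sub>m (rdim V v)"
    using V(2) unfolding rep_iso_def by blast
  obtain q q' where q: "is_hom Q ?I' W q" "is_hom Q W ?I' q'"
    "\<And>v. v \<in> verts Q \<Longrightarrow> q v * q' v = 1\<^sub>m (rdim W v)"
    using W(2) unfolding rep_iso_def by blast
  let ?F = "\<lambda>v. q' v * (f v * p v)"
  note I = interval_is_rep[of a b, where 'a = 'k] and I' = interval_is_rep[of a' b', where 'a = 'k]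
  have F: "is_hom Q ?I ?I' ?F"
    by (rule is_hom_comp[OF wf_Q I W(1) I' is_hom_comp[OF wf_Q I V(1) W(1) p(1) fh] q(2)])
  have nz: "\<not> (\<forall>v \<in> verts Q. ?F v = 0\<^sub>m (rdim ?I' v) (rdim ?I v))"
  proof
    assume 0: "\<forall>v \<in> verts Q. ?F v = 0\<^sub>m (rdim ?I' v) (rdim ?I v)"
    have "f v = 0\<^sub>m (rdim W v) (rdim V v)" if v: "v \<in> verts Q" for v
    proof -
      note c = is_hom_carrier[OF fh v] is_hom_carrier[OF p(1) v] is_hom_carrier[OF p(2) v]
        is_hom_carrier[OF q(1) v] is_hom_carrier[OF q(2) v]
      note d = c[THEN carrier_matD(1)] c[THEN carrier_matD(2)]
      have "f v = (q v * q' v) * f v * (p v * p' v)" using c(1) p(3)[OF v] q(3)[OF v] by simp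
      also have "\<dots> = q v * ?F v * p' v" using d by (simp add: mult_assoc_dim)
      also have "\<dots> = 0\<^sub>m (rdim W v) (rdim V v)"
        unfolding bspec[OF 0 v] right_mult_zero_mat[OF c(4)] by (rule left_mult_zero_mat[OF c(3)])
      finally show ?thesis .
    qed
    moreover have "\<not> is_zero_rep Q V" "\<not> is_zero_rep Q W"
      using interval_nonzero[OF ab] interval_nonzero[OF ab'] is_zero_rep_iso[OF wf_Q V(2)] is_zero_rep_iso[OF wf_Q W(2)]
      by blast+
    ultimately show False using irreducible_hom_nonzero[OF wf_Q V(1) W(1) f] by blast
  qed
  have "a' \<le> a \<and> b \<le> b'"
  proof (rule ccontr)
    assume "\<not> (a' \<le> a \<and> b \<le> b')"
    from hom_intervals_at_sink[OF ab ab' F this]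
    have "?F m = 0\<^sub>m 1 (rdim ?I m)" using spans_m[OF ab] by simp
    from hom_interval_zero[OF I ab' F this] show False using nz by simp
  qed
  moreover have "(a, b) \<noteq> (a', b')"
  proof
    assume eq: "(a, b) = (a', b')"
    \<comment> \<open>A nonzero endomorphism of an interval is invertible, which would make
      \<open>f\<close> a split mono.\<close>
    then obtain h' where h': "is_hom Q ?I ?I h'" "\<And>v. v \<in> verts Q \<Longrightarrow> h' v * ?F v = 1\<^sub>m (rdim ?I v)"
      using interval_endo[OF ab, of ?F] F nz by auto
    let ?k = "\<lambda>v. p v * (h' v * q' v)"
    have q'': "is_hom Q W ?I q'" using q(2) eq by simp
    have "is_hom Q W V ?k"
      by (rule is_hom_comp[OF wf_Q W(1) I V(1) is_hom_comp[OF wf_Q W(1) I I q'' h'(1)] p(1)])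
    moreover have "?k v * f v = 1\<^sub>m (rdim V v)" if v: "v \<in> verts Q" for v
    proof -
      note c = is_hom_carrier[OF fh v] is_hom_carrier[OF p(1) v] is_hom_carrier[OF p(2) v]
        is_hom_carrier[OF h'(1) v] is_hom_carrier[OF q'' v]
      note d = c[THEN carrier_matD(1)] c[THEN carrier_matD(2)]
      have "?k v * f v = ?k v * f v * (p v * p' v)" using c p(3)[OF v] by simp
      also have "\<dots> = p v * (h' v * ?F v) * p' v" using d by (simp add: mult_assoc_dim)
      also have "\<dots> = 1\<^sub>m (rdim V v)" unfolding h'(2)[OF v] using c p(3)[OF v] by simp
      finally show ?thesis .
    qed
    ultimately have "split_mono Q V W f" unfolding split_mono_def using fh by blast
    then show False using f by (simp add: irreducible_hom_def)
  qed
  ultimately show ?thesis by simp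
qed

text \<open>Off \<open>[a, b]\<close> the source is zero and the matrix has no columns; only its
  number of rows depends on the target.\<close>

definition incl :: "nat \<Rightarrow> nat \<Rightarrow> nat \<Rightarrow> nat \<Rightarrow> nat \<Rightarrow> 'k :: field mat" where
  "incl a b a' b' v = (if v \<in> {a..b} then 1\<^sub>m 1 else 0\<^sub>m (if v \<in> {a'..b'} then 1 else 0) 0)"

lemma incl_hom:
  assumes ab: "spans a b" and ab': "spans a' b'" and le: "a' \<le> a" "b \<le> b'"
  shows "is_hom Q (interval_rep a b) (interval_rep a' b') (incl a b a' b')"
proof -
  have "family (interval_rep a' b') {a..b} (\<lambda>_. 1\<^sub>m 1)"
    unfolding family_def
  proof (intro conjI ballI)
    fix v assume "v \<in> {a..b} - {m}"
    then have "v \<in> {a'..b'}" "nx v \<in> {a'..b'}" using le spans_nx[OF ab'] by auto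
    then show "rmap (interval_rep a' b') (v, nx v) * 1\<^sub>m 1 = 1\<^sub>m 1" by (simp add: rmap_interval del: atLeastAtMost_iff)
  qed (use le in auto)
  from family_hom[OF interval_is_rep ab this] show ?thesis unfolding incl_def[abs_def] rdim_interval .
qed

lemma incl_m: "spans a b \<Longrightarrow> incl a b a' b' m = 1\<^sub>m 1"
  using spans_m by (auto simp: incl_def)

text \<open>If neither factor of \<open>g h\<close> splits, \<open>h m = l + r\<close> with
  \<open>l\<close> and \<open>r\<close> arriving from just outside \<open>[a, b]\<close>. At the end
  that is not enlarged, the vector comes from outside the target too and is killed by
  \<open>g\<close>. The other one lies in both images attached to the target, where a non-split
  \<open>g\<close> vanishes. So \<open>g m * h m\<close> would be 0 instead of 1.\<close>

lemma irreducible_incl: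
  assumes ab: "spans a b" and step: "1 < a \<and> a' = a - 1 \<and> b' = b \<or> b < n \<and> a' = a \<and> b' = b + 1"
  shows "irreducible_hom Q (interval_rep a b) (interval_rep a' b') (incl a b a' b' :: nat \<Rightarrow> 'k :: field mat)"
  unfolding irreducible_hom_def
proof (intro conjI allI impI)
  let ?I = "interval_rep a b :: 'k vrep" and ?I' = "interval_rep a' b' :: 'k vrep"
  let ?i = "incl a b a' b' :: nat \<Rightarrow> 'k mat"
  have ab': "spans a' b'" and le: "a' \<le> a" "b \<le> b'" and nle: "\<not> (a \<le> a' \<and> b' \<le> b)"
    using ab step by (auto simp: spans_def)
  show i: "is_hom Q ?I ?I' ?i" by (rule incl_hom[OF ab ab' le])
  have g0: "g m = 0\<^sub>m 1 1" if "is_hom Q ?I' ?I g" for g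
    by (rule hom_intervals_at_sink[OF ab' ab that nle])
  have mv: "m \<in> verts Q" using m_in by (simp add: verts_Q)
  have ne: "1\<^sub>m 1 \<noteq> (0\<^sub>m 1 1 :: 'k mat)" by (rule one_mat_neq_zero) simp
  show "\<not> split_mono Q ?I ?I' ?i"
  proof
    assume "split_mono Q ?I ?I' ?i"
    then obtain g where g: "is_hom Q ?I' ?I g" "g m * ?i m = 1\<^sub>m (rdim ?I m)"
      unfolding split_mono_def using mv by blast
    then show False using g0[OF g(1)] ne spans_m[OF ab] incl_m[OF ab, of a' b', where 'a = 'k] by simp
  qed
  show "\<not> split_epi Q ?I ?I' ?i"
  proof
    assume "split_epi Q ?I ?I' ?i"
    then obtain g where g: "is_hom Q ?I' ?I g" "?i m * g m = 1\<^sub>m (rdim ?I' m)"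
      unfolding split_epi_def using mv by blast
    then show False using g0[OF g(1)] ne spans_m[OF ab'] incl_m[OF ab, of a' b', where 'a = 'k] by simp
  qed
  fix Z h g assume Z: "is_rep Q Z" and h: "is_hom Q ?I Z h" and g: "is_hom Q Z ?I' g"
    and fact: "\<forall>v \<in> verts Q. ?i v = g v * h v"
  show "split_mono Q ?I Z h \<or> split_epi Q Z ?I' g"
  proof (rule ccontr)
    assume no: "\<not> ?thesis"
    obtain l r where l: "l \<in> img Z (a - 1)" and r: "r \<in> img Z (b + 1)" and hm: "h m = l + r"
      using not_split_mono_decompose[OF Z ab h] no by blast
    note c = img_carrier[OF Z l] img_carrier[OF Z r] hom_row(1)[OF Z ab' g]
    have hmimg: "h m \<in> img Z v" if "v \<in> {a..b}" for v
      using family_in_img[OF Z ab hom_family[OF ab h] that] .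
    have sum: "g m * l + g m * r = 1\<^sub>m 1"
      using bspec[OF fact mv] mult_add_distrib_mat[OF c(3,1,2)] hm unfolding incl_m[OF ab] by simp
    have sub: "l = h m - r" "r = h m - l" unfolding hm using c by (auto intro!: eq_matI)
    have "g m * l = 0\<^sub>m 1 1 \<and> g m * r = 0\<^sub>m 1 1"
    proof (cases "a' = a")
      case False
      then have s: "1 < a" "a' = a - 1" "b' = b" using step by auto
      \<comment> \<open>\<open>h m\<close> is in \<open>img Z b\<close>, and so is \<open>r\<close>
        by the flag property; hence also their difference \<open>l\<close>.\<close>
      have "r \<in> img Z b" using img_mono(2)[OF Z, of b "b + 1"] ab r by (auto simp: spans_def)
      then have "l \<in> img Z b"
        unfolding sub(1) using hmimg[of b] ab by (intro img_closed(2)[OF Z]) (auto simp: spans_def)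
      then have "g m * l = 0\<^sub>m 1 1"
        using not_split_epi_vanish[OF Z ab' g] no l s by blast
      moreover have "g m * r = 0\<^sub>m 1 1" by (rule hom_row_img[OF Z ab' g _ r]) (use s in simp)
      ultimately show ?thesis ..
    next
      case True
      then have s: "b < n" "a' = a" "b' = b + 1" using step by auto
      have "l \<in> img Z a" using img_mono(1)[OF Z, of "a - 1" a] ab l by (auto simp: spans_def)
      then have "r \<in> img Z a"
        unfolding sub(2) using hmimg[of a] ab by (intro img_closed(2)[OF Z]) (auto simp: spans_def)
      then have "g m * r = 0\<^sub>m 1 1"
        using not_split_epi_vanish[OF Z ab' g] no r s by blast
      moreover have "g m * l = 0\<^sub>m 1 1"
        by (rule hom_row_img[OF Z ab' g _ l]) (use s ab in \<open>auto simp: spans_def\<close>)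
      ultimately show ?thesis by simp
    qed
    then show False using sum ne by simp
  qed
qed

section \<open>Almost split sequences ending in an interval\<close>

lemma no_short_exact_to_projective:
  fixes R :: "('k :: field) vrep"
  assumes ab: "spans a b" and proj: "a = m \<or> b = m" and reps: "is_rep Q E" "is_rep Q R"
    and iso: "rep_iso Q (interval_rep a b) R" and ex: "short_exact Q L f E g R"
  shows "split_epi Q E R g"
proof -
  let ?I = "interval_rep a b :: 'k vrep"
  have I: "is_rep Q ?I" by (rule interval_is_rep)
  obtain p p' where p: "is_hom Q ?I R p" "is_hom Q R ?I p'"
    "\<And>v. v \<in> verts Q \<Longrightarrow> p' v * p v = 1\<^sub>m (rdim ?I v)" "\<And>v. v \<in> verts Q \<Longrightarrow> p v * p' v = 1\<^sub>m (rdim R v)"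
    using iso unfolding rep_iso_def by blast
  have g: "is_hom Q E R g" using ex by (simp add: short_exact_def)
  let ?u = "\<lambda>v. p' v * g v"
  have u: "is_hom Q E ?I ?u" by (rule is_hom_comp[OF wf_Q reps I g p(2)])
  \<comment> \<open>An interval with the sink at one end is a path starting at \<open>v0\<close> and
    is generated by its vector there: it is the indecomposable projective of \<open>v0\<close>. A
    preimage under \<open>g\<close> at \<open>v0\<close> is pushed along the path to give a
    section.\<close>
  define v0 where "v0 = (if b = m then a else b)"
  have v0: "v0 \<in> {a..b}" "v0 \<in> {1..n}" "v0 \<in> verts Q" "{min v0 m..max v0 m} = {a..b}"
    using ab proj by (auto simp: v0_def spans_def verts_Q)
  obtain s where s: "s \<in> carrier_mat (rdim E v0) (rdim R v0)" "g v0 * s = 1\<^sub>m (rdim R v0)"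
    using short_exact_right_inverse[OF ex v0(3)] .
  have d0: "rdim ?I v0 = 1" using v0(1) by simp
  have pc: "p v0 \<in> carrier_mat (rdim R v0) 1" "p' v0 \<in> carrier_mat 1 (rdim R v0)"
    "g v0 \<in> carrier_mat (rdim R v0) (rdim E v0)"
    using is_hom_carrier[OF p(1) v0(3)] is_hom_carrier[OF p(2) v0(3)] is_hom_carrier[OF g v0(3)] d0 by simp_all
  have x: "s * p v0 \<in> carrier_mat (rdim E v0) 1" using s pc by simp
  have ux: "?u v0 * (s * p v0) = 1\<^sub>m 1"
  proof -
    have "?u v0 * (s * p v0) = p' v0 * (g v0 * s * p v0)" using s(1) pc by (simp add: mult_assoc_dim)
    then show ?thesis using s(2) pc p(3)[OF v0(3)] d0 by simp
  qed
  obtain Y where Y: "family E {a..b} Y" "Y v0 = s * p v0"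
    using family_extend[OF reps(1) v0(2) x] v0(4) by auto
  have "?u m * Y m = ?u m * to_sink E v0 * (s * p v0)"
    using family_to_sink[OF reps(1) ab Y(1) v0(1)] Y(2)
      assoc_mult_mat[OF hom_row(1)[OF reps(1) ab u] to_sink_carrier[OF reps(1) v0(2)] x] by simp
  then have uY: "?u m * Y m = 1\<^sub>m 1" using hom_row(2)[OF reps(1) ab u v0(1)] ux by simp
  let ?s = "\<lambda>v. if v \<in> {a..b} then Y v else 0\<^sub>m (rdim E v) 0"
  have "?u v * ?s v = 1\<^sub>m (rdim ?I v)" if v: "v \<in> verts Q" for v
  proof -
    have "?u v = (if v \<in> {a..b} then ?u m * to_sink E v else 0\<^sub>m 0 (rdim E v))"
    proof (cases "v \<in> {a..b}")
      case True
      then show ?thesis using hom_row(2)[OF reps(1) ab u True] by simp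
    next
      case False
      then show ?thesis using is_hom_carrier[OF u v] unfolding if_not_P[OF False]
        by (intro eq_mat_zero_row[of _ "rdim E v"]) auto
    qed
    then show ?thesis using row_family_retract[OF reps(1) ab Y(1) hom_row(1)[OF reps(1) ab u] uY v] by simp
  qed
  then have "split_epi Q E ?I ?u"
    unfolding split_epi_def using u family_hom[OF reps(1) ab Y(1)] by blast
  then show ?thesis using split_epi_comp_iso[OF wf_Q reps I g p(2,1)] p(4) by blast
qed

lemma family_add:
  assumes V: "is_rep Q V" and S: "S \<subseteq> {1..n}" and "family V S Y" "family V S Y'"
  shows "family V S (\<lambda>v. Y v + Y' v)"
  unfolding family_def
proof (intro conjI ballI)
  fix v assume v: "v \<in> S - {m}"
  have "rmap V (v, nx v) \<in> carrier_mat (rdim V (nx v)) (rdim V v)" using V S v by (auto simp: is_rep_iff)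
  then show "rmap V (v, nx v) * (Y v + Y' v) = Y (nx v) + Y' (nx v)"
    using v assms(3,4) by (auto simp: family_def mult_add_distrib_mat)
qed (use assms(3,4) in \<open>auto simp: family_def\<close>)

lemma hom_interval_eq:
  assumes V: "is_rep Q V" and ab: "spans a b" and f: "is_hom Q V (interval_rep a b) f"
    and g: "is_hom Q V (interval_rep a b) g" and m: "f m = g m" and v: "v \<in> verts Q"
  shows "f v = g v"
proof (cases "v \<in> {a..b}")
  case True
  then show ?thesis using hom_row(2)[OF V ab f True] hom_row(2)[OF V ab g True] m by simp
next
  case False
  then show ?thesis
    using is_hom_carrier[OF f v] is_hom_carrier[OF g v] by (intro eq_mat_zero_row[of _ "rdim V v"]) auto
qed

text \<open>Prescribing \<open>\<phi>\<close> on \<open>img V a\<close> and 0 on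
  \<open>img V b\<close> is consistent, as \<open>\<phi>\<close> vanishes on the intersection. The
  extension comes from separation: a vector \<open>l0\<close> with value 1 is separated from
  \<open>W\<close>, the sum of \<open>img V b\<close> and the kernel of \<open>\<phi>\<close> in
  \<open>img V a\<close>.\<close>

lemma row_extension:
  fixes V :: "('k :: field) vrep"
  assumes V: "is_rep Q V" and \<phi>: "\<phi> \<in> carrier_mat 1 (rdim V m)"
    and 0: "\<And>w. w \<in> img V a \<Longrightarrow> w \<in> img V b \<Longrightarrow> \<phi> * w = 0\<^sub>m 1 1"
  shows "\<exists>\<Phi> \<in> carrier_mat 1 (rdim V m). (\<forall>w \<in> img V a. \<Phi> * w = \<phi> * w) \<and> (\<forall>w \<in> img V b. \<Phi> * w = 0\<^sub>m 1 1)"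
proof (cases "\<forall>w \<in> img V a. \<phi> * w = 0\<^sub>m 1 1")
  case True
  then show ?thesis
    using img_carrier[OF V] by (intro bexI[of _ "0\<^sub>m 1 (rdim V m)"]) (auto simp: left_mult_zero_mat)
next
  case False
  note c = img_carrier[OF V]
  obtain l where l: "l \<in> img V a" "\<phi> * l \<noteq> 0\<^sub>m 1 1" using False by blast
  obtain k where k: "k \<noteq> 0" "\<phi> * l = k \<cdot>\<^sub>m 1\<^sub>m 1"
    by (rule scalar_mat_cases[OF mult_carrier_mat[OF \<phi> c[OF l(1)]]]) (use l(2) in simp, blast)
  define l0 where "l0 = (1 / k) \<cdot>\<^sub>m l"
  have l0: "l0 \<in> img V a" unfolding l0_def by (rule img_closed(3)[OF V l(1,1)])
  have \<phi>l0: "\<phi> * l0 = 1\<^sub>m 1"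
    unfolding l0_def using mult_smult_distrib[OF \<phi> c[OF l(1)], of "1 / k"] k by (auto intro!: eq_matI)
  define W where "W = {x + r | x r. x \<in> img V a \<and> \<phi> * x = 0\<^sub>m 1 1 \<and> r \<in> img V b}"
  have WI: "x + r \<in> W" if "x \<in> img V a" "\<phi> * x = 0\<^sub>m 1 1" "r \<in> img V b" for x r
    using that by (auto simp: W_def)
  have WE: "\<exists>x r. x \<in> img V a \<and> \<phi> * x = 0\<^sub>m 1 1 \<and> r \<in> img V b \<and> w = x + r" if "w \<in> W" for w
    using that by (auto simp: W_def)
  have z: "0\<^sub>m (rdim V m) 1 \<in> img V u" for u by (rule img_zero[OF V])
  have \<phi>z: "\<phi> * 0\<^sub>m (rdim V m) 1 = 0\<^sub>m 1 1" using \<phi> by simp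
  have "\<exists>\<Phi> \<in> carrier_mat 1 (rdim V m). \<Phi> * l0 = 1\<^sub>m 1 \<and> (\<forall>w \<in> W. \<Phi> * w = 0\<^sub>m 1 1)"
  proof (rule separating_row)
    show "W \<subseteq> carrier_mat (rdim V m) 1" using c WE by fastforce
    show "0\<^sub>m (rdim V m) 1 \<in> W" using WI[OF z \<phi>z z] by simp
    show "l0 \<in> carrier_mat (rdim V m) 1" by (rule c[OF l0])
    show "l0 \<notin> W"
    proof
      assume "l0 \<in> W"
      then obtain x r where xr: "x \<in> img V a" "\<phi> * x = 0\<^sub>m 1 1" "r \<in> img V b" "l0 = x + r" using WE by blast
      have "r = l0 - x" using xr(4) c[OF xr(1)] c[OF xr(3)] by (auto intro!: eq_matI)
      then have "r \<in> img V a" using img_closed(2)[OF V l0 xr(1)] by simp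
      then have "\<phi> * r = 0\<^sub>m 1 1" using 0 xr(3) by blast
      then have "\<phi> * l0 = 0\<^sub>m 1 1"
        using mult_add_distrib_mat[OF \<phi> c[OF xr(1)] c[OF xr(3)]] xr(2,4) by simp
      then show False using \<phi>l0 one_mat_neq_zero[of 1, where 'k = 'k] by simp
    qed
  next
    fix u v assume "u \<in> W" "v \<in> W"
    then obtain x r x' r' where xr: "x \<in> img V a" "\<phi> * x = 0\<^sub>m 1 1" "r \<in> img V b" "u = x + r"
      "x' \<in> img V a" "\<phi> * x' = 0\<^sub>m 1 1" "r' \<in> img V b" "v = x' + r'" using WE by metis
    have "u + v = (x + x') + (r + r')"
      using c[OF xr(1)] c[OF xr(3)] c[OF xr(5)] c[OF xr(7)] xr(4,8) by (intro eq_matI) auto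
    moreover have "\<phi> * (x + x') = 0\<^sub>m 1 1"
      using mult_add_distrib_mat[OF \<phi> c[OF xr(1)] c[OF xr(5)]] xr by simp
    ultimately show "u + v \<in> W"
      using WI[OF img_closed(1)[OF V xr(1,5)] _ img_closed(1)[OF V xr(3,7)]] by simp
  next
    fix s u assume "u \<in> W"
    then obtain x r where xr: "x \<in> img V a" "\<phi> * x = 0\<^sub>m 1 1" "r \<in> img V b" "u = x + r" using WE by blast
    have "s \<cdot>\<^sub>m u = s \<cdot>\<^sub>m x + s \<cdot>\<^sub>m r"
      using c[OF xr(1)] c[OF xr(3)] xr(4) by (intro eq_matI) (auto simp: algebra_simps)
    moreover have "\<phi> * (s \<cdot>\<^sub>m x) = 0\<^sub>m 1 1"
      using mult_smult_distrib[OF \<phi> c[OF xr(1)]] xr(2) by (auto intro!: eq_matI)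
    ultimately show "s \<cdot>\<^sub>m u \<in> W"
      using WI[OF img_closed(3)[OF V xr(1,1)] _ img_closed(3)[OF V xr(3,3)]] by simp
  qed
  then obtain \<Phi> where \<Phi>: "\<Phi> \<in> carrier_mat 1 (rdim V m)" "\<Phi> * l0 = 1\<^sub>m 1" "\<forall>w \<in> W. \<Phi> * w = 0\<^sub>m 1 1" by blast
  have "\<Phi> * w = \<phi> * w" if w: "w \<in> img V a" for w
  proof -
    have wc: "\<phi> * w \<in> carrier_mat 1 1" using \<phi> c[OF w] by simp
    define s where "s = (\<phi> * w) $$ (0, 0)"
    have s: "\<phi> * w = s \<cdot>\<^sub>m 1\<^sub>m 1" using wc by (intro eq_matI) (auto simp: s_def)
    \<comment> \<open>Subtracting the right multiple of \<open>l0\<close> moves \<open>w\<close>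
      into the kernel of \<open>\<phi>\<close>, hence into \<open>W\<close>.\<close>
    let ?x = "w - s \<cdot>\<^sub>m l0"
    have x: "?x \<in> img V a" by (rule img_closed(2)[OF V w img_closed(3)[OF V l0 l0]])
    note sc = smult_carrier_mat[OF c[OF l0], of s]
    have "\<phi> * ?x = 0\<^sub>m 1 1"
      using mult_minus_distrib_mat[OF \<phi> c[OF w] sc] mult_smult_distrib[OF \<phi> c[OF l0], of s] s \<phi>l0
      by (auto intro!: eq_matI)
    from WI[OF x this z] have "?x \<in> W" using c[OF x] by simp
    then have "\<Phi> * w - \<Phi> * (s \<cdot>\<^sub>m l0) = 0\<^sub>m 1 1"
      using \<Phi>(3) mult_minus_distrib_mat[OF \<Phi>(1) c[OF w] sc] by simp
    then have eq: "\<Phi> * w - s \<cdot>\<^sub>m 1\<^sub>m 1 = 0\<^sub>m 1 1"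
      using mult_smult_distrib[OF \<Phi>(1) c[OF l0], of s] \<Phi>(2) by simp
    have "\<Phi> * w = s \<cdot>\<^sub>m 1\<^sub>m 1"
    proof (rule eq_matI)
      fix i j assume "i < dim_row (s \<cdot>\<^sub>m 1\<^sub>m 1)" "j < dim_col (s \<cdot>\<^sub>m 1\<^sub>m 1)"
      then show "(\<Phi> * w) $$ (i, j) = (s \<cdot>\<^sub>m 1\<^sub>m 1) $$ (i, j)"
        using arg_cong[OF eq, of "\<lambda>A. A $$ (0, 0)"] mult_carrier_mat[OF \<Phi>(1) c[OF w]] by auto
    qed (use mult_carrier_mat[OF \<Phi>(1) c[OF w]] in auto)
    then show ?thesis using s by simp
  qed
  moreover have "\<Phi> * w = 0\<^sub>m 1 1" if w: "w \<in> img V b" for w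
    using WI[OF z \<phi>z w] \<Phi>(3) c[OF w] by simp
  ultimately show ?thesis using \<Phi>(1) by blast
qed

text \<open>The middle term is the direct sum of \<open>[a - 1, b]\<close> and
  \<open>[a, b + 1]\<close>, and the maps are inclusions with one sign. The almost split properties
  are the two splitting criteria: \<open>h m = l + r\<close> distributes a map from
  \<open>[a, b]\<close> over the middle terms, and vanishing on an intersection lets a row be split
  in two.\<close>

lemma almost_split_intervals:
  assumes ab: "spans a b" and a: "1 < a" and b: "b < n"
  shows "\<exists>(E :: ('k :: field) vrep) f g. is_rep Q E \<and>
    almost_split_sequence Q (interval_rep a b) f E g (interval_rep (a - 1) (b + 1))"
proof -
  define K X Y R where "K = (interval_rep a b :: 'k vrep)"
    and "X = (interval_rep (a - 1) b :: 'k vrep)"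
    and "Y = (interval_rep a (b + 1) :: 'k vrep)"
    and "R = (interval_rep (a - 1) (b + 1) :: 'k vrep)"
  note defs = K_def X_def Y_def R_def
  have sp: "spans (a - 1) b" "spans a (b + 1)" "spans (a - 1) (b + 1)" using ab a b by (auto simp: spans_def)
  have reps: "is_rep Q K" "is_rep Q X" "is_rep Q Y" "is_rep Q R" unfolding defs by (rule interval_is_rep)+
  define E where "E = direct_sum [X, Y]"
  have E: "is_rep Q E" unfolding E_def by (rule is_rep_direct_sum2[OF wf_Q reps(2,3)])
  obtain i1 i2 p1 p2 where bi:
    "is_hom Q X E i1" "is_hom Q Y E i2" "is_hom Q E X p1" "is_hom Q E Y p2"
    "\<And>v. p1 v * i1 v = 1\<^sub>m (rdim X v)" "\<And>v. p2 v * i2 v = 1\<^sub>m (rdim Y v)"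
    "\<And>v. p1 v * i2 v = 0\<^sub>m (rdim X v) (rdim Y v)" "\<And>v. p2 v * i1 v = 0\<^sub>m (rdim Y v) (rdim X v)"
    "\<And>v. i1 v * p1 v + i2 v * p2 v = 1\<^sub>m (rdim X v + rdim Y v)"
    unfolding E_def using direct_sum_biproduct[OF wf_Q reps(2,3)] by metis
  define x1 x2 y1 y2 :: "nat \<Rightarrow> 'k mat" where "x1 = incl a b (a - 1) b" and "x2 = incl a b a (b + 1)"
    and "y1 = incl (a - 1) b (a - 1) (b + 1)" and "y2 = incl a (b + 1) (a - 1) (b + 1)"
  have xy: "is_hom Q K X x1" "is_hom Q K Y x2" "is_hom Q X R y1" "is_hom Q Y R y2"
    unfolding defs x1_def x2_def y1_def y2_def by (rule incl_hom; use ab sp in simp)+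
  have m1: "x1 m = 1\<^sub>m 1" "x2 m = 1\<^sub>m 1" "y1 m = 1\<^sub>m 1" "y2 m = 1\<^sub>m 1"
    unfolding x1_def x2_def y1_def y2_def by (rule incl_m; use ab sp in simp)+
  have mv: "m \<in> verts Q" using m_in by (simp add: verts_Q)
  have dm: "rdim K m = 1" "rdim X m = 1" "rdim Y m = 1" "rdim R m = 1"
    using spans_m[OF ab] spans_m[OF sp(1)] spans_m[OF sp(2)] spans_m[OF sp(3)] unfolding defs by simp_all
  \<comment> \<open>The sign makes the two composites from \<open>K\<close> to \<open>R\<close>
    cancel.\<close>
  define f where "f = (\<lambda>v. i1 v * x1 v - i2 v * x2 v)"
  define g where "g = (\<lambda>v. y1 v * p1 v + y2 v * p2 v)"
  have f: "is_hom Q K E f" unfolding f_def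
    by (rule is_hom_minus[OF wf_Q reps(1) E is_hom_comp[OF wf_Q reps(1,2) E xy(1) bi(1)] is_hom_comp[OF wf_Q reps(1,3) E xy(2) bi(2)]])
  have g: "is_hom Q E R g" unfolding g_def
    by (rule is_hom_add[OF wf_Q E reps(4) is_hom_comp[OF wf_Q E reps(2,4) bi(3) xy(3)] is_hom_comp[OF wf_Q E reps(3,4) bi(4) xy(4)]])
  note cc = is_hom_carrier[OF bi(1)] is_hom_carrier[OF bi(2)] is_hom_carrier[OF bi(3)] is_hom_carrier[OF bi(4)]
    is_hom_carrier[OF xy(1)] is_hom_carrier[OF xy(2)] is_hom_carrier[OF xy(3)] is_hom_carrier[OF xy(4)]
  note dd = cc[THEN carrier_matD(1)] cc[THEN carrier_matD(2)]
  have pf: "p1 v * f v = x1 v" "p2 v * f v = 0\<^sub>m (rdim Y v) (rdim K v) - x2 v" if v: "v \<in> verts Q" for v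
  proof -
    have "p1 v * f v = p1 v * i1 v * x1 v - p1 v * i2 v * x2 v"
      "p2 v * f v = p2 v * i1 v * x1 v - p2 v * i2 v * x2 v"
      unfolding f_def using dd[OF v] by (simp_all add: mult_minus_distrib_dim mult_assoc_dim)
    then show "p1 v * f v = x1 v" "p2 v * f v = 0\<^sub>m (rdim Y v) (rdim K v) - x2 v"
      using cc[OF v] unfolding bi(5-8) by (simp_all add: minus_zero_mat[of "x1 v" "rdim X v"])
  qed
  have gi: "g v * i1 v = y1 v" "g v * i2 v = y2 v" if v: "v \<in> verts Q" for v
  proof -
    have "g v * i1 v = y1 v * (p1 v * i1 v) + y2 v * (p2 v * i1 v)"
      "g v * i2 v = y1 v * (p1 v * i2 v) + y2 v * (p2 v * i2 v)"
      unfolding g_def using dd[OF v] by (simp_all add: add_mult_distrib_dim mult_assoc_dim)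
    then show "g v * i1 v = y1 v" "g v * i2 v = y2 v"
      using cc[OF v] unfolding bi(5-8) by simp_all
  qed
  have gf: "g v * f v = 0\<^sub>m (rdim R v) (rdim K v)" if v: "v \<in> verts Q" for v
  proof -
    have "g m * f m = g m * i1 m * x1 m - g m * i2 m * x2 m"
      unfolding f_def using dd[OF mv] is_hom_carrier[OF g mv]
      by (simp add: mult_minus_distrib_dim mult_assoc_dim)
    also have "\<dots> = 0\<^sub>m 1 (rdim K m)"
      unfolding gi[OF mv] m1 dm by (auto intro!: eq_matI)
    finally have "g m * f m = 0\<^sub>m 1 (rdim K m)" .
    from hom_interval_zero[OF reps(1) sp(3), of "\<lambda>v. g v * f v", folded R_def, OF is_hom_comp[OF wf_Q reps(1) E reps(4) f g] this v]
    show ?thesis by (simp add: R_def)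
  qed
  have dE: "rdim E v = rdim X v + rdim Y v" for v by (simp add: E_def direct_sum_def)
  have ex: "short_exact Q K f E g R"
  proof (rule short_exactI[OF f g])
    fix v assume v: "v \<in> verts Q"
    note c = cc[OF v] is_hom_carrier[OF f v] is_hom_carrier[OF g v]
    note d = c[THEN carrier_matD(1)] c[THEN carrier_matD(2)]
    have "\<exists>s t. s \<in> carrier_mat (rdim K v) (rdim E v) \<and> t \<in> carrier_mat (rdim E v) (rdim R v) \<and>
      s * f v = 1\<^sub>m (rdim K v) \<and> g v * t = 1\<^sub>m (rdim R v) \<and> f v * s + t * g v = 1\<^sub>m (rdim E v)"
    proof -
      \<comment> \<open>On \<open>[a, b]\<close> the dimensions are 1, 2, 1; at \<open>a - 1\<close>
        and at \<open>b + 1\<close> only one middle summand and the right end are nonzero.\<close>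
      consider (mid) "v \<in> {a..b}" | (left) "v = a - 1" | (right) "v = b + 1" | (out) "v \<notin> {a - 1..b + 1}"
        by fastforce
      then show ?thesis
      proof cases
        case mid
        then have vs: "v \<in> {a - 1..b}" "v \<in> {a..b + 1}" "v \<in> {a - 1..b + 1}" by auto
        have dv: "rdim K v = 1" "rdim X v = 1" "rdim Y v = 1" "rdim R v = 1" unfolding defs using mid vs by simp_all
        have o: "x1 v = 1\<^sub>m 1" "x2 v = 1\<^sub>m 1" "y1 v = 1\<^sub>m 1" "y2 v = 1\<^sub>m 1"
          unfolding x1_def x2_def y1_def y2_def incl_def
          using mid vs(1,2) by (simp_all del: atLeastAtMost_iff)
        have "f v * p1 v + i2 v * g v = 1\<^sub>m (rdim E v)"
        proof -
          have "f v * p1 v + i2 v * g v = (i1 v - i2 v) * p1 v + i2 v * (p1 v + p2 v)"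
            unfolding f_def g_def o using c dv by simp
          also have "\<dots> = i1 v * p1 v - i2 v * p1 v + (i2 v * p1 v + i2 v * p2 v)"
            using d dv by (simp add: minus_mult_distrib_dim mult_add_distrib_dim)
          also have "\<dots> = i1 v * p1 v + i2 v * p2 v"
            using d dv by (intro eq_matI) auto
          finally show ?thesis using bi(9) dE by simp
        qed
        then show ?thesis
          using c dv pf(1)[OF v] gi(2)[OF v] o by (intro exI[of _ "p1 v"] exI[of _ "i2 v"]) auto
      next
        case left
        have ka: "v \<in> {a - 1..b}" "v \<notin> {a..b + 1}" "v \<notin> {a..b}" "v \<in> {a - 1..b + 1}"
          using left a ab by (auto simp: spans_def)
        have dv: "rdim K v = 0" "rdim X v = 1" "rdim Y v = 0" "rdim R v = 1" unfolding defs using ka by simp_all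
        have y: "y1 v = 1\<^sub>m 1" unfolding y1_def incl_def using ka by simp
        have z: "f v * 0\<^sub>m 0 (rdim E v) = 0\<^sub>m (rdim E v) (rdim E v)" "y2 v * p2 v = 0\<^sub>m 1 (rdim E v)"
          "i2 v * p2 v = 0\<^sub>m (rdim E v) (rdim E v)"
          using c dv by (auto intro!: eq_matI simp: scalar_prod_def)
        have "f v * 0\<^sub>m 0 (rdim E v) + i1 v * g v = 1\<^sub>m (rdim E v)"
        proof -
          have "g v = p1 v" unfolding g_def z y using c dv by simp
          moreover have "i1 v * p1 v = 1\<^sub>m (rdim E v)"
            using bi(9)[of v] c dv unfolding z dE by simp
          ultimately show ?thesis unfolding z(1) by simp
        qed
        moreover have "0\<^sub>m 0 (rdim E v) * f v = 1\<^sub>m 0" using c dv by (intro eq_mat_zero_row[of _ 0]) auto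
        ultimately show ?thesis
          using c dv gi(1)[OF v] y by (intro exI[of _ "0\<^sub>m 0 (rdim E v)"] exI[of _ "i1 v"]) auto
      next
        case right
        have ka: "v \<in> {a..b + 1}" "v \<notin> {a - 1..b}" "v \<notin> {a..b}" "v \<in> {a - 1..b + 1}"
          using right a ab by (auto simp: spans_def)
        have dv: "rdim K v = 0" "rdim X v = 0" "rdim Y v = 1" "rdim R v = 1" unfolding defs using ka by simp_all
        have y: "y2 v = 1\<^sub>m 1" unfolding y2_def incl_def using ka by simp
        have z: "f v * 0\<^sub>m 0 (rdim E v) = 0\<^sub>m (rdim E v) (rdim E v)" "y1 v * p1 v = 0\<^sub>m 1 (rdim E v)"
          "i1 v * p1 v = 0\<^sub>m (rdim E v) (rdim E v)"
          using c dv by (auto intro!: eq_matI simp: scalar_prod_def)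
        have "f v * 0\<^sub>m 0 (rdim E v) + i2 v * g v = 1\<^sub>m (rdim E v)"
        proof -
          have "g v = p2 v" unfolding g_def z y using c dv by simp
          moreover have "i2 v * p2 v = 1\<^sub>m (rdim E v)"
            using bi(9)[of v] c dv unfolding z dE by simp
          ultimately show ?thesis unfolding z(1) by simp
        qed
        moreover have "0\<^sub>m 0 (rdim E v) * f v = 1\<^sub>m 0" using c dv by (intro eq_mat_zero_row[of _ 0]) auto
        ultimately show ?thesis
          using c dv gi(2)[OF v] y by (intro exI[of _ "0\<^sub>m 0 (rdim E v)"] exI[of _ "i2 v"]) auto
      next
        case out
        then have "v \<notin> {a..b}" "v \<notin> {a - 1..b}" "v \<notin> {a..b + 1}" by auto
        then have dv: "rdim K v = 0" "rdim X v = 0" "rdim Y v = 0" "rdim R v = 0" unfolding defs using out by simp_all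
        then show ?thesis using c dE
          by (intro exI[of _ "0\<^sub>m 0 0"]) (auto intro!: eq_matI)
      qed
    qed
    then show "\<exists>s t. s \<in> carrier_mat (rdim K v) (rdim E v) \<and> t \<in> carrier_mat (rdim E v) (rdim R v) \<and>
      s * f v = 1\<^sub>m (rdim K v) \<and> g v * t = 1\<^sub>m (rdim R v) \<and>
      g v * f v = 0\<^sub>m (rdim R v) (rdim K v) \<and> f v * s + t * g v = 1\<^sub>m (rdim E v)"
      using gf[OF v] by blast
  qed
  have ne: "1\<^sub>m 1 \<noteq> (0\<^sub>m 1 1 :: 'k mat)" by (rule one_mat_neq_zero) simp
  have las: "left_almost_split Q K E f"
    unfolding left_almost_split_def
  proof (intro conjI allI impI)
    show "is_hom Q K E f" by fact
    \<comment> \<open>Maps from either middle term to the smaller interval \<open>K\<close> vanish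
      at the sink, so a retraction would vanish there as well.\<close>
    show "\<not> split_mono Q K E f"
    proof
      assume "split_mono Q K E f"
      then obtain k where k: "is_hom Q E K k" "k m * f m = 1\<^sub>m 1"
        unfolding split_mono_def using mv dm(1) by metis
      have "k m * i1 m = 0\<^sub>m 1 1"
        using is_hom_comp[OF wf_Q reps(2) E reps(1) bi(1) k(1)] ab a
        by (intro hom_intervals_at_sink[OF sp(1) ab, of "\<lambda>v. k v * i1 v"]) (auto simp: defs)
      moreover have "k m * i2 m = 0\<^sub>m 1 1"
        using is_hom_comp[OF wf_Q reps(3) E reps(1) bi(2) k(1)] ab
        by (intro hom_intervals_at_sink[OF sp(2) ab, of "\<lambda>v. k v * i2 v"]) (auto simp: defs)
      moreover have "k m * f m = k m * i1 m * x1 m - k m * i2 m * x2 m"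
        unfolding f_def using dd[OF mv] is_hom_carrier[OF k(1) mv]
        by (simp add: mult_minus_distrib_dim mult_assoc_dim)
      ultimately have "k m * f m = 0\<^sub>m 1 1" unfolding m1 by (auto intro!: eq_matI)
      then show False using k(2) ne by simp
    qed
    fix Z h assume Z: "is_rep Q Z" and h: "is_hom Q K Z h" and ns: "\<not> split_mono Q K Z h"
    obtain l r where l: "l \<in> img Z (a - 1)" and r: "r \<in> img Z (b + 1)" and hm: "h m = l + r"
      using not_split_mono_decompose[OF Z ab, folded K_def, OF h ns] by blast
    \<comment> \<open>The maps from the two middle terms are to be \<open>l\<close> and
      \<open>-r\<close> at the sink, because the sign in \<open>f\<close> makes \<open>h m\<close>
      their difference.\<close>
    define r' where "r' = 0\<^sub>m (rdim Z m) 1 - r"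
    have r': "r' \<in> img Z (b + 1)" unfolding r'_def by (rule img_closed(2)[OF Z img_zero[OF Z] r])
    note lc = img_carrier[OF Z l] img_carrier[OF Z r]
    obtain Yl where Yl: "family Z {a - 1..m} Yl" "Yl m = l"
      by (rule img_family_left[OF Z _ _ l]) (use sp in \<open>auto simp: spans_def\<close>)
    obtain Yr where Yr: "family Z {m..b + 1} Yr" "Yr m = r'"
      by (rule img_family_right[OF Z _ _ r']) (use sp in \<open>auto simp: spans_def\<close>)
    have "is_hom Q (interval_rep a b) Z h" using h by (simp add: K_def)
    then have hf: "family Z {a..b} h" by (rule hom_family[OF ab])
    have half: "spans a m" "spans m b" using ab m_ge m_le by (auto simp: spans_def)
    have fl: "family Z {a..m} (\<lambda>v. Yl v - h v)"
    proof (rule family_minus[OF Z spans_sub[OF half(1)] spans_nx[OF half(1)]])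
      show "family Z {a..m} Yl" by (rule family_subset[OF Yl(1)]) auto
      show "family Z {a..m} h" by (rule family_subset[OF hf]) (use ab in \<open>auto simp: spans_def\<close>)
    qed
    have fr: "family Z {m..b} (\<lambda>v. h v + Yr v)"
    proof (rule family_add[OF Z spans_sub[OF half(2)]])
      show "family Z {m..b} Yr" by (rule family_subset[OF Yr(1)]) auto
      show "family Z {m..b} h" by (rule family_subset[OF hf]) (use ab in \<open>auto simp: spans_def\<close>)
    qed
    have "Yl m = h m + Yr m" "Yl m - h m = Yr m"
      unfolding Yl(2) Yr(2) hm r'_def using lc by (auto intro!: eq_matI)
    note glued = family_glue[OF Yl(1) fr this(1)] family_glue[OF fl Yr(1) this(2)]
    \<comment> \<open>On the arm where a middle term exceeds \<open>[a, b]\<close>, the lift of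
      \<open>l\<close> or of \<open>-r\<close> reaches one vertex further than \<open>h\<close>. On
      the other arm \<open>h\<close> is corrected by the other lift, so that
      \<open>?U1 - ?U2 = h\<close> throughout \<open>[a, b]\<close>.\<close>
    let ?U1 = "\<lambda>v. if v \<le> m then Yl v else h v + Yr v" and ?U2 = "\<lambda>v. if v \<le> m then Yl v - h v else Yr v"
    define u1 where "u1 = (\<lambda>v. if v \<in> {a - 1..b} then ?U1 v else 0\<^sub>m (rdim Z v) 0)"
    define u2 where "u2 = (\<lambda>v. if v \<in> {a..b + 1} then ?U2 v else 0\<^sub>m (rdim Z v) 0)"
    have u: "is_hom Q X Z u1" "is_hom Q Y Z u2"
      unfolding defs u1_def u2_def by (rule family_hom[OF Z sp(1) glued(1)], rule family_hom[OF Z sp(2) glued(2)])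
    let ?h' = "\<lambda>v. u1 v * p1 v + u2 v * p2 v"
    have h': "is_hom Q E Z ?h'"
      by (rule is_hom_add[OF wf_Q E Z is_hom_comp[OF wf_Q E reps(2) Z bi(3) u(1)] is_hom_comp[OF wf_Q E reps(3) Z bi(4) u(2)]])
    have "h v = ?h' v * f v" if v: "v \<in> verts Q" for v
    proof -
      note c = cc[OF v] is_hom_carrier[OF u(1) v] is_hom_carrier[OF u(2) v] is_hom_carrier[OF f v] is_hom_carrier[OF h v]
      note d = c[THEN carrier_matD(1)] c[THEN carrier_matD(2)]
      show ?thesis
      proof (cases "v \<in> {a..b}")
        case True
        then have vs: "v \<in> {a - 1..b}" "v \<in> {a..b + 1}" by auto
        have o: "x1 v = 1\<^sub>m 1" "x2 v = 1\<^sub>m 1" unfolding x1_def x2_def incl_def using True by simp_all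
        have dv: "rdim K v = 1" "rdim X v = 1" "rdim Y v = 1" unfolding defs using True vs by simp_all
        have "?h' v * f v = u1 v * (p1 v * f v) + u2 v * (p2 v * f v)"
          using d by (simp add: add_mult_distrib_dim mult_assoc_dim)
        also have "\<dots> = u1 v - u2 v"
          unfolding pf[OF v] o using c dv by (auto intro!: eq_matI simp: scalar_prod_def)
        also have "\<dots> = ?U1 v - ?U2 v" unfolding u1_def u2_def if_P[OF vs(1)] if_P[OF vs(2)] ..
        also have "\<dots> = h v"
        proof (cases "v \<le> m")
          case vm: True
          then have "Yl v \<in> carrier_mat (rdim Z v) 1" using Yl(1) vs by (auto simp: family_def)
          then show ?thesis using vm c dv by (auto intro!: eq_matI)
        next
          case vm: False
          then have "Yr v \<in> carrier_mat (rdim Z v) 1" using Yr(1) vs by (auto simp: family_def)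
          then show ?thesis using vm c dv by (auto intro!: eq_matI)
        qed
        finally show ?thesis by simp
      next
        case False
        then have "rdim K v = 0" by (simp add: K_def)
        then show ?thesis using c is_hom_carrier[OF h' v] by (intro eq_mat_zero_col[of _ "rdim Z v"]) auto
      qed
    qed
    with h' show "\<exists>h'. is_hom Q E Z h' \<and> (\<forall>v \<in> verts Q. h v = h' v * f v)" by blast
  qed
  have ras: "right_almost_split Q E R g"
    unfolding right_almost_split_def
  proof (intro conjI allI impI)
    show "is_hom Q E R g" by fact
    show "\<not> split_epi Q E R g"
    proof
      assume "split_epi Q E R g"
      then obtain k where k: "is_hom Q R E k" "g m * k m = 1\<^sub>m 1"
        unfolding split_epi_def using mv dm(4) by metis
      have "p1 m * k m = 0\<^sub>m 1 1"
        using is_hom_comp[OF wf_Q reps(4) E reps(2) k(1) bi(3)] ab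
        by (intro hom_intervals_at_sink[OF sp(3) sp(1), of "\<lambda>v. p1 v * k v"]) (auto simp: defs)
      moreover have "p2 m * k m = 0\<^sub>m 1 1"
        using is_hom_comp[OF wf_Q reps(4) E reps(3) k(1) bi(4)] ab a
        by (intro hom_intervals_at_sink[OF sp(3) sp(2), of "\<lambda>v. p2 v * k v"]) (auto simp: defs)
      moreover have "g m * k m = y1 m * (p1 m * k m) + y2 m * (p2 m * k m)"
        unfolding g_def using dd[OF mv] is_hom_carrier[OF k(1) mv]
        by (simp add: add_mult_distrib_dim mult_assoc_dim)
      ultimately have "g m * k m = 0\<^sub>m 1 1" unfolding m1 by simp
      then show False using k(2) ne by simp
    qed
    fix Z h assume Z: "is_rep Q Z" and h: "is_hom Q Z R h" and ns: "\<not> split_epi Q Z R h"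
    have hR: "is_hom Q Z (interval_rep (a - 1) (b + 1)) h" using h by (simp add: R_def)
    have ns': "\<not> split_epi Q Z (interval_rep (a - 1) (b + 1)) h" using ns by (simp add: R_def)
    note hm = hom_row(1)[OF Z sp(3) hR]
    \<comment> \<open>A non-split \<open>h\<close> vanishes where the images of \<open>a - 1\<close>
      and \<open>b + 1\<close> meet. So \<open>h m\<close> is the sum of a row \<open>\<Phi>\<close>
      that carries its values on \<open>img Z (a - 1)\<close> and a row \<open>\<Psi>\<close> that
      carries those on \<open>img Z (b + 1)\<close>; these factor through \<open>X\<close> and
      \<open>Y\<close>.\<close>
    obtain \<Phi> where \<Phi>: "\<Phi> \<in> carrier_mat 1 (rdim Z m)" "\<And>w. w \<in> img Z (a - 1) \<Longrightarrow> \<Phi> * w = h m * w"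
      "\<And>w. w \<in> img Z (b + 1) \<Longrightarrow> \<Phi> * w = 0\<^sub>m 1 1"
      using row_extension[OF Z hm, of "a - 1" "b + 1"] not_split_epi_vanish[OF Z sp(3) hR ns'] by blast
    define \<Psi> where "\<Psi> = h m - \<Phi>"
    have \<Psi>: "\<Psi> \<in> carrier_mat 1 (rdim Z m)" unfolding \<Psi>_def by (rule minus_carrier_mat[OF \<Phi>(1)])
    have \<Psi>w: "\<Psi> * w = h m * w - \<Phi> * w" if "w \<in> img Z u" for w u
      unfolding \<Psi>_def by (rule minus_mult_distrib_mat[OF hm \<Phi>(1) img_carrier[OF Z that]])
    have out: "h m * w = 0\<^sub>m 1 1" if "w \<in> img Z (a - 1 - 1) \<or> w \<in> img Z (b + 1 + 1)" for w
      using that hom_row_img[OF Z sp(3) hR, of "a - 1 - 1" w] hom_row_img[OF Z sp(3) hR, of "b + 1 + 1" w] a by auto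
    have sub: "img Z (a - 1 - 1) \<subseteq> img Z (a - 1)" "img Z (b + 1 + 1) \<subseteq> img Z (b + 1)"
      by (rule img_mono(1)[OF Z]; use ab in \<open>auto simp: spans_def\<close>)
        (rule img_mono(2)[OF Z]; use ab in \<open>auto simp: spans_def\<close>)
    define h1 where "h1 = (\<lambda>v. if v \<in> {a - 1..b} then \<Phi> * to_sink Z v else 0\<^sub>m 0 (rdim Z v))"
    define h2 where "h2 = (\<lambda>v. if v \<in> {a..b + 1} then \<Psi> * to_sink Z v else 0\<^sub>m 0 (rdim Z v))"
    have h1: "is_hom Q Z X h1"
      unfolding X_def h1_def
    proof (rule row_hom_img[OF Z sp(1) \<Phi>(1)])
      show "\<Phi> * w = 0\<^sub>m 1 1" if "w \<in> img Z (a - 1 - 1)" for w using \<Phi>(2) out sub that by (metis subsetD)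
    qed (rule \<Phi>(3))
    have h2: "is_hom Q Z Y h2"
      unfolding Y_def h2_def
    proof (rule row_hom_img[OF Z sp(2) \<Psi>])
      show "\<Psi> * w = 0\<^sub>m 1 1" if w: "w \<in> img Z (a - 1)" for w
        using \<Psi>w[OF w] \<Phi>(2)[OF w] mult_carrier_mat[OF hm img_carrier[OF Z w]] by (auto intro!: eq_matI)
      show "\<Psi> * w = 0\<^sub>m 1 1" if w: "w \<in> img Z (b + 1 + 1)" for w
        using \<Psi>w[OF w] \<Phi>(3)[of w] sub(2) out[of w] w by (auto intro!: eq_matI)
    qed
    let ?h' = "\<lambda>v. i1 v * h1 v + i2 v * h2 v"
    have h': "is_hom Q Z E ?h'"
      by (rule is_hom_add[OF wf_Q Z E is_hom_comp[OF wf_Q Z reps(2) E h1 bi(1)] is_hom_comp[OF wf_Q Z reps(3) E h2 bi(2)]])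
    have "g m * ?h' m = g m * i1 m * h1 m + g m * i2 m * h2 m"
      using dd[OF mv] is_hom_carrier[OF g mv] is_hom_carrier[OF h1 mv] is_hom_carrier[OF h2 mv]
      by (simp add: mult_add_distrib_dim mult_assoc_dim)
    also have "\<dots> = h1 m + h2 m"
      unfolding gi[OF mv] m1 using is_hom_carrier[OF h1 mv] is_hom_carrier[OF h2 mv] dm by simp
    also have "\<dots> = \<Phi> + \<Psi>"
      using \<Phi>(1) \<Psi> spans_m[OF sp(1)] spans_m[OF sp(2)] by (simp add: h1_def h2_def to_sink_m)
    also have "\<dots> = h m" unfolding \<Psi>_def using \<Phi>(1) hm by (auto intro!: eq_matI)
    finally have "h m = g m * ?h' m" by simp
    moreover have "is_hom Q Z (interval_rep (a - 1) (b + 1)) (\<lambda>v. g v * ?h' v)"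
      using is_hom_comp[OF wf_Q Z E reps(4) h' g] by (simp add: R_def)
    ultimately have "h v = g v * ?h' v" if "v \<in> verts Q" for v
      using hom_interval_eq[OF Z sp(3) hR, of "\<lambda>v. g v * ?h' v" v] that by blast
    with h' show "\<exists>h'. is_hom Q Z E h' \<and> (\<forall>v \<in> verts Q. h v = g v * h' v)" by blast
  qed
  have "almost_split_sequence Q K f E g R" unfolding almost_split_sequence_def using ex las ras by simp
  then show ?thesis using E unfolding K_def R_def by blast
qed

section \<open>The poset of indecomposables supported at the sink\<close>

abbreviation cls :: "nat \<Rightarrow> nat \<Rightarrow> ('k :: field) vrep set" where
  "cls a b \<equiv> iso_class Q (interval_rep a b)"

lemma cls_in_ar_verts: "spans a b \<Longrightarrow> cls a b \<in> ar_verts Q"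
  using interval_indecomposable by (auto simp: ar_verts_def)

lemma cls_in_poset: "spans a b \<Longrightarrow> cls a b \<in> poset_at Q m"
  unfolding poset_at_def using interval_indecomposable spans_m by (intro imageI) auto

lemma indecomposable_cls:
  fixes V :: "('k :: field) vrep"
  assumes "indecomposable Q V" "rdim V m \<noteq> 0"
  shows "\<exists>a b. spans a b \<and> iso_class Q V = cls a b \<and> (\<forall>v \<in> {1..n}. rdim V v = (if v \<in> {a..b} then 1 else 0))"
proof -
  have V: "is_rep Q V" using assms(1) by (rule indecomposable_rep)
  obtain a b where ab: "spans a b" "rep_iso Q V (interval_rep a b :: 'k vrep)"
    using classification[OF V assms] by blast
  have "iso_class Q V = cls a b" using iso_class_eq_iff[OF wf_Q V interval_is_rep] ab(2) by blast
  moreover have "rdim V v = (if v \<in> {a..b} then 1 else 0)" if "v \<in> {1..n}" for v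
    using rep_iso_rdim[OF wf_Q ab(2), of v] that by (simp add: verts_Q)
  ultimately show ?thesis using ab(1) by blast
qed

lemma poset_cases:
  assumes "x \<in> poset_at Q m"
  obtains a b where "spans a b" "x = cls a b"
proof -
  obtain V where V: "indecomposable Q V" "rdim V m \<noteq> 0" "x = iso_class Q V"
    using assms by (auto simp: poset_at_def)
  obtain a b where "spans a b" "iso_class Q V = cls a b" using indecomposable_cls[OF V(1,2)] by blast
  then show ?thesis using that V(3) by blast
qed

lemma cls_eq_iff:
  assumes ab: "spans a b" and ab': "spans a' b'"
  shows "(cls a b :: ('k :: field) vrep set) = cls a' b' \<longleftrightarrow> a = a' \<and> b = b'"
proof
  assume "(cls a b :: 'k vrep set) = cls a' b'"
  then have iso: "rep_iso Q (interval_rep a b :: 'k vrep) (interval_rep a' b')"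
    using iso_class_eq_iff[OF wf_Q interval_is_rep interval_is_rep] by blast
  have eq: "v \<in> {a..b} \<longleftrightarrow> v \<in> {a'..b'}" if "v \<in> {1..n}" for v
  proof -
    have "(if v \<in> {a..b} then 1 else 0 :: nat) = (if v \<in> {a'..b'} then 1 else 0)"
      using rep_iso_rdim[OF wf_Q iso, of v] that unfolding rdim_interval verts_Q by simp
    then show ?thesis by (metis zero_neq_one)
  qed
  have "v \<in> {a..b} \<longleftrightarrow> v \<in> {a'..b'}" for v
    using eq[of v] subsetD[OF spans_sub[OF ab], of v] subsetD[OF spans_sub[OF ab'], of v] by argo
  from this[of a] this[of b] this[of a'] this[of b'] show "a = a' \<and> b = b'"
    using ab ab' by (auto simp: spans_def)
qed simp

text \<open>The explicit sequence gives existence, and an arbitrary almost split sequence is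
  compared with it. For \<open>a = m\<close> or \<open>b = m\<close> the interval is projective, so
  every short exact sequence ending there splits.\<close>

lemma ar_translate_cls:
  fixes y :: "('k :: field) vrep set"
  assumes ab: "spans a b"
  shows "ar_translate Q (cls a b) y \<longleftrightarrow> a < m \<and> m < b \<and> y = cls (a + 1) (b - 1)"
proof
  let ?I = "interval_rep a b :: 'k vrep"
  let ?K = "interval_rep (a + 1) (b - 1) :: 'k vrep"
  have seqK: "\<exists>(E :: 'k vrep) f g. is_rep Q E \<and> almost_split_sequence Q ?K f E g ?I"
    and spK: "spans (a + 1) (b - 1)" if "a < m" "m < b"
  proof -
    show sp: "spans (a + 1) (b - 1)" using that ab by (auto simp: spans_def)
    show "\<exists>(E :: 'k vrep) f g. is_rep Q E \<and> almost_split_sequence Q ?K f E g ?I"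
      using almost_split_intervals[OF sp, where 'k = 'k] that ab by (auto simp: spans_def)
  qed
  {
    assume "ar_translate Q (cls a b) y"
    then obtain W R L E f g where W: "indecomposable Q W" "y = iso_class Q W"
      and R: "is_rep Q R" "rep_iso Q ?I R" and L: "is_rep Q L" "rep_iso Q W L"
      and E: "is_rep Q E" and seq: "almost_split_sequence Q L f E g R"
      by (auto simp: ar_translate_def ar_verts_def iso_class_def)
    have Li: "indecomposable Q L" by (rule indecomposable_iso[OF wf_Q W(1) L])
    have ex: "short_exact Q L f E g R" and ns: "\<not> split_epi Q E R g"
      using seq by (auto simp: almost_split_sequence_def right_almost_split_def)
    have "\<not> (a = m \<or> b = m)"
      using no_short_exact_to_projective[OF ab _ E R ex] ns by blast
    then have lt: "a < m" "m < b" using ab by (auto simp: spans_def)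
    obtain B :: "'k vrep" and f' g' where B: "is_rep Q B" "almost_split_sequence Q ?K f' B g' ?I"
      using seqK[OF lt] by blast
    have "rep_iso Q L ?K"
      using almost_split_sequence_unique_left[OF wf_Q interval_is_rep B(1) interval_is_rep E R(1) B(2) seq R(2) Li
          interval_nonzero[OF spK[OF lt]] _ interval_endo[OF spK[OF lt]]] by simp
    then have "iso_class Q L = iso_class Q ?K" using iso_class_eq_iff[OF wf_Q L(1) interval_is_rep] by blast
    moreover have "iso_class Q L = y"
      using iso_class_eq_iff[OF wf_Q indecomposable_rep[OF W(1)] L(1)] L(2) W(2) by blast
    ultimately show "a < m \<and> m < b \<and> y = cls (a + 1) (b - 1)" using lt by simp
  next
    assume r: "a < m \<and> m < b \<and> y = cls (a + 1) (b - 1)"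
    then obtain E :: "'k vrep" and f g where
      E: "is_rep Q E" "almost_split_sequence Q ?K f E g ?I" using seqK by blast
    have "?I \<in> cls a b" "?K \<in> cls (a + 1) (b - 1)"
      by (rule iso_class_self[OF wf_Q interval_is_rep])+
    then show "ar_translate Q (cls a b) y"
      unfolding ar_translate_def using r cls_in_ar_verts[OF ab] cls_in_ar_verts[OF spK] E by blast
  }
qed

lemma ar_translate_trancl_cls:
  fixes y :: "('k :: field) vrep set"
  assumes ab: "spans a b"
  shows "(ar_translate Q)\<^sup>+\<^sup>+ (cls a b) y \<longleftrightarrow> (\<exists>k \<ge> 1. spans (a + k) (b - k) \<and> k \<le> b \<and> y = cls (a + k) (b - k))"
proof
  assume "(ar_translate Q)\<^sup>+\<^sup>+ (cls a b) y"
  then show "\<exists>k \<ge> 1. spans (a + k) (b - k) \<and> k \<le> b \<and> y = cls (a + k) (b - k)"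
  proof (induction rule: tranclp_induct)
    case (base y)
    then show ?case using ar_translate_cls[OF ab, of y] ab by (intro exI[of _ 1]) (auto simp: spans_def)
  next
    case (step y z)
    then obtain k where k: "1 \<le> k" "spans (a + k) (b - k)" "k \<le> b" "y = cls (a + k) (b - k)" by blast
    have "a + k < m \<and> m < b - k \<and> z = cls (a + k + 1) (b - k - 1)"
      using step(2) ar_translate_cls[OF k(2), of z] k(4) by simp
    then show ?case using k by (intro exI[of _ "k + 1"]) (auto simp: spans_def)
  qed
next
  assume "\<exists>k \<ge> 1. spans (a + k) (b - k) \<and> k \<le> b \<and> y = cls (a + k) (b - k)"
  then obtain k where k: "1 \<le> k" "spans (a + k) (b - k)" "y = cls (a + k) (b - k)" by blast
  have "spans (a + k) (b - k) \<Longrightarrow> (ar_translate Q)\<^sup>+\<^sup>+ (cls a b) (cls (a + k) (b - k) :: 'k vrep set)"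
    using k(1)
  proof (induction k rule: dec_induct)
    case base
    then show ?case using ar_translate_cls[OF ab, where 'k = 'k] by (intro tranclp.r_into_trancl) (auto simp: spans_def)
  next
    case (step k)
    have sp: "spans (a + k) (b - k)" using step.prems ab by (auto simp: spans_def)
    have "ar_translate Q (cls (a + k) (b - k)) (cls (a + Suc k) (b - Suc k) :: 'k vrep set)"
      using ar_translate_cls[OF sp, where 'k = 'k] step.prems ab by (auto simp: spans_def)
    then show ?case using step.IH[OF sp] by (rule tranclp.trancl_into_trancl[rotated])
  qed
  then show "(ar_translate Q)\<^sup>+\<^sup>+ (cls a b) y" using k by simp
qed

text \<open>The arrow relation lies between enlargement by one vertex and proper containment, and
  both of these have proper containment as transitive closure.\<close>

lemma poset_less_cls:
  assumes ab: "spans a b" and ab': "spans a' b'"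
  shows "poset_less Q m (cls a b :: ('k :: field) vrep set) (cls a' b') \<longleftrightarrow>
    a' \<le> a \<and> b \<le> b' \<and> (a, b) \<noteq> (a', b')"
proof
  let ?r = "\<lambda>x y :: 'k vrep set. x \<in> poset_at Q m \<and> y \<in> poset_at Q m \<and> ar_arrow Q x y"
  have sound: "\<forall>c d. spans c d \<and> y = cls c d \<longrightarrow> c \<le> a \<and> b \<le> d \<and> (a, b) \<noteq> (c, d)"
    if "?r\<^sup>+\<^sup>+ (cls a b) y" for y :: "'k vrep set"
    using that
  proof (induction rule: tranclp_induct)
    case (base y)
    then show ?case using ar_arrow_intervals[OF ab] by blast
  next
    case (step y z)
    obtain c d where cd: "spans c d" "y = cls c d" using step(2) poset_cases by blast
    then have 1: "c \<le> a \<and> b \<le> d \<and> (a, b) \<noteq> (c, d)" using step.IH by blast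
    show ?case
    proof (intro allI impI)
      fix e f assume ef: "spans e f \<and> z = cls e f"
      have "e \<le> c \<and> d \<le> f \<and> (c, d) \<noteq> (e, f)"
        using ar_arrow_intervals[OF cd(1), of e f, where 'k = 'k] step(2) ef cd(2) by blast
      then show "e \<le> a \<and> b \<le> f \<and> (a, b) \<noteq> (e, f)" using 1 by auto
    qed
  qed
  show "a' \<le> a \<and> b \<le> b' \<and> (a, b) \<noteq> (a', b')"
    if "poset_less Q m (cls a b :: 'k vrep set) (cls a' b')"
    using sound[of "cls a' b'"] that ab' unfolding poset_less_def by blast
  have arrow: "?r (cls c d) (cls c' d')"
    if sp: "spans c d" "spans c' d'" and "c' + 1 = c \<and> d' = d \<or> c' = c \<and> d' = d + 1" for c d c' d'
  proof -
    have st: "1 < c \<and> c' = c - 1 \<and> d' = d \<or> d < n \<and> c' = c \<and> d' = d + 1" using that by (auto simp: spans_def)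
    have "ar_arrow Q (cls c d :: 'k vrep set) (cls c' d')"
      unfolding ar_arrow_def
      using cls_in_ar_verts[OF sp(1)] cls_in_ar_verts[OF sp(2)] irreducible_incl[OF sp(1) st]
        iso_class_self[OF wf_Q interval_is_rep[of c d]] iso_class_self[OF wf_Q interval_is_rep[of c' d']] by blast
    then show ?thesis using cls_in_poset[OF sp(1)] cls_in_poset[OF sp(2)] by blast
  qed
  show "poset_less Q m (cls a b :: 'k vrep set) (cls a' b')"
    if le: "a' \<le> a \<and> b \<le> b' \<and> (a, b) \<noteq> (a', b')"
  proof -
    have "spans c d \<Longrightarrow> c \<le> a \<Longrightarrow> b \<le> d \<Longrightarrow> ?r\<^sup>*\<^sup>* (cls a b) (cls c d)" for c d
    proof (induction "(a - c) + (d - b)" arbitrary: c d)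
      case 0
      then have "c = a" "d = b" by auto
      then show ?case by simp
    next
      case (Suc k)
      show ?case
      proof (cases "c < a")
        case True
        then have sp: "spans (c + 1) d" using Suc.prems ab by (auto simp: spans_def)
        have "?r\<^sup>*\<^sup>* (cls a b) (cls (c + 1) d)" by (rule Suc(1)) (use Suc.hyps(2) Suc.prems True sp in auto)
        moreover have "?r (cls (c + 1) d) (cls c d)" by (rule arrow[OF sp Suc.prems(1)]) simp
        ultimately show ?thesis by (rule rtranclp.rtrancl_into_rtrancl)
      next
        case False
        then have d: "b < d" using Suc.hyps(2) Suc.prems by auto
        then have sp: "spans c (d - 1)" using Suc.prems ab by (auto simp: spans_def)
        have "?r\<^sup>*\<^sup>* (cls a b) (cls c (d - 1))" by (rule Suc(1)) (use Suc.hyps(2) Suc.prems d sp in auto)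
        moreover have "?r (cls c (d - 1)) (cls c d)" by (rule arrow[OF sp Suc.prems(1)]) (use d in simp)
        ultimately show ?thesis by (rule rtranclp.rtrancl_into_rtrancl)
      qed
    qed
    then have "?r\<^sup>*\<^sup>* (cls a b) (cls a' b')" using le ab' by blast
    moreover have "(cls a b :: 'k vrep set) \<noteq> cls a' b'" using cls_eq_iff[OF ab ab'] le by blast
    ultimately show ?thesis unfolding poset_less_def by (meson rtranclpD)
  qed
qed

lemma poset_less_in_poset: "poset_less Q m x y \<Longrightarrow> x \<in> poset_at Q m \<and> y \<in> poset_at Q m"
  unfolding poset_less_def by (induction rule: tranclp_induct) auto

lemma covered_by_cls:
  assumes ab: "spans a b" and ab': "spans a' b'"
  shows "covered_by Q m (cls a b :: ('k :: field) vrep set) (cls a' b') \<longleftrightarrow>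
    a' + 1 = a \<and> b' = b \<or> a' = a \<and> b' = b + 1"
proof
  assume cov: "covered_by Q m (cls a b :: 'k vrep set) (cls a' b')"
  then have le: "a' \<le> a \<and> b \<le> b' \<and> (a, b) \<noteq> (a', b')"
    and no: "\<And>z :: 'k vrep set. \<not> (poset_less Q m (cls a b) z \<and> poset_less Q m z (cls a' b'))"
    using poset_less_cls[OF ab ab'] unfolding covered_by_def by blast+
  show "a' + 1 = a \<and> b' = b \<or> a' = a \<and> b' = b + 1"
  proof (rule ccontr)
    assume n: "\<not> ?thesis"
    \<comment> \<open>\<open>[a, b]\<close> enlarged by one vertex, on the left if
      \<open>[a', b']\<close> exceeds it there; this lies strictly between the two intervals if they
      differ by more than one vertex.\<close>
    define c d where "c = (if a' < a then a - 1 else a)" and "d = (if a' < a then b else b + 1)"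
    have "spans c d \<and> c \<le> a \<and> b \<le> d \<and> (a, b) \<noteq> (c, d) \<and> a' \<le> c \<and> d \<le> b' \<and> (c, d) \<noteq> (a', b')"
      using le n ab ab' by (auto simp: c_def d_def spans_def)
    then show False using no poset_less_cls[OF ab, of c d] poset_less_cls[OF _ ab', of c d] by blast
  qed
next
  assume st: "a' + 1 = a \<and> b' = b \<or> a' = a \<and> b' = b + 1"
  show "covered_by Q m (cls a b :: 'k vrep set) (cls a' b')"
    unfolding covered_by_def
  proof (intro conjI notI)
    show "poset_less Q m (cls a b :: 'k vrep set) (cls a' b')"
      using st poset_less_cls[OF ab ab'] by auto
    assume "\<exists>z :: 'k vrep set. poset_less Q m (cls a b) z \<and> poset_less Q m z (cls a' b')"
    then obtain z :: "'k vrep set" where z: "poset_less Q m (cls a b) z" "poset_less Q m z (cls a' b')" by blast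
    obtain c d where cd: "spans c d" "z = cls c d" using poset_less_in_poset[OF z(1)] poset_cases by blast
    have "c \<le> a \<and> b \<le> d \<and> (a, b) \<noteq> (c, d)" "a' \<le> c \<and> d \<le> b' \<and> (c, d) \<noteq> (a', b')"
      using z unfolding cd(2) poset_less_cls[OF ab cd(1)] poset_less_cls[OF cd(1) ab'] by blast+
    then show False using st by auto
  qed
qed

text \<open>With nothing at the sink, \<open>V\<close> is the direct sum of its restrictions to the
  two sides, and identity matrices give the isomorphism. Such modules occur in every listing of all
  indecomposables but are not covered by the classification into intervals containing
  \<open>m\<close>.\<close>

lemma one_sided:
  fixes V :: "('k :: field) vrep"
  assumes ind: "indecomposable Q V" and Vm: "rdim V m = 0"
  shows "(\<forall>v \<in> {1..n}. m \<le> v \<longrightarrow> rdim V v = 0) \<or> (\<forall>v \<in> {1..n}. v \<le> m \<longrightarrow> rdim V v = 0)"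
proof -
  have V: "is_rep Q V" using ind by (rule indecomposable_rep)
  define X Y :: "'k vrep" where
    "X = \<lparr>rdim = \<lambda>v. if v < m then rdim V v else 0, rmap = \<lambda>e. if fst e < m then rmap V e else 0\<^sub>m 0 0\<rparr>" and
    "Y = \<lparr>rdim = \<lambda>v. if m \<le> v then rdim V v else 0, rmap = \<lambda>e. if m \<le> fst e then rmap V e else 0\<^sub>m 0 0\<rparr>"
  have side: "v < m \<and> nx v = m \<or> v < m \<and> nx v < m \<or> m < v \<and> m \<le> nx v" if "v \<noteq> m" for v
    using that by (auto simp: nx_def)
  have c: "rmap V (v, nx v) \<in> carrier_mat (rdim V (nx v)) (rdim V v)" if "v \<in> {1..n} - {m}" for v
    using V that unfolding is_rep_iff by blast
  have "rmap X (v, nx v) \<in> carrier_mat (rdim X (nx v)) (rdim X v) \<and>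
      rmap Y (v, nx v) \<in> carrier_mat (rdim Y (nx v)) (rdim Y v)" if v: "v \<in> {1..n} - {m}" for v
    using c[OF v] v side[of v] Vm by (auto simp: X_def Y_def)
  then have XY: "is_rep Q X" "is_rep Q Y" unfolding is_rep_iff by blast+
  have dim: "rdim (direct_sum [X, Y]) v = rdim V v" for v by (auto simp: direct_sum_def X_def Y_def)
  have map: "rmap (direct_sum [X, Y]) (v, nx v) = rmap V (v, nx v)" if v: "v \<in> {1..n} - {m}" for v
  proof (cases "v < m")
    case True
    then have "rmap (direct_sum [X, Y]) (v, nx v) = diag_block_mat [rmap V (v, nx v), 0\<^sub>m 0 0]"
      by (simp add: direct_sum_def X_def Y_def)
    then show ?thesis unfolding diag_block_mat_pair[OF c[OF v] zero_carrier_mat] four_block_mat_empty(1)[OF c[OF v]] .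
  next
    case False
    then have "rmap (direct_sum [X, Y]) (v, nx v) = diag_block_mat [0\<^sub>m 0 0, rmap V (v, nx v)]"
      by (simp add: direct_sum_def X_def Y_def)
    then show ?thesis unfolding diag_block_mat_pair[OF zero_carrier_mat c[OF v]] four_block_mat_empty(2)[OF c[OF v]] .
  qed
  let ?id = "\<lambda>v. 1\<^sub>m (rdim V v) :: 'k mat"
  have "1\<^sub>m (rdim V (nx v)) * rmap V (v, nx v) = rmap V (v, nx v) * 1\<^sub>m (rdim V v)"
    if "v \<in> {1..n} - {m}" for v
    using c[OF that] by simp
  then have "is_hom Q V (direct_sum [X, Y]) ?id" "is_hom Q (direct_sum [X, Y]) V ?id"
    unfolding is_hom_iff using map by (auto simp: dim simp del: atLeastAtMost_iff)
  then have "rep_iso Q V (direct_sum [X, Y])"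
    unfolding rep_iso_def by (intro exI[of _ ?id]) (simp add: dim)
  then have "is_zero_rep Q X \<or> is_zero_rep Q Y" using ind XY unfolding indecomposable_def by blast
  then show ?thesis
  proof
    assume "is_zero_rep Q X"
    then have "rdim X v = 0" if "v \<in> {1..n}" for v using that by (simp add: is_zero_rep_def verts_Q)
    then have "rdim V v = 0" if "v \<in> {1..n}" "v \<le> m" for v
      using that Vm by (cases "v = m") (force simp: X_def)+
    then show ?thesis by blast
  next
    assume "is_zero_rep Q Y"
    then have "rdim Y v = 0" if "v \<in> {1..n}" for v using that by (simp add: is_zero_rep_def verts_Q)
    then have "rdim V v = 0" if "v \<in> {1..n}" "m \<le> v" for v
      using that by (force simp: Y_def)
    then show ?thesis by blast
  qed
qed

section \<open>The comparison\<close>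

abbreviation rect :: "cell set" where "rect \<equiv> rectangle n m"

text \<open>The inverse of \<open>cell_of rect\<close>, given by explicit intervals so that
  computations avoid the description operator.\<close>

definition cell_cls :: "cell \<Rightarrow> ('k :: field) vrep set" where
  "cell_cls u = cls (snd u) (n + 1 - fst u)"

lemma rect_iff: "(i, j) \<in> rect \<longleftrightarrow> 1 \<le> i \<and> i \<le> n \<and> spans j (n + 1 - i)"
  using m_ge m_le by (auto simp: rectangle_def spans_def)

lemma cell_cls_in_poset: "u \<in> rect \<Longrightarrow> cell_cls u \<in> poset_at Q m"
  by (cases u) (simp add: cell_cls_def rect_iff cls_in_poset)

lemma cell_cls_inj: "u \<in> rect \<Longrightarrow> v \<in> rect \<Longrightarrow>
    (cell_cls u :: ('k :: field) vrep set) = cell_cls v \<longleftrightarrow> u = v"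
  by (cases u; cases v) (auto simp: cell_cls_def rect_iff cls_eq_iff)

lemma indecomposable_cell:
  fixes V :: "('k :: field) vrep"
  assumes "indecomposable Q V" "rdim V m \<noteq> 0"
  shows "\<exists>u \<in> rect. iso_class Q V = cell_cls u \<and>
    (\<forall>v \<in> rect. same_ends (hook rect v) (rim_hook rect (rdim V)) \<longleftrightarrow> v = u)"
proof -
  obtain a b where ab: "spans a b" "iso_class Q V = cls a b"
    "\<And>v. v \<in> {1..n} \<Longrightarrow> rdim V v = (if v \<in> {a..b} then 1 else 0)"
    using indecomposable_cls[OF assms] by blast
  have ab': "1 \<le> a" "a \<le> m" "m \<le> b" "b \<le> n" using ab(1) by (auto simp: spans_def)
  have "n + 1 - (n + 1 - b) = b" using ab' by simp
  then have u: "(n + 1 - b, a) \<in> rect" "iso_class Q V = cell_cls (n + 1 - b, a)"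
    using ab ab' by (auto simp: rect_iff cell_cls_def)
  have "same_ends (hook rect v) (rim_hook rect (rdim V)) \<longleftrightarrow> v = (n + 1 - b, a)" if "v \<in> rect" for v
    using same_ends_interval[OF m_ge m_le _ ab' ab(3), of "fst v" "snd v"] that by simp
  with u show ?thesis by blast
qed

lemma poset_cell_cases:
  fixes x :: "('k :: field) vrep set"
  assumes "x \<in> poset_at Q m"
  obtains u where "u \<in> rect" "x = cell_cls u"
proof -
  obtain V where "indecomposable Q V" "rdim V m \<noteq> 0" "x = iso_class Q V"
    using assms by (auto simp: poset_at_def)
  then show ?thesis using that indecomposable_cell by blast
qed

text \<open>\<open>cell_of\<close> refers to some member of the class. All members have the same
  dimensions on the quiver, so each of them leads to \<open>u\<close>.\<close>

lemma cell_of_cell_cls: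
  assumes u: "u \<in> rect"
  shows "cell_of rect (cell_cls u :: ('k :: field) vrep set) = u"
proof -
  let ?I = "interval_rep (snd u) (n + 1 - fst u) :: 'k vrep"
  have sp: "spans (snd u) (n + 1 - fst u)" using u by (cases u) (simp add: rect_iff)
  have members: "same_ends (hook rect v) (rim_hook rect (rdim V)) \<longleftrightarrow> v = u"
    if V: "V \<in> (cell_cls u :: 'k vrep set)" and v: "v \<in> rect" for V v
  proof -
    have iso: "is_rep Q V" "rep_iso Q ?I V" using V by (auto simp: cell_cls_def iso_class_def)
    have ind: "indecomposable Q V" by (rule indecomposable_iso[OF wf_Q interval_indecomposable[OF sp] iso])
    have "rdim V m = 1" using rep_iso_rdim[OF wf_Q iso(2), of m] m_in spans_m[OF sp] by (simp add: verts_Q)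
    then obtain w where w: "w \<in> rect" "iso_class Q V = cell_cls w"
      "\<And>v. v \<in> rect \<Longrightarrow> same_ends (hook rect v) (rim_hook rect (rdim V)) \<longleftrightarrow> v = w"
      using indecomposable_cell[OF ind] by auto
    have "iso_class Q V = cell_cls u" using iso_class_eqI[OF wf_Q interval_is_rep] V unfolding cell_cls_def by blast
    then have "w = u" using cell_cls_inj[OF w(1) u, where 'k = 'k] w(2) by simp
    then show ?thesis using w(3)[OF v] by simp
  qed
  have I: "?I \<in> cell_cls u" unfolding cell_cls_def by (rule iso_class_self[OF wf_Q interval_is_rep])
  show ?thesis
    unfolding cell_of_def
  proof (rule the_equality)
    show "u \<in> rect \<and> (\<exists>V \<in> (cell_cls u :: 'k vrep set). same_ends (hook rect u) (rim_hook rect (rdim V)))"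
      using u I members by blast
    show "v = u" if "v \<in> rect \<and> (\<exists>V \<in> (cell_cls u :: 'k vrep set). same_ends (hook rect v) (rim_hook rect (rdim V)))" for v
      using that members by blast
  qed
qed

lemma cell_of_bij: "bij_betw (cell_of rect) (poset_at Q m :: ('k :: field) vrep set set) rect"
proof (rule bij_betwI[where g = cell_cls])
  show "cell_of rect \<in> (poset_at Q m :: 'k vrep set set) \<rightarrow> rect"
    by (auto elim!: poset_cell_cases simp: cell_of_cell_cls)
  show "cell_cls \<in> rect \<rightarrow> (poset_at Q m :: 'k vrep set set)"
    by (simp add: cell_cls_in_poset)
  show "cell_cls (cell_of rect x) = x" if "x \<in> poset_at Q m" for x :: "'k vrep set"
    using that by (auto elim!: poset_cell_cases simp: cell_of_cell_cls)
qed (simp add: cell_of_cell_cls)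

lemma covered_by_cell_cls:
  assumes "(i, j) \<in> rect" "(i', j') \<in> rect"
  shows "covered_by Q m (cell_cls (i, j) :: ('k :: field) vrep set) (cell_cls (i', j')) \<longleftrightarrow>
    i' + 1 = i \<and> j' = j \<or> i' = i \<and> j' + 1 = j"
  using assms covered_by_cls[of j "n + 1 - i" j' "n + 1 - i'", where 'k = 'k]
  by (auto simp: rect_iff cell_cls_def)

text \<open>Larger intervals sit further northwest, so the covers are the neighbours above and to
  the left. In the first row or column a neighbour is missing; its entry 0 does no harm, as the
  values are nonnegative.\<close>

lemma max_above_cell:
  fixes \<rho> :: "('k :: field) vrep set \<Rightarrow> int"
  assumes ij: "(i, j) \<in> rect" and \<rho>: "\<And>u. u \<in> rect \<Longrightarrow> \<rho> (cell_cls u) = \<pi> u"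
    and out: "\<And>u. u \<notin> rect \<Longrightarrow> \<pi> u = 0" and nonneg: "\<And>u. 0 \<le> \<pi> u"
  shows "max_above Q m \<rho> (cell_cls (i, j)) = max (\<pi> (i - 1, j)) (\<pi> (i, j - 1))"
proof -
  let ?A = "(if 1 < i then {(i - 1, j)} else {}) \<union> (if 1 < j then {(i, j - 1)} else {})"
  have A: "?A \<subseteq> rect" using ij by (auto simp: rectangle_def)
  have S: "{y :: 'k vrep set. covered_by Q m (cell_cls (i, j)) y} = cell_cls ` ?A"
  proof (intro subset_antisym subsetI)
    fix y :: "'k vrep set" assume y: "y \<in> {y. covered_by Q m (cell_cls (i, j)) y}"
    then have "y \<in> poset_at Q m" using poset_less_in_poset by (auto simp: covered_by_def)
    then obtain u where u: "u \<in> rect" "y = cell_cls u" by (rule poset_cell_cases)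
    obtain i' j' where ij': "u = (i', j')" by (cases u)
    have "i' + 1 = i \<and> j' = j \<or> i' = i \<and> j' + 1 = j"
      using y covered_by_cell_cls[OF ij, of i' j'] u ij' by blast
    moreover have "1 \<le> i'" "1 \<le> j'" using u(1) ij' by (auto simp: rectangle_def)
    ultimately have "u \<in> ?A" using ij' by auto
    then show "y \<in> cell_cls ` ?A" using u(2) by blast
  next
    fix y :: "'k vrep set" assume "y \<in> cell_cls ` ?A"
    then obtain u where u: "u \<in> ?A" "y = cell_cls u" by blast
    obtain i' j' where ij': "u = (i', j')" by (cases u)
    have "i' + 1 = i \<and> j' = j \<or> i' = i \<and> j' + 1 = j" using u(1) ij' by (auto split: if_splits)
    then show "y \<in> {y. covered_by Q m (cell_cls (i, j)) y}"
      using covered_by_cell_cls[OF ij, of i' j', where 'k = 'k] u A ij' by blast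
  qed
  have img: "\<rho> ` cell_cls ` ?A = \<pi> ` ?A" using \<rho> A by (force simp: image_image intro!: image_cong)
  have 0: "\<not> 1 < i \<Longrightarrow> \<pi> (i - 1, j) = 0" "\<not> 1 < j \<Longrightarrow> \<pi> (i, j - 1) = 0"
    using out by (auto simp: rectangle_def)
  show ?thesis
    unfolding max_above_def Let_def S img using 0 nonneg[of "(i - 1, j)"] nonneg[of "(i, j - 1)"]
    by (cases "1 < i"; cases "1 < j") (simp_all add: max_def)
qed

text \<open>With both lower neighbours in the rectangle the minimum is not over the empty set, so
  \<open>N\<close> does not enter.\<close>

lemma min_below_cell:
  fixes \<rho> :: "('k :: field) vrep set \<Rightarrow> int"
  assumes ij: "(i, j) \<in> rect" "(i + 1, j) \<in> rect" "(i, j + 1) \<in> rect" and \<rho>: "\<And>u. u \<in> rect \<Longrightarrow> \<rho> (cell_cls u) = \<pi> u"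
  shows "min_below Q m N \<rho> (cell_cls (i, j)) = min (\<pi> (i + 1, j)) (\<pi> (i, j + 1))"
proof -
  have S: "{z :: 'k vrep set. covered_by Q m z (cell_cls (i, j))} = {cell_cls (i + 1, j), cell_cls (i, j + 1)}"
  proof (intro subset_antisym subsetI)
    fix y :: "'k vrep set" assume y: "y \<in> {z. covered_by Q m z (cell_cls (i, j))}"
    then have "y \<in> poset_at Q m" using poset_less_in_poset by (auto simp: covered_by_def)
    then obtain u where u: "u \<in> rect" "y = cell_cls u" by (rule poset_cell_cases)
    obtain i' j' where ij': "u = (i', j')" by (cases u)
    have "i + 1 = i' \<and> j = j' \<or> i = i' \<and> j + 1 = j'"
      using y covered_by_cell_cls[OF _ ij(1), of i' j'] u ij' by blast
    then show "y \<in> {cell_cls (i + 1, j), cell_cls (i, j + 1)}" using u(2) ij' by auto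
  next
    fix y :: "'k vrep set" assume "y \<in> {cell_cls (i + 1, j), cell_cls (i, j + 1)}"
    then show "y \<in> {z. covered_by Q m z (cell_cls (i, j))}"
      using covered_by_cell_cls[OF ij(2,1), where 'k = 'k] covered_by_cell_cls[OF ij(3,1), where 'k = 'k] by auto
  qed
  show ?thesis unfolding min_below_def Let_def S using \<rho>[OF ij(2)] \<rho>[OF ij(3)] by simp
qed

text \<open>The translation shrinks an interval by one vertex at each end, which is one step
  southeast along the diagonal.\<close>

lemma translates_cell:
  assumes ab: "(a, b) \<in> rect" and ij: "(i, j) \<in> rect"
  shows "(ar_translate Q)\<^sup>+\<^sup>+ (cell_cls (a, b)) (cell_cls (i, j) :: ('k :: field) vrep set) \<longleftrightarrow>
    (\<exists>k \<ge> 1. a + k = i \<and> b + k = j)"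
proof -
  have sp: "spans b (n + 1 - a)" "spans j (n + 1 - i)" and le: "a \<le> n" "i \<le> n" using ab ij by (auto simp: rect_iff)
  have eq: "(ar_translate Q)\<^sup>+\<^sup>+ (cell_cls (a, b)) (cell_cls (i, j) :: 'k vrep set) \<longleftrightarrow>
      (\<exists>k \<ge> 1. spans (b + k) (n + 1 - a - k) \<and> k \<le> n + 1 - a \<and>
        (cls j (n + 1 - i) :: 'k vrep set) = cls (b + k) (n + 1 - a - k))"
    unfolding cell_cls_def fst_conv snd_conv by (rule ar_translate_trancl_cls[OF sp(1)])
  show ?thesis unfolding eq
  proof
    assume "\<exists>k \<ge> 1. spans (b + k) (n + 1 - a - k) \<and> k \<le> n + 1 - a \<and>
        (cls j (n + 1 - i) :: 'k vrep set) = cls (b + k) (n + 1 - a - k)"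
    then obtain k where k: "k \<ge> 1" "spans (b + k) (n + 1 - a - k)"
      "(cls j (n + 1 - i) :: 'k vrep set) = cls (b + k) (n + 1 - a - k)" by blast
    then have "j = b + k \<and> n + 1 - i = n + 1 - a - k" using cls_eq_iff[OF sp(2) k(2), where 'k = 'k] by blast
    then show "\<exists>k \<ge> 1. a + k = i \<and> b + k = j"
      using k(1,2) le m_ge by (intro exI[of _ k]) (auto simp: spans_def)
  next
    assume "\<exists>k \<ge> 1. a + k = i \<and> b + k = j"
    then obtain k where k: "k \<ge> 1" "a + k = i" "b + k = j" by blast
    then have "n + 1 - a - k = n + 1 - i" by simp
    then show "\<exists>k \<ge> 1. spans (b + k) (n + 1 - a - k) \<and> k \<le> n + 1 - a \<and>
        (cls j (n + 1 - i) :: 'k vrep set) = cls (b + k) (n + 1 - a - k)"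
      using k sp(2) le by (intro exI[of _ k]) auto
  qed
qed

section \<open>From the listing to a linear extension of the rectangle\<close>

definition cells :: "(('k :: field) vrep \<times> nat) list \<Rightarrow> cell list" where
  "cells zs = map (\<lambda>(V, c). cell_of rect (iso_class Q V)) (filter (\<lambda>(V, c). rdim V m \<noteq> 0) zs)"

lemma iso_class_cell_cls:
  fixes V :: "('k :: field) vrep"
  assumes "indecomposable Q V" "rdim V m \<noteq> 0"
  shows "cell_of rect (iso_class Q V) \<in> rect" "iso_class Q V = cell_cls (cell_of rect (iso_class Q V))"
proof -
  obtain u where "u \<in> rect" "iso_class Q V = cell_cls u" using indecomposable_cell[OF assms] by blast
  then show "cell_of rect (iso_class Q V) \<in> rect" "iso_class Q V = cell_cls (cell_of rect (iso_class Q V))"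
    by (simp_all add: cell_of_cell_cls)
qed

text \<open>Modules not supported at the sink change nothing, since the translates of
  a module that is supported there are supported there as well.\<close>

lemma fold_rho_step_cells:
  fixes zs :: "(('k :: field) vrep \<times> nat) list"
  assumes "\<And>V c. (V, c) \<in> set zs \<Longrightarrow> indecomposable Q V"
    and "\<And>V c. (V, c) \<in> set zs \<Longrightarrow> rdim V m \<noteq> 0 \<Longrightarrow> F (cell_of rect (iso_class Q V)) = c"
    and "linear_extension (cells zs)" "order_ideal (set (cells zs))" "u \<in> rect"
  shows "fold (rho_step Q m N) zs (\<lambda>_. 0) (cell_cls u) = fold (pak_step F) (cells zs) (\<lambda>_. 0) u"
  using assms
proof (induction zs arbitrary: u rule: rev_induct)
  case Nil
  then show ?case by (simp add: cells_def)
next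
  case (snoc z zs)
  obtain V c where z: "z = (V, c)" by (cases z)
  define \<rho> where "\<rho> = fold (rho_step Q m N) zs (\<lambda>_. 0)"
  define \<pi> where "\<pi> = fold (pak_step F) (cells zs) (\<lambda>_. 0)"
  have V: "indecomposable Q V" using snoc.prems(1) z by auto
  obtain a b where u: "u = (a, b)" by (cases u)
  have poset: "(cell_cls u :: 'k vrep set) \<in> poset_at Q m" using snoc.prems(5) by (rule cell_cls_in_poset)
  have lhs: "fold (rho_step Q m N) (zs @ [z]) (\<lambda>_. 0) (cell_cls u) =
      (if cell_cls u = iso_class Q V then max_above Q m \<rho> (cell_cls u) + int c
       else if (ar_translate Q)\<^sup>+\<^sup>+ (cell_cls u) (iso_class Q V) then toggle Q m N (cell_cls u) \<rho> (cell_cls u)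
       else \<rho> (cell_cls u))"
    unfolding fold_append comp_apply fold.simps id_apply z \<rho>_def[symmetric]
    using poset by (simp add: rho_step_def)
  show ?case
  proof (cases "rdim V m = 0")
    case True
    then have cells: "cells (zs @ [z]) = cells zs" by (simp add: cells_def z)
    \<comment> \<open>Every class \<open>cell_cls v\<close> is supported at \<open>m\<close> while
      \<open>V\<close> is not, so neither changing branch of the step applies.\<close>
    have "iso_class Q V \<noteq> cell_cls v" if "v \<in> rect" for v
    proof
      assume "iso_class Q V = cell_cls v"
      then have "V \<in> cell_cls v" using iso_class_self[OF wf_Q indecomposable_rep[OF V]] by simp
      then have "rep_iso Q (interval_rep (snd v) (n + 1 - fst v)) V" by (simp add: cell_cls_def iso_class_def)
      from rep_iso_rdim[OF wf_Q this, of m] m_in have "rdim (interval_rep (snd v) (n + 1 - fst v) :: 'k vrep) m = 0"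
        using True by (simp add: verts_Q)
      moreover have "m \<in> {snd v..n + 1 - fst v}" using \<open>v \<in> rect\<close> by (cases v) (auto simp: rect_iff spans_def)
      ultimately show False by simp
    qed
    moreover have "\<exists>v \<in> rect. y = cell_cls v" if "(ar_translate Q)\<^sup>+\<^sup>+ (cell_cls u) y" for y :: "'k vrep set"
    proof -
      have "spans b (n + 1 - a)" using snoc.prems(5) u by (simp add: rect_iff)
      from ar_translate_trancl_cls[OF this, of y] that obtain k where "spans (b + k) (n + 1 - a - k)" "y = cls (b + k) (n + 1 - a - k)"
        by (auto simp: cell_cls_def u)
      then have "y \<in> poset_at Q m" by (simp add: cls_in_poset)
      then show ?thesis using poset_cell_cases by blast
    qed
    ultimately have "fold (rho_step Q m N) (zs @ [z]) (\<lambda>_. 0) (cell_cls u) = \<rho> (cell_cls u)"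
      unfolding lhs using snoc.prems(5) by metis
    also have "\<dots> = fold (pak_step F) (cells zs) (\<lambda>_. 0) u"
      unfolding \<rho>_def by (rule snoc.IH) (use snoc.prems cells in auto)
    finally show ?thesis using cells by simp
  next
    case False
    obtain i j where ij: "cell_of rect (iso_class Q V) = (i, j)" by fastforce
    have cells: "cells (zs @ [z]) = cells zs @ [(i, j)]" using False by (simp add: cells_def z ij)
    have cellV: "(i, j) \<in> rect" "iso_class Q V = cell_cls (i, j)" using iso_class_cell_cls[OF V False] ij by simp_all
    have F: "F (i, j) = c" using snoc.prems(2)[of V c] z ij False by simp
    have lx: "linear_extension (cells zs)" using snoc.prems(3) unfolding cells by (simp add: sorted_wrt_append)
    have oi: "order_ideal (set (cells zs))"
      by (rule order_ideal_snoc) (use snoc.prems(3,4) in \<open>simp_all only: cells\<close>)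
    have IH: "\<rho> (cell_cls v) = \<pi> v" if "v \<in> rect" for v
      unfolding \<rho>_def \<pi>_def by (rule snoc.IH) (use snoc.prems lx oi that in auto)
    note pp = fold_pak_step_plane_partition[OF lx oi, of F, folded \<pi>_def]
    have "set (cells zs) \<subseteq> rect"
      using snoc.prems(1) iso_class_cell_cls(1) by (fastforce simp: cells_def)
    then have out: "\<pi> v = 0" if "v \<notin> rect" for v using pp that by blast
    have nonneg: "0 \<le> \<pi> v" for v using pp by blast
    have uab: "(a, b) \<in> rect" using snoc.prems(5) u by simp
    have max: "max_above Q m \<rho> (cell_cls (a, b)) = max (\<pi> (a - 1, b)) (\<pi> (a, b - 1))"
      by (rule max_above_cell[where \<rho> = \<rho> and \<pi> = \<pi>, OF uab IH out nonneg])
    have rhs: "fold (pak_step F) (cells (zs @ [z])) (\<lambda>_. 0) u = pak_step F (i, j) \<pi> (a, b)"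
      unfolding cells by (simp add: \<pi>_def u)
    have eq: "(cell_cls (a, b) :: 'k vrep set) = cell_cls (i, j) \<longleftrightarrow> (a, b) = (i, j)"
      by (rule cell_cls_inj[OF uab cellV(1)])
    note tr = translates_cell[OF uab cellV(1), where 'k = 'k]
    have ab1: "1 \<le> a" "1 \<le> b" using uab by (auto simp: rectangle_def)
    have tog: "toggle Q m N (cell_cls (a, b)) \<rho> (cell_cls (a, b)) =
        max (\<pi> (a - 1, b)) (\<pi> (a, b - 1)) + min (\<pi> (a + 1, b)) (\<pi> (a, b + 1)) - \<pi> (a, b)"
      if "\<exists>k \<ge> 1. a + k = i \<and> b + k = j"
    proof -
      \<comment> \<open>A toggled cell is strictly northwest of \<open>(i, j)\<close>, so both lower
        neighbours are in the rectangle and \<open>N\<close> is not read.\<close>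
      have "(a + 1, b) \<in> rect" "(a, b + 1) \<in> rect" using that uab cellV(1) by (auto simp: rectangle_def)
      from min_below_cell[where \<rho> = \<rho> and \<pi> = \<pi>, OF uab this IH] show ?thesis
        by (simp add: toggle_def max IH[OF uab])
    qed
    show ?thesis
      unfolding lhs rhs unfolding u cellV(2) unfolding eq tr
      using tog ab1 max IH[OF uab] F by (auto simp: pak_step_def)
  qed
qed

text \<open>The intermediate members of a chain of arrows are represented in the listing, so the
  condition on single arrows propagates along the chain.\<close>

lemma ar_listing_strict:
  fixes Ms :: "('k :: field) vrep list"
  assumes L: "ar_listing Q Ms" and less: "poset_less Q m x y"
    and ij: "i < length Ms" "iso_class Q (Ms ! i) = x" "j < length Ms" "iso_class Q (Ms ! j) = y"
  shows "j < i"
proof -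
  have ind: "\<And>V. V \<in> set Ms \<Longrightarrow> indecomposable Q V"
    and ex: "\<And>W. indecomposable Q W \<Longrightarrow> \<exists>V \<in> set Ms. rep_iso Q V W"
    and arr: "\<And>i j. i < length Ms \<Longrightarrow> j < length Ms \<Longrightarrow>
      ar_arrow Q (iso_class Q (Ms ! i)) (iso_class Q (Ms ! j)) \<Longrightarrow> j < i"
    using L unfolding ar_listing_def by blast+
  have "\<forall>j < length Ms. iso_class Q (Ms ! j) = y \<longrightarrow> j < i"
    using less unfolding poset_less_def
  proof (induction rule: tranclp_induct)
    case (base y)
    then show ?case using arr[OF ij(1)] ij(2) by blast
  next
    case (step y z)
    obtain W where W: "indecomposable Q W" "y = iso_class Q W" using step(2) by (auto simp: poset_at_def)
    obtain V where V: "V \<in> set Ms" "rep_iso Q V W" using ex[OF W(1)] by blast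
    then obtain k where k: "k < length Ms" "Ms ! k = V" by (auto simp: in_set_conv_nth)
    have "iso_class Q (Ms ! k) = y"
      using iso_class_eq_iff[OF wf_Q indecomposable_rep[OF ind[OF V(1)]] indecomposable_rep[OF W(1)]] V(2) k W(2) by simp
    then show ?case using step.IH arr[OF k(1)] k(1) step(2) by (metis order.strict_trans)
  qed
  then show ?thesis using ij by blast
qed

text \<open>A cell weakly northwest of another stands for a larger interval, hence for a greater
  element of the poset, and the listing puts it earlier. Completeness of the listing makes every
  cell occur.\<close>

lemma cells_listing:
  fixes Ms :: "('k :: field) vrep list"
  assumes L: "ar_listing Q Ms" and len: "length cs = length Ms"
  shows "linear_extension (cells (zip Ms cs))" "set (cells (zip Ms cs)) = rect"
proof -
  have ind: "\<And>V. V \<in> set Ms \<Longrightarrow> indecomposable Q V"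
    and ex: "\<And>W. indecomposable Q W \<Longrightarrow> \<exists>V \<in> set Ms. rep_iso Q V W"
    and dist: "\<And>i j. i < length Ms \<Longrightarrow> j < length Ms \<Longrightarrow> rep_iso Q (Ms ! i) (Ms ! j) \<Longrightarrow> i = j"
    using L unfolding ar_listing_def by blast+
  have "sorted_wrt (\<lambda>(V, c) (V', c'). rdim V m \<noteq> 0 \<longrightarrow> rdim V' m \<noteq> 0 \<longrightarrow>
      \<not> (fst (cell_of rect (iso_class Q V')) \<le> fst (cell_of rect (iso_class Q V)) \<and>
         snd (cell_of rect (iso_class Q V')) \<le> snd (cell_of rect (iso_class Q V)))) (zip Ms cs)"
    unfolding sorted_wrt_iff_nth_less
  proof (clarsimp simp: len)
    fix k l assume kl: "k < l" "l < length Ms" "0 < rdim (Ms ! k) m" "0 < rdim (Ms ! l) m"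
      "fst (cell_of rect (iso_class Q (Ms ! l))) \<le> fst (cell_of rect (iso_class Q (Ms ! k)))"
      "snd (cell_of rect (iso_class Q (Ms ! l))) \<le> snd (cell_of rect (iso_class Q (Ms ! k)))"
    have I: "indecomposable Q (Ms ! k)" "indecomposable Q (Ms ! l)" using ind kl by simp_all
    obtain i j i' j' where c: "cell_of rect (iso_class Q (Ms ! k)) = (i, j)" "cell_of rect (iso_class Q (Ms ! l)) = (i', j')"
      by fastforce
    note k = iso_class_cell_cls[OF I(1), unfolded c(1)] and l = iso_class_cell_cls[OF I(2), unfolded c(2)]
    have kr: "(i, j) \<in> rect" "iso_class Q (Ms ! k) = cell_cls (i, j)" using k kl(3) by simp_all
    have lr: "(i', j') \<in> rect" "iso_class Q (Ms ! l) = cell_cls (i', j')" using l kl(4) by simp_all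
    have le: "i' \<le> i" "j' \<le> j" using kl c by simp_all
    have "(i, j) \<noteq> (i', j')"
    proof
      assume "(i, j) = (i', j')"
      then have "rep_iso Q (Ms ! k) (Ms ! l)"
        using kr lr iso_class_eq_iff[OF wf_Q I[THEN indecomposable_rep]] by simp
      then show False using dist[of k l] kl by simp
    qed
    then have "poset_less Q m (cell_cls (i, j) :: 'k vrep set) (cell_cls (i', j'))"
      using poset_less_cls[of j "n + 1 - i" j' "n + 1 - i'", where 'k = 'k] kr(1) lr(1) le
      by (auto simp: cell_cls_def rect_iff)
    from ar_listing_strict[OF L this _ kr(2) _ lr(2)] show False using kl by simp
  qed
  then have "sorted_wrt (\<lambda>(V, c) (V', c'). rdim V m \<noteq> 0 \<longrightarrow> rdim V' m \<noteq> 0 \<longrightarrow>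
      \<not> (fst (cell_of rect (iso_class Q V')) \<le> fst (cell_of rect (iso_class Q V)) \<and>
         snd (cell_of rect (iso_class Q V')) \<le> snd (cell_of rect (iso_class Q V))))
      (filter (\<lambda>(V, c). rdim V m \<noteq> 0) (zip Ms cs))"
    by (rule sorted_wrt_filter)
  then show "linear_extension (cells (zip Ms cs))"
    unfolding cells_def sorted_wrt_map
    by (rule sorted_wrt_mono_rel[rotated]) (auto simp: case_prod_beta)
  show "set (cells (zip Ms cs)) = rect"
  proof (intro subset_antisym subsetI)
    fix u assume "u \<in> set (cells (zip Ms cs))"
    then obtain V c where "(V, c) \<in> set (zip Ms cs)" "rdim V m \<noteq> 0" "u = cell_of rect (iso_class Q V)"
      by (auto simp: cells_def)
    then show "u \<in> rect" using iso_class_cell_cls(1) ind by (metis set_zip_leftD)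
  next
    fix u assume u: "u \<in> rect"
    let ?I = "interval_rep (snd u) (n + 1 - fst u) :: 'k vrep"
    have sp: "spans (snd u) (n + 1 - fst u)" using u by (cases u) (simp add: rect_iff)
    obtain V where V: "V \<in> set Ms" "rep_iso Q V ?I" using ex[OF interval_indecomposable[OF sp]] by blast
    have Vm: "rdim V m \<noteq> 0" using rep_iso_rdim[OF wf_Q V(2), of m] m_in spans_m[OF sp] by (simp add: verts_Q)
    have "iso_class Q V = cell_cls u"
      unfolding cell_cls_def using iso_class_eq_iff[OF wf_Q indecomposable_rep[OF ind[OF V(1)]] interval_is_rep] V(2) by blast
    then have cu: "cell_of rect (iso_class Q V) = u" using cell_of_cell_cls[OF u] by simp
    obtain c where "(V, c) \<in> set (zip Ms cs)"
      using V(1) len by (metis in_set_impl_in_set_zip1)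
    then show "u \<in> set (cells (zip Ms cs))" using Vm cu by (force simp: cells_def)
  qed
qed

text \<open>A rim hook of a module supported at \<open>m\<close> matches exactly one cell, the
  listed classes are distinct, and modules vanishing at \<open>m\<close> match no cell; so a single
  summand survives.\<close>

lemma hook_filling_listing:
  fixes Ms :: "('k :: field) vrep list"
  assumes L: "ar_listing Q Ms" and len: "length cs = length Ms" and Vc: "(V, c) \<in> set (zip Ms cs)" and Vm: "rdim V m \<noteq> 0"
  shows "hook_filling rect (rim_hooks_of rect Ms cs) (cell_of rect (iso_class Q V)) = c"
proof -
  have ind: "\<And>V. V \<in> set Ms \<Longrightarrow> indecomposable Q V"
    and dist: "\<And>i j. i < length Ms \<Longrightarrow> j < length Ms \<Longrightarrow> rep_iso Q (Ms ! i) (Ms ! j) \<Longrightarrow> i = j"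
    using L unfolding ar_listing_def by blast+
  obtain k where k: "k < length Ms" "V = Ms ! k" "c = cs ! k" using Vc by (auto simp: in_set_zip len)
  let ?u = "cell_of rect (iso_class Q V)"
  have V: "indecomposable Q V" using ind k by simp
  note u = iso_class_cell_cls[OF V Vm]
  have iff: "same_ends (hook rect ?u) (rim_hook rect (rdim (Ms ! l))) \<longleftrightarrow> l = k" if l: "l < length Ms" for l
  proof (cases "rdim (Ms ! l) m = 0")
    case True
    have "\<not> same_ends (hook rect (fst ?u, snd ?u)) (rim_hook rect (rdim (Ms ! l)))"
      by (rule same_ends_one_sided[OF m_ge m_le _ one_sided]) (use u(1) ind l True in auto)
    then show ?thesis using True Vm k by auto
  next
    case False
    have Il: "indecomposable Q (Ms ! l)" using ind l by simp
    obtain w where w: "w \<in> rect" "iso_class Q (Ms ! l) = cell_cls w"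
      "\<And>v. v \<in> rect \<Longrightarrow> same_ends (hook rect v) (rim_hook rect (rdim (Ms ! l))) \<longleftrightarrow> v = w"
      using indecomposable_cell[OF Il False] by blast
    have "same_ends (hook rect ?u) (rim_hook rect (rdim (Ms ! l))) \<longleftrightarrow> ?u = w" by (rule w(3)[OF u(1)])
    also have "\<dots> \<longleftrightarrow> iso_class Q V = iso_class Q (Ms ! l)"
      using cell_cls_inj[OF u(1) w(1), where 'k = 'k] u(2) w(2) by simp
    also have "\<dots> \<longleftrightarrow> rep_iso Q V (Ms ! l)"
      by (rule iso_class_eq_iff[OF wf_Q indecomposable_rep[OF V] indecomposable_rep[OF Il]])
    also have "\<dots> \<longleftrightarrow> l = k"
      using dist[OF k(1) l] rep_iso_refl[OF wf_Q indecomposable_rep[OF V]] k(2) by auto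
    finally show ?thesis .
  qed
  have "hook_filling rect (rim_hooks_of rect Ms cs) ?u =
      (\<Sum>l<length Ms. if same_ends (hook rect ?u) (rim_hook rect (rdim (Ms ! l))) then cs ! l else 0)"
    unfolding hook_filling_rim_hooks_of by (simp add: sum_list_sum_nth len atLeast0LessThan)
  also have "\<dots> = (\<Sum>l<length Ms. if l = k then cs ! l else 0)"
    by (intro sum.cong) (auto simp: iff)
  also have "\<dots> = c" using k by simp
  finally show ?thesis .
qed

theorem rho_eq_pak:
  fixes Ms :: "('k :: field) vrep list"
  assumes listing: "ar_listing Q Ms" "length cs = length Ms" and us: "standard_order rect us"
    and x: "x \<in> poset_at Q m"
  shows "rho Q m N Ms cs x = pak rect us (rim_hooks_of rect Ms cs) (cell_of rect x)"
proof -
  obtain u where u: "u \<in> rect" "x = cell_cls u" using poset_cell_cases[OF x] by blast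
  let ?F = "hook_filling rect (rim_hooks_of rect Ms cs)"
  note cells = cells_listing[OF listing]
  have us: "set us = rect" "linear_extension us" using us by (auto simp: standard_order_def)
  have "rho Q m N Ms cs x = fold (pak_step ?F) (cells (zip Ms cs)) (\<lambda>_. 0) u"
    unfolding rho_def u(2)
  proof (rule fold_rho_step_cells[OF _ _ cells(1) _ u(1)])
    show "indecomposable Q V" if "(V, c) \<in> set (zip Ms cs)" for V c
      using listing(1) that unfolding ar_listing_def by (metis set_zip_leftD)
    show "?F (cell_of rect (iso_class Q V)) = c" if "(V, c) \<in> set (zip Ms cs)" "rdim V m \<noteq> 0" for V c
      by (rule hook_filling_listing[OF listing that])
    show "order_ideal (set (cells (zip Ms cs)))"
      unfolding cells(2) by (auto simp: order_ideal_def rectangle_def)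
  qed
  also have "fold (pak_step ?F) (cells (zip Ms cs)) (\<lambda>_. 0) = fold (pak_step ?F) us (\<lambda>_. 0)"
    by (rule fold_pak_step_unique) (use cells us in \<open>auto simp: rectangle_def\<close>)
  finally show ?thesis unfolding pak_def u(2) cell_of_cell_cls[OF u(1)] .
qed

end

theorem theorem11:
  fixes n m N :: nat
    and M :: "(nat, nat \<times> nat, 'k :: alg_closed_field) qrep"
    and Ms :: "(nat, nat \<times> nat, 'k) qrep list"
    and cs :: "nat list"
    and us :: "(nat \<times> nat) list"
  assumes "1 \<le> m" and "m \<le> n"
    and "in_category (quiver_A n m) m M"
    and "ar_listing (quiver_A n m) Ms"
    and "length cs = length Ms"
    and "rep_iso (quiver_A n m) M (direct_sum_powers Ms cs)"
    and "standard_order (rectangle n m) us"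
  shows "bij_betw (cell_of (rectangle n m))
           (poset_at (quiver_A n m) m :: (nat, nat \<times> nat, 'k) qrep set set) (rectangle n m)
       \<and> (\<forall>x \<in> poset_at (quiver_A n m) m.
            rho (quiver_A n m) m N Ms cs x =
            pak (rectangle n m) us (rim_hooks_of (rectangle n m) Ms cs) (cell_of (rectangle n m) x))"
proof -
  have "sink_quiver n m" using assms(1,2) by (rule sink_quiver.intro)
  then show ?thesis
    using sink_quiver.cell_of_bij sink_quiver.rho_eq_pak[OF _ assms(4,5,7)] by blast
qed

end
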